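(* Let $q$ be a prime power, let $n\ge 1$, and let $H$ be a group with $\operatorname{SL}(n,q)\le H\le \operatorname{GL}(n,q)$ and $e=[H:\operatorname{SL}(n,q)]<q-1$. Let $AH=\mathbb{F}_q^n\rtimes H$ with $H$ acting naturally on $\mathbb{F}_q^n$. Then $k(AH)<q^n$, except in the cases $k(\operatorname{ASL}(1,q))=q$ and $k(\operatorname{ASL}(2,3))=10$ (where $\operatorname{ASL}(n,q)=\mathbb{F}_q^n\rtimes\operatorname{SL}(n,q)$).
   Context: For a finite group $X$, $k(X)$ denotes the number of conjugacy classes of $X$. *)

theory Defs
  imports
    "HOL-Library.Cardinality"
    "HOL-Algebra.Group_Action"
    "Jordan_Normal_Form.Determinant"
begin

text \<open>
  Dimensions are explicit natural numbers, using the matrices and vectors of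
  \<open>Jordan_Normal_Form\<close>. The entries are taken from a type of class \<open>{field, finite}\<close>, which plays
  the role of \<open>F_q\<close> with \<open>q = CARD('a)\<close>; such a cardinality is automatically a prime power.
\<close>

definition GL :: "nat \<Rightarrow> 'a::field mat monoid" where
  "GL n = units_of (ring_mat TYPE('a) n ())"

definition SL :: "nat \<Rightarrow> 'a::field mat set" where
  "SL n = {A \<in> carrier (GL n). det A = 1}"

definition subgroup_index :: "('a, 'b) monoid_scheme \<Rightarrow> 'a set \<Rightarrow> 'a set \<Rightarrow> nat" where
  "subgroup_index G H K = card (rcosets\<^bsub>G\<lparr>carrier := H\<rparr>\<^esub> K)"

definition semidirect_product ::
  "('n, 'c) monoid_scheme \<Rightarrow> ('h, 'd) monoid_scheme \<Rightarrow> ('h \<Rightarrow> 'n \<Rightarrow> 'n) \<Rightarrow> ('n \<times> 'h) monoid" where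
  "semidirect_product N H \<phi> =
     \<lparr>carrier = carrier N \<times> carrier H,
      monoid.mult = (\<lambda>(a, g) (b, h). (a \<otimes>\<^bsub>N\<^esub> \<phi> g b, g \<otimes>\<^bsub>H\<^esub> h)),
      one = (\<one>\<^bsub>N\<^esub>, \<one>\<^bsub>H\<^esub>)\<rparr>"

definition affine_ext :: "nat \<Rightarrow> 'a::field mat set \<Rightarrow> ('a vec \<times> 'a mat) monoid" where
  "affine_ext n H =
     semidirect_product (monoid_vec TYPE('a) n) ((GL n)\<lparr>carrier := H\<rparr>) (\<lambda>A v. A *\<^sub>v v)"

definition conjugacy_classes :: "('a, 'b) monoid_scheme \<Rightarrow> 'a set set" where
  "conjugacy_classes G =
     orbits G (carrier G) (\<lambda>g. \<lambda>x \<in> carrier G. g \<otimes>\<^bsub>G\<^esub> x \<otimes>\<^bsub>G\<^esub> inv\<^bsub>G\<^esub> g)"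

definition class_number :: "('a, 'b) monoid_scheme \<Rightarrow> nat" where
  "class_number G = card (conjugacy_classes G)"

end

theory Submission
  imports
    Defs
    "HOL-Algebra.Multiplicative_Group"
begin

text \<open>Let \<open>D\<close> be the image of \<open>H\<close> under the determinant, of order \<open>e\<close>, put \<open>m = (q - 1) / e\<close> (so \<open>m \<ge> 2\<close>), let
  \<open>H\<^sub>n\<close> be the group of matrices of size \<open>n\<close> with determinant in \<open>D\<close>, and let \<open>K n = k(AH\<^sub>n)\<close>. By Burnside's
  lemma, class numbers are counted by commuting pairs. For commuting \<open>g\<close> and \<open>h\<close>, the number of commuting
  pairs \<open>(a, g)\<close>, \<open>(b, h)\<close> above them is \<open>q\<^sup>n\<close> times the number of row vectors fixed by both. As \<open>SL(n, q)\<close> is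
  transitive on the nonzero row vectors, with stabilizers that are affine groups in dimension \<open>n - 1\<close>, this
  gives \<open>K (n + 1) = k(H\<^bsub>n+1\<^esub>) + K n\<close> and \<open>K 1 = e + m\<close>.

  For \<open>k(H\<^sub>n)\<close>, the condition on determinants is detected by the powers of a character \<open>\<chi>\<close> of order \<open>m\<close> with
  kernel \<open>D\<close>. The substitutions \<open>(g, h) \<mapsto> (g, g h)\<close> and \<open>(g, h) \<mapsto> (h, g)\<close> permute the commuting pairs of
  \<open>GL(n, q)\<close>, so the sum of \<open>\<chi>(det g)\<^sup>a \<chi>(det h)\<^sup>b\<close> depends on \<open>gcd a b\<close> only and becomes a sum of one character
  over the conjugacy classes of \<open>GL(n, q)\<close>, that is, over chains of invariant factors. For a character of
  order \<open>s\<close> that sum is \<open>k(GL(n/s, q))\<close> if \<open>s\<close> divides \<open>n\<close> and \<open>0\<close> otherwise. Together with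
  \<open>k(GL(n, q)) \<le> q\<^sup>n q\<^sup>2 / (q\<^sup>2 - 1)\<close> this bounds \<open>m k(H\<^sub>n)\<close> by \<open>(q\<^sup>n + (m\<^sup>2 - 1) q\<^bsup>n/2\<^esup>) q\<^sup>2 / (q\<^sup>2 - 1)\<close>, which
  suffices for an induction on \<open>n\<close>. For \<open>q = 3\<close> the induction starts from the exact values 10, 22, 73 of \<open>K\<close>
  at 2, 3, 4.\<close>

text \<open>A conjugacy class of \<open>GL(n, q)\<close> may split in \<open>H\<close>, so the
  classes of \<open>H\<close> are never listed: they enter only through commuting pairs, and a
  parametrization of classes is needed for \<open>GL(n, q)\<close> alone. Row vectors appear because
  the translation parts \<open>(a, b)\<close> above commuting \<open>g\<close> and \<open>h\<close>
  form the kernel of the linear map sending \<open>(a, b)\<close> to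
  \<open>(1 - h) a - (1 - g) b\<close>, and the cokernel of this map is dual to the functionals
  fixed by \<open>g\<close> and \<open>h\<close>. Since the field is finite, linear algebra is done
  by counting: cardinalities of subspaces replace dimensions, and bases and annihilating polynomials
  are found by pigeonhole. Numerically, dividing by \<open>m \<ge> 2\<close> leaves a main term of
  about half of \<open>q^n\<close>, to which at most \<open>q^(n-1)\<close> and the terms of the
  nontrivial characters are added. This leaves enough room only for \<open>q \<ge> 4\<close>. For
  \<open>q = 3\<close> the estimate is too weak at \<open>n = 2, 3, 4\<close>, whence the exact
  values there.\<close>

hide_const (open) UnivPoly.monom UnivPoly.coeff

section \<open>Polynomials acting on vectors\<close>

abbreviation monic :: "'a::idom poly \<Rightarrow> bool" where
  "monic f \<equiv> lead_coeff f = 1"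

text \<open>Horner's scheme for the vector \<open>p(A) v\<close>.\<close>

definition pact :: "'a::field mat \<Rightarrow> 'a poly \<Rightarrow> 'a vec \<Rightarrow> 'a vec" where
  "pact A p v = fold_coeffs (\<lambda>c w. c \<cdot>\<^sub>v v + A *\<^sub>v w) p (0\<^sub>v (dim_vec v))"

lemma mult_mat_zero_vec [simp]:
  "A \<in> carrier_mat m n \<Longrightarrow> A *\<^sub>v 0\<^sub>v n = (0\<^sub>v m :: 'a::semiring_0 vec)"
  by (intro eq_vecI) auto

lemma pact_0 [simp]: "pact A 0 v = 0\<^sub>v (dim_vec v)"
  by (simp add: pact_def)

lemma pact_pCons:
  assumes "A \<in> carrier_mat n n" "v \<in> carrier_vec n"
  shows "pact A (pCons c p) v = c \<cdot>\<^sub>v v + A *\<^sub>v pact A p v"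
proof (cases "c = 0 \<and> p = 0")
  case True
  have "0 \<cdot>\<^sub>v v + A *\<^sub>v 0\<^sub>v n = 0\<^sub>v n" using assms by (intro eq_vecI) auto
  then show ?thesis using True assms by simp
next
  case False
  then show ?thesis using assms by (auto simp: pact_def fold_coeffs_def cCons_def)
qed

lemma pact_carrier [simp]:
  assumes "A \<in> carrier_mat n n" "v \<in> carrier_vec n"
  shows "pact A p v \<in> carrier_vec n"
  by (induction p) (use assms in \<open>auto simp: pact_pCons\<close>)

text \<open>Each Horner step is linear, and \<open>P\<close> passes through one multiplication by
  \<open>A\<close> at a time. It serves for base changes and, with \<open>P = A\<close>, shows that
  \<open>A\<close> commutes with its own polynomials.\<close>

lemma pact_intertwine:
  assumes A: "A \<in> carrier_mat n n" and B: "B \<in> carrier_mat m m" and P: "P \<in> carrier_mat m n"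
    and PA: "P * A = B * P" and v: "v \<in> carrier_vec n"
  shows "P *\<^sub>v pact A p v = pact B p (P *\<^sub>v v)"
proof (induction p)
  case 0
  then show ?case using P v by simp
next
  case (pCons c p)
  have w: "pact A p v \<in> carrier_vec n" using A v by simp
  have Pv: "P *\<^sub>v v \<in> carrier_vec m" using P v by simp
  have "P *\<^sub>v pact A (pCons c p) v = P *\<^sub>v (c \<cdot>\<^sub>v v) + P *\<^sub>v (A *\<^sub>v pact A p v)"
    unfolding pact_pCons[OF A v] using A P v w by (intro mult_add_distrib_mat_vec) auto
  also have "P *\<^sub>v (c \<cdot>\<^sub>v v) = c \<cdot>\<^sub>v (P *\<^sub>v v)" using P v by (rule mult_mat_vec)
  also have "P *\<^sub>v (A *\<^sub>v pact A p v) = B *\<^sub>v (P *\<^sub>v pact A p v)"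
    using assoc_mult_mat_vec[OF P A w] assoc_mult_mat_vec[OF B P w] PA by simp
  finally show ?case using pCons.IH pact_pCons[OF B Pv] by simp
qed

lemma pact_mult_mat_vec:
  assumes "A \<in> carrier_mat n n" "v \<in> carrier_vec n"
  shows "pact A p (A *\<^sub>v v) = A *\<^sub>v pact A p v"
  using pact_intertwine[of A n A n A v p] assms by simp

lemma pact_add:
  assumes A: "A \<in> carrier_mat n n" and v: "v \<in> carrier_vec n"
  shows "pact A (p + q) v = pact A p v + pact A q v"
proof (induction p q rule: poly_induct2)
  case 0
  then show ?case using v by simp
next
  case (pCons a p b q)
  have w: "pact A p v \<in> carrier_vec n" "pact A q v \<in> carrier_vec n" using A v by simp_all
  have "A *\<^sub>v (pact A p v + pact A q v) = A *\<^sub>v pact A p v + A *\<^sub>v pact A q v"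
    using A w by (intro mult_add_distrib_mat_vec) auto
  moreover have "A *\<^sub>v pact A p v \<in> carrier_vec n" "A *\<^sub>v pact A q v \<in> carrier_vec n"
    using A w by auto
  ultimately show ?case using pCons.IH v
    by (auto simp: pact_pCons[OF A v] add_smult_distrib_vec intro!: eq_vecI)
qed

lemma pact_smult:
  assumes A: "A \<in> carrier_mat n n" and v: "v \<in> carrier_vec n"
  shows "pact A (smult c p) v = c \<cdot>\<^sub>v pact A p v"
proof (induction p)
  case 0
  then show ?case using v by (auto intro!: eq_vecI)
next
  case (pCons a p)
  have w: "pact A p v \<in> carrier_vec n" using A v by simp
  have Aw: "A *\<^sub>v pact A p v \<in> carrier_vec n" using A w by auto
  have "A *\<^sub>v (c \<cdot>\<^sub>v pact A p v) = c \<cdot>\<^sub>v (A *\<^sub>v pact A p v)" using A w by (rule mult_mat_vec)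
  then show ?case using pCons.IH v Aw
    by (auto simp: pact_pCons[OF A v] smult_smult_assoc smult_add_distrib_vec[of _ n])
qed

lemma pact_1:
  assumes A: "A \<in> carrier_mat n n" and v: "v \<in> carrier_vec n"
  shows "pact A 1 v = v"
  unfolding one_pCons pact_pCons[OF A v] using A v by simp

lemma pact_mult:
  assumes A: "A \<in> carrier_mat n n" and v: "v \<in> carrier_vec n"
  shows "pact A (p * q) v = pact A p (pact A q v)"
proof (induction p)
  case 0
  then show ?case using carrier_vecD[OF v] carrier_vecD[OF pact_carrier[OF A v]] by simp
next
  case (pCons c p)
  have w: "pact A q v \<in> carrier_vec n" and u: "pact A (p * q) v \<in> carrier_vec n"
    using A v by simp_all
  have "A *\<^sub>v pact A (p * q) v \<in> carrier_vec n" using A u by auto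
  moreover have "0 \<cdot>\<^sub>v v = 0\<^sub>v n" using v by auto
  ultimately show ?case using pCons.IH v w u
    by (simp add: pact_add[OF A v] pact_smult[OF A v] pact_pCons[OF A v] pact_pCons[OF A w])
qed

lemma pact_vec_add:
  assumes A: "A \<in> carrier_mat n n" and u: "u \<in> carrier_vec n" and v: "v \<in> carrier_vec n"
  shows "pact A p (u + v) = pact A p u + pact A p v"
proof (induction p)
  case 0
  then show ?case using u v by simp
next
  case (pCons a p)
  have w: "pact A p u \<in> carrier_vec n" "pact A p v \<in> carrier_vec n" using A u v by simp_all
  have "A *\<^sub>v (pact A p u + pact A p v) = A *\<^sub>v pact A p u + A *\<^sub>v pact A p v"
    using A w by (intro mult_add_distrib_mat_vec) auto
  moreover have "A *\<^sub>v pact A p u \<in> carrier_vec n" "A *\<^sub>v pact A p v \<in> carrier_vec n"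
    using A w by auto
  ultimately show ?case using pCons.IH u v
    by (auto simp: pact_pCons[OF A] smult_add_distrib_vec[of _ n] intro!: eq_vecI)
qed

lemma pact_zero_vec [simp]:
  assumes A: "A \<in> carrier_mat n n"
  shows "pact A p (0\<^sub>v n) = 0\<^sub>v n"
  by (induction p) (use A in \<open>auto simp: pact_pCons\<close>)

lemma pact_0_dvd:
  assumes A: "A \<in> carrier_mat n n" and v: "v \<in> carrier_vec n" and "pact A p v = 0\<^sub>v n" "p dvd q"
  shows "pact A q v = 0\<^sub>v n"
proof -
  obtain r where "q = r * p" using assms(4) by (metis dvd_def mult.commute)
  then show ?thesis using assms by (simp add: pact_mult[OF A v])
qed

lemma pact_commute:
  assumes A: "A \<in> carrier_mat n n" and v: "v \<in> carrier_vec n"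
  shows "pact A p (pact A q v) = pact A q (pact A p v)"
  unfolding pact_mult[OF A v, symmetric] by (simp only: mult.commute)

lemma pact_monom_0:
  assumes "A \<in> carrier_mat n n" "v \<in> carrier_vec n"
  shows "pact A (monom 1 0) v = v"
  using pact_1[OF assms] by (simp add: monom_0 flip: one_pCons)

lemma pact_monom_Suc:
  assumes A: "A \<in> carrier_mat n n" and v: "v \<in> carrier_vec n"
  shows "pact A (monom 1 (Suc i)) v = A *\<^sub>v pact A (monom 1 i) v"
proof -
  have "0 \<cdot>\<^sub>v v = 0\<^sub>v n" using v by auto
  then show ?thesis unfolding monom_Suc pact_pCons[OF A v] using A v by simp
qed

section \<open>Sizes of vector and matrix spaces over a finite field\<close>

lemma bij_betw_vec_of_list: "bij_betw vec_of_list {xs. length xs = n} (carrier_vec n)"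
proof (rule bij_betw_byWitness[where f' = list_of_vec])
  show "list_of_vec ` carrier_vec n \<subseteq> {xs. length xs = n}" by auto
  show "vec_of_list ` {xs. length xs = n} \<subseteq> carrier_vec n" by (auto intro: carrier_vecI)
qed (simp_all add: list_vec vec_list)

lemma finite_carrier_vec [simp]: "finite (carrier_vec n :: 'a::finite vec set)"
  using bij_betw_finite[OF bij_betw_vec_of_list[of n, where 'a='a]]
    finite_lists_length_eq[of "UNIV :: 'a set" n] by simp

lemma card_carrier_vec: "card (carrier_vec n :: 'a::finite vec set) = CARD('a) ^ n"
  using bij_betw_same_card[OF bij_betw_vec_of_list[of n, where 'a='a]] card_lists_length_eq[of "UNIV::'a set" n]
  by simp

lemma finite_carrier_mat [simp]: "finite (carrier_mat m n :: 'a::finite mat set)"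
proof (rule finite_subset)
  show "carrier_mat m n \<subseteq> (\<lambda>f. mat m n f) ` (({..<m} \<times> {..<n}) \<rightarrow>\<^sub>E (UNIV::'a set))"
  proof
    fix A :: "'a mat" assume A: "A \<in> carrier_mat m n"
    have "A = mat m n (restrict (\<lambda>ij. A $$ ij) ({..<m} \<times> {..<n}))" using A by (intro eq_matI) auto
    then show "A \<in> (\<lambda>f. mat m n f) ` (({..<m} \<times> {..<n}) \<rightarrow>\<^sub>E UNIV)"
      by (rule image_eqI[where x = "restrict (\<lambda>ij. A $$ ij) ({..<m} \<times> {..<n})"]) auto
  qed
  show "finite ((\<lambda>f. mat m n f) ` (({..<m} \<times> {..<n}) \<rightarrow>\<^sub>E (UNIV::'a set)))"
    by (intro finite_imageI finite_PiE finite_cartesian_product) simp_all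
qed

text \<open>Multiplication by \<open>X\<close> on the polynomials modulo \<open>f\<close>, in the
  basis of powers of \<open>X\<close>; the last column reduces \<open>X^k\<close> for
  \<open>k = degree f\<close>. Degree 0 gives the empty matrix, so ones in a chain are
  harmless.\<close>

definition companion :: "'a::field poly \<Rightarrow> 'a mat" where
  "companion f = mat (degree f) (degree f)
     (\<lambda>(i, j). if Suc j = degree f then - coeff f i else if i = Suc j then 1 else 0)"

lemma companion_carrier [simp]: "companion f \<in> carrier_mat (degree f) (degree f)"
  by (simp add: companion_def)

lemma companion_dim [simp]: "dim_row (companion f) = degree f" "dim_col (companion f) = degree f"
  by (simp_all add: companion_def)

lemma companion_mult_vec:
  assumes "i < degree f"
  shows "(companion f *\<^sub>v vec (degree f) g) $ i
    = (if i = 0 then 0 else g (i - 1)) - coeff f i * g (degree f - 1)"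
proof -
  define k where "k = degree f"
  have k: "i < k" using assms by (simp add: k_def)
  have "(companion f *\<^sub>v vec k g) $ i
     = (\<Sum>j<k. (if Suc j = k then - coeff f i else if i = Suc j then 1 else 0) * g j)"
    using k by (auto simp: companion_def scalar_prod_def k_def lessThan_atLeast0 intro!: sum.cong)
  also have "\<dots> = (\<Sum>j<k. (if j = k - 1 then - coeff f i * g j else 0) + (if j = i - 1 \<and> i \<noteq> 0 then g j else 0))"
    using k by (intro sum.cong) auto
  also have "\<dots> = (\<Sum>j<k. (if j = k - 1 then - coeff f i * g j else 0)) + (\<Sum>j<k. (if j = i - 1 then (if i \<noteq> 0 then g j else 0) else 0))"
    by (auto simp: sum.distrib intro!: sum.cong)
  also have "\<dots> = - coeff f i * g (k - 1) + (if i \<noteq> 0 then g (i-1) else 0)"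
    using k by (subst (1 2) sum.delta) auto
  finally show ?thesis by (auto simp: k_def)
qed

text \<open>The first unit vector stands for the residue class of 1, so applying \<open>p\<close> to
  it yields the class of \<open>p\<close>, which is already reduced here.\<close>

lemma pact_companion_small:
  assumes "degree p < degree f"
  shows "pact (companion f) p (unit_vec (degree f) 0) = vec (degree f) (coeff p)"
  using assms
proof (induction p)
  case 0
  then show ?case by auto
next
  case (pCons c p)
  define k where "k = degree f"
  have C: "companion f \<in> carrier_mat k k" by (simp add: k_def)
  have k: "0 < k" and dp: "degree p < k" "p \<noteq> 0 \<Longrightarrow> Suc (degree p) < k"
    using pCons.prems by (auto simp: k_def split: if_splits)
  \<comment> \<open>There is room for one more factor \<open>X\<close>: no reduction modulo
    \<open>f\<close> takes place, and the companion matrix acts on \<open>p\<close> as a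
    shift.\<close>
  have z: "coeff p (k - 1) = 0" using dp by (cases "p = 0") (auto intro!: coeff_eq_0)
  have "pact (companion f) (pCons c p) (unit_vec k 0) = c \<cdot>\<^sub>v unit_vec k 0 + companion f *\<^sub>v vec k (coeff p)"
    using pCons.IH dp by (simp add: pact_pCons[OF C] k_def)
  also have "\<dots> = vec k (coeff (pCons c p))"
    using k z by (intro eq_vecI) (auto simp: companion_mult_vec k_def coeff_pCons scalar_prod_def simp del: index_mult_mat_vec split: nat.splits)
  finally show ?case by (simp add: k_def)
qed

lemma pact_companion_self:
  assumes "monic f" "0 < degree f"
  shows "pact (companion f) f (unit_vec (degree f) 0) = 0\<^sub>v (degree f)"
proof -
  obtain c p where f: "f = pCons c p" by (cases f)
  define k where "k = degree f"
  have C: "companion f \<in> carrier_mat k k" by (simp add: k_def)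
  have p: "p \<noteq> 0" "Suc (degree p) = k" using assms f by (auto simp: k_def split: if_splits)
  have "pact (companion f) p (unit_vec k 0) = vec k (coeff p)"
    unfolding k_def by (rule pact_companion_small) (use p k_def in auto)
  then have "pact (companion f) f (unit_vec k 0) = c \<cdot>\<^sub>v unit_vec k 0 + companion f *\<^sub>v vec k (coeff p)"
    using pact_pCons[OF C, of "unit_vec k 0" c p] f by simp
  also have "\<dots> = 0\<^sub>v k"
  proof (intro eq_vecI)
    fix i assume "i < dim_vec (0\<^sub>v k)"
    then have i: "i < degree f" by (simp add: k_def)
    have "degree f - 1 = degree p" using p(2) unfolding k_def by linarith
    moreover have "lead_coeff p = 1" using assms(1)[unfolded f] p(1) by simp
    ultimately have "coeff p (degree f - 1) = 1" by simp
    then have "(companion f *\<^sub>v vec k (coeff p)) $ i = (if i = 0 then 0 else coeff p (i - 1)) - coeff f i"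
      unfolding k_def companion_mult_vec[OF i] by simp
    then show "(c \<cdot>\<^sub>v unit_vec k 0 + companion f *\<^sub>v vec k (coeff p)) $ i = 0\<^sub>v k $ i"
      using i by (auto simp: k_def f coeff_pCons simp del: index_mult_mat_vec split: nat.splits)
  qed (simp add: k_def)
  finally show ?thesis by (simp add: k_def)
qed

lemma pact_companion_eq_0_iff:
  assumes "monic f" "0 < degree f"
  shows "pact (companion f) p (unit_vec (degree f) 0) = 0\<^sub>v (degree f) \<longleftrightarrow> f dvd p"
proof -
  define k where "k = degree f"
  have C: "companion f \<in> carrier_mat k k" and e: "unit_vec k 0 \<in> carrier_vec k" by (auto simp: k_def)
  have "p = f * (p div f) + p mod f" by simp
  then have "pact (companion f) p (unit_vec k 0) = pact (companion f) (f * (p div f)) (unit_vec k 0)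
      + pact (companion f) (p mod f) (unit_vec k 0)"
    using pact_add[OF C e] by metis
  also have "pact (companion f) (f * (p div f)) (unit_vec k 0) = 0\<^sub>v k"
    using pact_0_dvd[OF C e, of f] pact_companion_self[OF assms] by (simp add: k_def)
  finally have eq: "pact (companion f) p (unit_vec k 0) = pact (companion f) (p mod f) (unit_vec k 0)"
    using C e by simp
  have "f \<noteq> 0" using assms(1) by auto
  then have deg: "degree (p mod f) < degree f"
    using assms(2) degree_mod_less[of f p] by (cases "p mod f = 0") auto
  have "pact (companion f) (p mod f) (unit_vec k 0) = vec k (coeff (p mod f))"
    unfolding k_def by (rule pact_companion_small[OF deg])
  moreover have "vec k (coeff (p mod f)) = 0\<^sub>v k \<longleftrightarrow> p mod f = 0"
  proof
    assume z: "vec k (coeff (p mod f)) = 0\<^sub>v k"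
    show "p mod f = 0"
    proof (rule poly_eqI)
      fix i
      show "coeff (p mod f) i = coeff 0 i"
      proof (cases "i < k")
        case True
        then show ?thesis using arg_cong[OF z, of "\<lambda>v. v $ i"] by simp
      next
        case False
        then show ?thesis using deg coeff_eq_0[of "p mod f" i] by (simp add: k_def)
      qed
    qed
  next
    assume "p mod f = 0"
    then show "vec k (coeff (p mod f)) = 0\<^sub>v k" by (intro eq_vecI) simp_all
  qed
  ultimately show ?thesis using eq unfolding k_def dvd_eq_mod_eq_0 by metis
qed

definition kills :: "'a::field mat \<Rightarrow> 'a poly \<Rightarrow> bool" where
  "kills A p \<longleftrightarrow> (\<forall>v\<in>carrier_vec (dim_row A). pact A p v = 0\<^sub>v (dim_row A))"

lemma vec_eq_pact_companion:
  assumes "v \<in> carrier_vec (degree f)" "0 < degree f"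
  obtains p where "degree p < degree f" "v = pact (companion f) p (unit_vec (degree f) 0)"
proof
  define p where "p = Poly (list_of_vec v)"
  have *: "coeff p i = (if i < degree f then v $ i else 0)" for i
    using assms by (auto simp: p_def nth_default_def list_of_vec_index)
  show d: "degree p < degree f" using * assms(2) by (intro degree_lessI) auto
  show "v = pact (companion f) p (unit_vec (degree f) 0)"
    unfolding pact_companion_small[OF d] using assms * by (intro eq_vecI) auto
qed

lemma kills_companion_iff:
  assumes "monic f"
  shows "kills (companion f) p \<longleftrightarrow> f dvd p"
proof (cases "degree f = 0")
  \<comment> \<open>Here \<open>f = 1\<close> and the space is zero. The case does occur, since
    chains are padded with ones.\<close>
  case True
  then have "f = 1" using assms by (metis degree_eq_zeroE lead_coeff_pCons(2) one_pCons pCons_eq_0_iff)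
  have "pact (companion f) p v = 0\<^sub>v 0" if "v \<in> carrier_vec 0" for v
  proof -
    have "pact (companion f) p v \<in> carrier_vec 0"
      using pact_carrier[of "companion f" 0 v p] that companion_carrier[of f] unfolding True by blast
    then show ?thesis by (metis carrier_vecD vec_of_dim_0)
  qed
  then have "kills (companion f) p" unfolding kills_def companion_dim True by blast
  moreover have "f dvd p" unfolding \<open>f = 1\<close> by (rule one_dvd)
  ultimately show ?thesis by blast
next
  case False
  define k where "k = degree f"
  have C: "companion f \<in> carrier_mat k k" and e: "unit_vec k 0 \<in> carrier_vec k" by (auto simp: k_def)
  have k: "0 < degree f" using False by simp
  have "pact (companion f) p v = 0\<^sub>v k" if d: "f dvd p" and v: "v \<in> carrier_vec k" for v
  proof -
    obtain r where r: "v = pact (companion f) r (unit_vec k 0)"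
      using v k vec_eq_pact_companion[of v f] unfolding k_def by metis
    have "f dvd p * r" using d by simp
    then have "pact (companion f) (p * r) (unit_vec k 0) = 0\<^sub>v k"
      unfolding k_def using pact_companion_eq_0_iff[OF assms k] by blast
    then show ?thesis unfolding r pact_mult[OF C e] .
  qed
  moreover have "f dvd p" if kl: "kills (companion f) p"
  proof -
    have "pact (companion f) p (unit_vec (degree f) 0) = 0\<^sub>v (degree f)"
      using kl e unfolding kills_def companion_dim k_def by blast
    then show ?thesis using pact_companion_eq_0_iff[OF assms k] by blast
  qed
  ultimately show ?thesis unfolding kills_def companion_dim k_def by blast
qed

section \<open>The rational canonical form\<close>

lemma CARD_gt_1: "1 < CARD('a::{zero_neq_one,finite})"
proof -
  have "card {0, 1 :: 'a} \<le> CARD('a)" by (rule card_mono) simp_all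
  then show ?thesis by simp
qed

lemma mult_unit_vec:
  assumes "A \<in> carrier_mat m n" "j < n"
  shows "A *\<^sub>v unit_vec n j = (col A j :: 'a::semiring_1 vec)"
  using assms by (intro eq_vecI) auto

lemma mat_eq_by_mult_vec:
  fixes A B :: "'a::semiring_1 mat"
  assumes A: "A \<in> carrier_mat m n" and B: "B \<in> carrier_mat m n"
    and eq: "\<And>y. y \<in> carrier_vec n \<Longrightarrow> A *\<^sub>v y = B *\<^sub>v y"
  shows "A = B"
proof (rule mat_col_eqI)
  fix j assume "j < dim_col B"
  then have j: "j < n" using B by simp
  show "col A j = col B j"
    using eq[OF unit_vec_carrier, of j] mult_unit_vec[OF A j] mult_unit_vec[OF B j] by simp
qed (use A B in auto)

lemma det_nonzero_inverse:
  assumes P: "P \<in> carrier_mat n n" and "det P \<noteq> (0::'a::field)"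
  obtains P' where "P' \<in> carrier_mat n n" "P * P' = 1\<^sub>m n" "P' * P = 1\<^sub>m n" "det P' \<noteq> 0"
proof -
  obtain P' where P': "P' \<in> carrier_mat n n" "P' * P = 1\<^sub>m n" "P * P' = 1\<^sub>m n"
    using det_non_zero_imp_unit[OF assms, of "()"] by (auto simp: Units_def ring_mat_def)
  have "det P * det P' = 1" using det_mult[OF P P'(1)] P'(3) by simp
  then have "det P' \<noteq> 0" by auto
  then show ?thesis using that P' by blast
qed

lemma similar_mat_intertwine:
  assumes T: "T \<in> carrier_mat n n" and M: "M \<in> carrier_mat n n" and N: "N \<in> carrier_mat n n"
    and d: "det T \<noteq> (0::'a::field)" and eq: "T * M = N * T"
  shows "similar_mat M N"
proof -
  obtain T' where T': "T' \<in> carrier_mat n n" "T * T' = 1\<^sub>m n" "T' * T = 1\<^sub>m n"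
    using det_nonzero_inverse[OF T d] by blast
  have "T' * N * T = T' * (N * T)" using T' N T by (intro assoc_mult_mat)
  also have "\<dots> = T' * T * M" unfolding eq[symmetric] using T' T M by (intro assoc_mult_mat[symmetric])
  also have "\<dots> = M" using T' M by simp
  finally have "similar_mat_wit M N T' T"
    unfolding similar_mat_wit_def Let_def using T T' M N by auto
  then show ?thesis unfolding similar_mat_def by blast
qed

lemma inj_on_mult_mat_vec:
  fixes R :: "'a::field mat"
  assumes R: "R \<in> carrier_mat n k" and inj: "\<And>x. x \<in> carrier_vec k \<Longrightarrow> R *\<^sub>v x = 0\<^sub>v n \<Longrightarrow> x = 0\<^sub>v k"
  shows "inj_on (\<lambda>x. R *\<^sub>v x) (carrier_vec k)"
proof (rule inj_onI)
  fix x y assume x: "x \<in> carrier_vec k" and y: "y \<in> carrier_vec k" and eq: "R *\<^sub>v x = R *\<^sub>v y"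
  have "R *\<^sub>v (x - y) = R *\<^sub>v x - R *\<^sub>v y" using R x y by (rule mult_minus_distrib_mat_vec)
  also have "\<dots> = 0\<^sub>v n" unfolding eq using R y by (intro eq_vecI) auto
  finally have "x - y = 0\<^sub>v k" using inj x y by simp
  then have "(x - y) $ i = 0" if "i < k" for i using that by simp
  then show "x = y" using x y by (intro eq_vecI) auto
qed

text \<open>By counting: for \<open>k < n\<close> the image of \<open>R\<close> has at most
  \<open>q^k\<close> of the \<open>q^n\<close> vectors, so a vector outside it can be appended as a
  new column. When the matrix has become square, injectivity gives a nonzero determinant.\<close>

lemma extend_to_basis:
  fixes R :: "'a::{field,finite} mat"
  assumes "R \<in> carrier_mat n k" and "\<And>x. x \<in> carrier_vec k \<Longrightarrow> R *\<^sub>v x = 0\<^sub>v n \<Longrightarrow> x = 0\<^sub>v k"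
  shows "k \<le> n \<and> (\<exists>P\<in>carrier_mat n n. det P \<noteq> 0 \<and> (\<forall>i<n. \<forall>j<k. P $$ (i, j) = R $$ (i, j)))"
  using assms
proof (induction "n - k" arbitrary: k R)
  case 0
  note R = 0(2) and inj = 0(3)
  have q: "1 < CARD('a)" by (rule CARD_gt_1)
  have "CARD('a) ^ k \<le> CARD('a) ^ n"
    unfolding card_carrier_vec[symmetric]
    by (rule card_inj_on_le[OF inj_on_mult_mat_vec[OF R inj]]) (use R in auto)
  then have "k \<le> n" using q by (simp add: power_increasing_iff)
  with 0(1) have k: "k = n" by simp
  have "det R \<noteq> 0"
  proof
    assume "det R = 0"
    then obtain x where "x \<in> carrier_vec n" "x \<noteq> 0\<^sub>v n" "R *\<^sub>v x = 0\<^sub>v n"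
      using det_0_iff_vec_prod_zero[of R n] R k by auto
    then show False using inj k by blast
  qed
  then show ?case using k R by blast
next
  case (Suc m)
  note R = Suc(3) and inj = Suc(4)
  have k: "k < n" using Suc(2) by simp
  have q: "1 < CARD('a)" by (rule CARD_gt_1)
  have "card ((\<lambda>x. R *\<^sub>v x) ` carrier_vec k) \<le> CARD('a) ^ k"
    using card_image_le[OF finite_carrier_vec[of k, where 'a='a]] unfolding card_carrier_vec by blast
  also have "\<dots> < card (carrier_vec n :: 'a vec set)"
    unfolding card_carrier_vec using k q by (intro power_strict_increasing)
  finally have "\<not> carrier_vec n \<subseteq> (\<lambda>x. R *\<^sub>v x) ` carrier_vec k"
    using card_mono[of "(\<lambda>x. R *\<^sub>v x) ` carrier_vec k" "carrier_vec n"] finite_carrier_vec[of k, where 'a='a]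
    by (meson finite_imageI not_le)
  then obtain w where w: "w \<in> carrier_vec n" "w \<notin> (\<lambda>x. R *\<^sub>v x) ` carrier_vec k" by blast
  define R' where "R' = mat n (Suc k) (\<lambda>(i, j). if j < k then R $$ (i, j) else w $ i)"
  have R': "R' \<in> carrier_mat n (Suc k)" by (simp add: R'_def)
  have inj': "x = 0\<^sub>v (Suc k)" if x: "x \<in> carrier_vec (Suc k)" and Rx: "R' *\<^sub>v x = 0\<^sub>v n" for x
  proof -
    define x' where "x' = vec k (\<lambda>i. x $ i)"
    have x': "x' \<in> carrier_vec k" by (simp add: x'_def)
    have eq: "(R *\<^sub>v x') $ i + x $ k * w $ i = 0" if i: "i < n" for i
    proof -
      have "0 = (R' *\<^sub>v x) $ i" using Rx i by simp
      also have "\<dots> = (\<Sum>j<Suc k. (if j < k then R $$ (i, j) else w $ i) * x $ j)"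
        using x i by (simp add: scalar_prod_def R'_def lessThan_atLeast0)
      also have "\<dots> = (\<Sum>j<k. R $$ (i, j) * x $ j) + w $ i * x $ k" by simp
      also have "(\<Sum>j<k. R $$ (i, j) * x $ j) = (R *\<^sub>v x') $ i"
        using R i by (simp add: scalar_prod_def x'_def lessThan_atLeast0)
      finally show ?thesis by (simp add: mult.commute)
    qed
    have xk: "x $ k = 0"
    proof (rule ccontr)
      assume nz: "x $ k \<noteq> 0"
      have "w = R *\<^sub>v ((- inverse (x $ k)) \<cdot>\<^sub>v x')"
      proof (rule eq_vecI)
        fix i assume "i < dim_vec (R *\<^sub>v ((- inverse (x $ k)) \<cdot>\<^sub>v x'))"
        then have i: "i < n" using R by simp
        have "(R *\<^sub>v ((- inverse (x $ k)) \<cdot>\<^sub>v x')) $ i = (- inverse (x $ k)) * (R *\<^sub>v x') $ i"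
          unfolding mult_mat_vec[OF R x'] using i R by simp
        also have "(R *\<^sub>v x') $ i = - (x $ k * w $ i)" using eq[OF i] by (simp add: add_eq_0_iff2)
        finally show "w $ i = (R *\<^sub>v ((- inverse (x $ k)) \<cdot>\<^sub>v x')) $ i" using nz by simp
      qed (use R w in simp)
      moreover have "(- inverse (x $ k)) \<cdot>\<^sub>v x' \<in> carrier_vec k" using x' by simp
      ultimately show False using w(2) by blast
    qed
    have "R *\<^sub>v x' = 0\<^sub>v n" using eq xk R by (intro eq_vecI) (simp_all del: index_mult_mat_vec)
    then have "x' = 0\<^sub>v k" using inj x' by blast
    then have "x $ i = 0" if "i < k" for i using that by (metis index_vec index_zero_vec(1) x'_def)
    then show ?thesis using x xk by (intro eq_vecI) (auto simp: less_Suc_eq)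
  qed
  have "Suc k \<le> n \<and> (\<exists>P\<in>carrier_mat n n. det P \<noteq> 0 \<and> (\<forall>i<n. \<forall>j<Suc k. P $$ (i, j) = R' $$ (i, j)))"
    by (rule Suc(1)[OF _ R' inj']) (use Suc(2) in auto)
  then show ?case by (auto simp: R'_def)
qed

lemma prime_power_dvd_cancel:
  fixes p :: "'a::field poly"
  assumes p: "prime_elem p" and t: "\<not> p dvd t" and "p ^ k dvd t * r"
  shows "p ^ k dvd r"
  using assms(3)
proof (induction k)
  case (Suc k)
  have "p ^ k dvd t * r" using Suc.prems by (metis dvd_trans le_imp_power_dvd le_SucI order_refl)
  with Suc.IH obtain s where s: "r = p ^ k * s" by blast
  have "p ^ k * p dvd p ^ k * (t * s)" using Suc.prems s by (simp add: mult.left_commute mult.commute)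
  moreover have "p \<noteq> 0" using p by (simp add: prime_elem_def)
  ultimately have "p dvd t * s" by (simp add: dvd_mult_cancel_left)
  then have "p dvd s" using p t by (simp add: prime_elem_dvd_mult_iff)
  then show ?case unfolding s power_Suc2 by (rule mult_dvd_mono[OF dvd_refl])
qed simp

lemma dvd_prime_power_cancel:
  fixes p :: "'a::field poly"
  assumes p: "prime_elem p" and t: "\<not> p dvd t" and "t dvd p ^ k * r"
  shows "t dvd r"
proof -
  obtain s where s: "p ^ k * r = t * s" using assms(3) by blast
  then have "p ^ k dvd t * s" by (metis dvd_triv_left)
  then obtain u where "s = p ^ k * u" using prime_power_dvd_cancel[OF p t] by blast
  then have "p ^ k * r = p ^ k * (t * u)" using s by (simp add: mult.left_commute)
  moreover have "p \<noteq> 0" using p by (simp add: prime_elem_def)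
  ultimately have "r = t * u" by simp
  then show ?thesis by simp
qed

lemma prime_power_decompose:
  fixes p f :: "'a::field poly"
  assumes p: "0 < degree p" and "f \<noteq> 0"
  shows "\<exists>b f'. f = p ^ b * f' \<and> \<not> p dvd f'"
  using assms(2)
proof (induction "degree f" arbitrary: f rule: less_induct)
  case less
  show ?case
  proof (cases "p dvd f")
    case False
    then have "f = p ^ 0 * f \<and> \<not> p dvd f" by simp
    then show ?thesis by blast
  next
    case True
    then obtain g where g: "f = p * g" by blast
    then have "g \<noteq> 0" "p \<noteq> 0" using less.prems by auto
    then have "degree g < degree f" using p by (simp add: g degree_mult_eq)
    from less.hyps[OF this \<open>g \<noteq> 0\<close>] obtain b f' where "g = p ^ b * f'" "\<not> p dvd f'" by blast
    then have "f = p ^ Suc b * f' \<and> \<not> p dvd f'" by (simp add: g mult.assoc)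
    then show ?thesis by blast
  qed
qed

section \<open>Orders of vectors and a vector of maximal order\<close>

lemma pact_diff:
  assumes A: "A \<in> carrier_mat n n" and v: "v \<in> carrier_vec n"
  shows "pact A (p - q) v = pact A p v - pact A q v"
proof -
  have "pact A p v = pact A (p - q) v + pact A q v" using pact_add[OF A v, of "p - q" q] by simp
  moreover have "pact A (p - q) v \<in> carrier_vec n" "pact A q v \<in> carrier_vec n" using A v by simp_all
  ultimately show ?thesis by (intro eq_vecI) auto
qed

text \<open>Pigeonhole: the \<open>q^(n+1)\<close> polynomials of degree at most \<open>n\<close>
  take at most \<open>q^n\<close> values on \<open>v\<close>, so the difference of two of them kills
  \<open>v\<close>. One of least degree, made monic, divides all the others by division with
  remainder.\<close>

lemma ex_vec_order:
  fixes A :: "'a::{field,finite} mat"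
  assumes A: "A \<in> carrier_mat n n" and v: "v \<in> carrier_vec n"
  shows "\<exists>f. monic f \<and> (\<forall>p. pact A p v = 0\<^sub>v n \<longleftrightarrow> f dvd p)"
proof -
  have q: "1 < CARD('a)" by (rule CARD_gt_1)
  define F where "F x = pact A (Poly (list_of_vec x)) v" for x :: "'a vec"
  have "\<not> inj_on F (carrier_vec (Suc n))"
  proof
    assume "inj_on F (carrier_vec (Suc n))"
    then have "card (carrier_vec (Suc n) :: 'a vec set) \<le> card (carrier_vec n :: 'a vec set)"
      by (rule card_inj_on_le) (use A v in \<open>auto simp: F_def\<close>)
    then show False unfolding card_carrier_vec using q by (simp add: power_increasing_iff)
  qed
  then obtain x y where xy: "x \<in> carrier_vec (Suc n)" "y \<in> carrier_vec (Suc n)" "x \<noteq> y" "F x = F y"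
    unfolding inj_on_def by blast
  define p0 where "p0 = Poly (list_of_vec x) - Poly (list_of_vec y)"
  have "p0 \<noteq> 0"
  proof
    assume z: "p0 = 0"
    have "x $ i = y $ i" if "i < Suc n" for i
      using arg_cong[OF z, of "\<lambda>p. coeff p i"] that xy(1,2)
      by (simp add: p0_def nth_default_def list_of_vec_index)
    then have "x = y" using xy(1,2) by (intro eq_vecI) simp_all
    then show False using xy(3) by contradiction
  qed
  moreover have "pact A p0 v = 0\<^sub>v n"
    unfolding p0_def pact_diff[OF A v] using xy(4) A v by (simp add: F_def)
  ultimately have ex: "\<exists>p. p \<noteq> 0 \<and> pact A p v = 0\<^sub>v n" by blast
  obtain g where g: "g \<noteq> 0" "pact A g v = 0\<^sub>v n"
    and min: "\<And>p. p \<noteq> 0 \<Longrightarrow> pact A p v = 0\<^sub>v n \<Longrightarrow> degree g \<le> degree p"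
    using ex_has_least_nat[of "\<lambda>p. p \<noteq> 0 \<and> pact A p v = 0\<^sub>v n" _ degree] ex by blast
  define f where "f = smult (inverse (lead_coeff g)) g"
  have f: "monic f" "degree f = degree g" using g by (auto simp: f_def)
  have fv: "pact A f v = 0\<^sub>v n" unfolding f_def pact_smult[OF A v] g(2) by (intro eq_vecI) simp_all
  have "f dvd p" if p: "pact A p v = 0\<^sub>v n" for p
  proof (rule ccontr)
    assume "\<not> f dvd p"
    then have nz: "p mod f \<noteq> 0" by (simp add: dvd_eq_mod_eq_0)
    have "pact A (p mod f) v = pact A (p - f * (p div f)) v" by (simp add: minus_mult_div_eq_mod)
    also have "\<dots> = 0\<^sub>v n"
      unfolding pact_diff[OF A v] p using pact_0_dvd[OF A v fv, of "f * (p div f)"] by simp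
    finally have "degree g \<le> degree (p mod f)" using min nz by blast
    moreover have "f \<noteq> 0" using f(1) by auto
    then have "degree (p mod f) < degree f" using nz degree_mod_less[of f p] by auto
    ultimately show False using f by simp
  qed
  then show ?thesis using f fv pact_0_dvd[OF A v fv] by blast
qed

text \<open>The order of a vector \<open>v\<close> of maximal degree kills the whole space: otherwise some irreducible \<open>p\<close> occurs with a
  higher power in the order of another vector, and adding the \<open>p\<close>-part of that vector to the \<open>p\<close>-free part of
  \<open>v\<close> raises the degree.\<close>

lemma ex_max_order_vec:
  fixes A :: "'a::{field,finite} mat"
  assumes A: "A \<in> carrier_mat n n"
  shows "\<exists>v\<in>carrier_vec n. \<exists>f. monic f \<and> (\<forall>p. pact A p v = 0\<^sub>v n \<longleftrightarrow> f dvd p) \<and> kills A f"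
proof -
  define F where "F v = (SOME f. monic f \<and> (\<forall>p. pact A p v = 0\<^sub>v n \<longleftrightarrow> f dvd p))" for v
  have F: "monic (F v)" "pact A p v = 0\<^sub>v n \<longleftrightarrow> F v dvd p" if v: "v \<in> carrier_vec n" for v p
    using someI_ex[OF ex_vec_order[OF A v], folded F_def] by blast+
  have nz: "F v \<noteq> 0" if "v \<in> carrier_vec n" for v using F(1)[OF that] by auto
  have "finite ((\<lambda>v. degree (F v)) ` carrier_vec n)" "(\<lambda>v. degree (F v)) ` carrier_vec n \<noteq> {}"
    using zero_carrier_vec[of n, where 'a='a] by (auto simp del: zero_carrier_vec)
  then have "Max ((\<lambda>v. degree (F v)) ` carrier_vec n) \<in> (\<lambda>v. degree (F v)) ` carrier_vec n"
    and mx0: "\<And>u. u \<in> carrier_vec n \<Longrightarrow> degree (F u) \<le> Max ((\<lambda>v. degree (F v)) ` carrier_vec n)"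
    by (rule Max_in) (rule Max_ge, simp_all)
  then obtain v where v: "v \<in> carrier_vec n"
    and "Max ((\<lambda>v. degree (F v)) ` carrier_vec n) = degree (F v)" by blast
  with mx0 have mx: "\<And>u. u \<in> carrier_vec n \<Longrightarrow> degree (F u) \<le> degree (F v)" by simp
  define f where "f = F v"
  have "kills A f"
  proof (rule ccontr)
    assume "\<not> kills A f"
    then obtain u0 where u0: "u0 \<in> carrier_vec n" "pact A f u0 \<noteq> 0\<^sub>v n"
      using A unfolding kills_def by auto
    \<comment> \<open>Nonzero polynomials that kill some nonzero vector in the image of
      \<open>f(A)\<close>. A member of least degree is irreducible, because a proper factorization
      would put one of the factors into \<open>S\<close>.\<close>
    define S where "S g \<longleftrightarrow> g \<noteq> 0 \<and> (\<exists>u\<in>carrier_vec n. pact A f u \<noteq> 0\<^sub>v n \<and> pact A g (pact A f u) = 0\<^sub>v n)" for g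
    have "S (F (pact A f u0))"
      unfolding S_def using u0 F(2)[of "pact A f u0" "F (pact A f u0)"] nz[of "pact A f u0"] A by auto
    then obtain p where Sp: "S p" and min: "\<And>g. S g \<Longrightarrow> degree p \<le> degree g"
      using ex_has_least_nat[of S _ degree] by blast
    obtain u where p0: "p \<noteq> 0" and u: "u \<in> carrier_vec n" "pact A f u \<noteq> 0\<^sub>v n" "pact A p (pact A f u) = 0\<^sub>v n"
      using Sp unfolding S_def by blast
    have fu: "pact A f u \<in> carrier_vec n" using A u by simp
    have dp: "0 < degree p"
    proof (rule ccontr)
      assume "\<not> 0 < degree p"
      then have "p dvd 1" using p0 by (simp add: is_unit_iff_degree)
      then have "pact A 1 (pact A f u) = 0\<^sub>v n" using pact_0_dvd[OF A fu u(3)] by blast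
      then show False using u(2) by (simp add: pact_1[OF A fu])
    qed
    have irr: "irreducible p"
    proof (rule irreducibleI)
      show "\<not> p dvd 1" using dp p0 by (simp add: is_unit_iff_degree)
    next
      fix r s assume rs: "p = r * s"
      show "r dvd 1 \<or> s dvd 1"
      proof (rule ccontr)
        assume "\<not> (r dvd 1 \<or> s dvd 1)"
        moreover have rs0: "r \<noteq> 0" "s \<noteq> 0" using rs p0 by auto
        ultimately have d: "0 < degree r" "0 < degree s" by (auto simp: is_unit_iff_degree)
        have dd: "degree p = degree r + degree s" using rs rs0 by (simp add: degree_mult_eq)
        have su: "pact A s u \<in> carrier_vec n" using A u by simp
        have e: "pact A s (pact A f u) = pact A f (pact A s u)" by (rule pact_commute[OF A u(1)])
        show False
        proof (cases "pact A s (pact A f u) = 0\<^sub>v n")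
          case True
          then have "S s" unfolding S_def using rs0 u by blast
          then show False using min dd d by fastforce
        next
          case False
          have "pact A r (pact A s (pact A f u)) = 0\<^sub>v n" using u(3) unfolding rs pact_mult[OF A fu] .
          then have "S r" unfolding S_def using rs0 su False unfolding e by blast
          then show False using min dd d by fastforce
        qed
      qed
    qed (rule p0)
    have p: "prime_elem p" using irr by (rule field_poly_irreducible_imp_prime)
    have f0: "f \<noteq> 0" using nz v by (simp add: f_def)
    obtain b f' where f': "f = p ^ b * f'" "\<not> p dvd f'"
      using prime_power_decompose[OF dp f0] by blast
    \<comment> \<open>\<open>x\<close> is killed by \<open>p^(b+1)\<close> because
      \<open>p f\<close> kills \<open>u\<close>, but not by \<open>p^b\<close> because
      \<open>f\<close> does not; so its order is \<open>p^(b+1)\<close> up to a unit.\<close>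
    define x where "x = pact A f' u"
    have x: "x \<in> carrier_vec n" using A u by (simp add: x_def)
    have xb: "\<not> F x dvd p ^ b"
      using F(2)[OF x, of "p ^ b"] u(2) unfolding x_def pact_mult[OF A u(1), symmetric] f'(1) by simp
    have "pact A (p ^ Suc b) x = 0\<^sub>v n"
      using u(3) unfolding x_def pact_mult[OF A u(1), symmetric] f'(1) by (simp add: mult.assoc)
    then have xSb: "F x dvd p ^ Suc b" using F(2)[OF x] by blast
    have pF: "p ^ Suc b dvd F x"
    proof -
      obtain t where t: "p ^ Suc b = F x * t" using xSb by blast
      have "\<not> p dvd t"
      proof
        assume "p dvd t"
        then obtain t' where "t = p * t'" by blast
        then have "p * p ^ b = p * (F x * t')" using t by (simp add: mult.left_commute)
        then have "p ^ b = F x * t'" using p0 by simp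
        then show False using xb by simp
      qed
      then show ?thesis using prime_power_dvd_cancel[OF p, of t "Suc b" "F x"] t by (simp add: mult.commute)
    qed
    \<comment> \<open>Applying \<open>p^b\<close> strips the \<open>p\<close>-part from the order of
      \<open>v\<close> and leaves \<open>f'\<close>.\<close>
    define v' where "v' = pact A (p ^ b) v"
    have v': "v' \<in> carrier_vec n" using A v by (simp add: v'_def)
    have pb: "p ^ b \<noteq> 0" using p0 by simp
    have ordv': "pact A h v' = 0\<^sub>v n \<longleftrightarrow> f' dvd h" for h
    proof -
      have "pact A h v' = 0\<^sub>v n \<longleftrightarrow> f dvd h * p ^ b"
        unfolding v'_def pact_mult[OF A v, symmetric] f_def by (rule F(2)[OF v])
      also have "\<dots> \<longleftrightarrow> p ^ b * f' dvd p ^ b * h" by (simp add: f'(1) mult.commute)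
      also have "\<dots> \<longleftrightarrow> f' dvd h" using p0 by (simp add: dvd_mult_cancel_left)
      finally show ?thesis .
    qed
    \<comment> \<open>The two orders are coprime, so the order of the sum is divisible by
      \<open>p^(b+1) f' = p f\<close>, whose degree exceeds the maximum.\<close>
    define w where "w = x + v'"
    have w: "w \<in> carrier_vec n" using x v' by (simp add: w_def)
    have wsum: "pact A h x + pact A h v' = pact A h w" for h
      unfolding w_def by (rule pact_vec_add[OF A x v', symmetric])
    have Fw: "pact A (h * F w) w = 0\<^sub>v n" for h using F(2)[OF w] by simp
    have "pact A (f' * F w) v' = 0\<^sub>v n" using ordv' by simp
    then have "pact A (f' * F w) x = 0\<^sub>v n"
      using wsum[of "f' * F w"] Fw[of f'] pact_carrier[OF A x, of "f' * F w"] by simp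
    then have "p ^ Suc b dvd f' * F w" using F(2)[OF x] pF dvd_trans by blast
    then have "p ^ Suc b dvd F w" by (rule prime_power_dvd_cancel[OF p f'(2)])
    then obtain s where s: "F w = p ^ Suc b * s" by blast
    have "pact A (p ^ Suc b * F w) x = 0\<^sub>v n" using F(2)[OF x] xSb dvd_mult2 by blast
    then have "pact A (p ^ Suc b * F w) v' = 0\<^sub>v n"
      using wsum[of "p ^ Suc b * F w"] Fw[of "p ^ Suc b"] pact_carrier[OF A v', of "p ^ Suc b * F w"] by simp
    then have "f' dvd F w" using ordv' dvd_prime_power_cancel[OF p f'(2)] by blast
    then have "f' dvd s" unfolding s by (rule dvd_prime_power_cancel[OF p f'(2)])
    then have "p ^ Suc b * f' dvd F w" unfolding s by (rule mult_dvd_mono[OF dvd_refl])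
    then have "degree (p ^ Suc b * f') \<le> degree (F w)" using dvd_imp_degree_le nz[OF w] by blast
    also have "\<dots> \<le> degree f" unfolding f_def by (rule mx[OF w])
    also have "p ^ Suc b * f' = p * f" by (simp add: f'(1) mult.assoc)
    finally show False using dp p0 f0 by (simp add: degree_mult_eq)
  qed
  then show ?thesis using v F[OF v] unfolding f_def by blast
qed

lemma pact_monom:
  assumes A: "A \<in> carrier_mat n n" and v: "v \<in> carrier_vec n"
  shows "pact A (monom 1 i) v = (A ^\<^sub>m i) *\<^sub>v v"
  using v
proof (induction i arbitrary: v)
  case 0
  then show ?case using pact_monom_0[OF A] A by simp
next
  case (Suc i)
  have Av: "A *\<^sub>v v \<in> carrier_vec n" using A Suc.prems by auto
  have "pact A (monom 1 (Suc i)) v = pact A (monom 1 i) (A *\<^sub>v v)"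
    unfolding pact_monom_Suc[OF A Suc.prems] pact_mult_mat_vec[OF A Suc.prems] ..
  also have "\<dots> = (A ^\<^sub>m i) *\<^sub>v (A *\<^sub>v v)" by (rule Suc.IH[OF Av])
  also have "\<dots> = (A ^\<^sub>m i * A) *\<^sub>v v"
    using A Suc.prems by (intro assoc_mult_mat_vec[symmetric]) auto
  finally show ?case by simp
qed

lemma pact_sum_index:
  assumes A: "A \<in> carrier_mat n n" and v: "v \<in> carrier_vec n" and i: "i < n" and S: "finite S"
  shows "pact A (sum g S) v $ i = (\<Sum>s\<in>S. pact A (g s) v $ i)"
  using S
proof (induction S rule: finite_induct)
  case empty
  then show ?case using i v by simp
next
  case (insert s S)
  have "pact A (g s + sum g S) v $ i = pact A (g s) v $ i + pact A (sum g S) v $ i"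
    using pact_add[OF A v] i carrier_vecD[OF pact_carrier[OF A v]] by simp
  then show ?case using insert by simp
qed

lemma pact_index:
  assumes A: "A \<in> carrier_mat n n" and v: "v \<in> carrier_vec n" and i: "i < n" and d: "degree p \<le> N"
  shows "pact A p v $ i = (\<Sum>j\<le>N. coeff p j * pact A (monom 1 j) v $ i)"
proof -
  have "pact A p v $ i = pact A (\<Sum>j\<le>N. monom (coeff p j) j) v $ i"
    using poly_as_sum_of_monoms'[OF d] by simp
  also have "\<dots> = (\<Sum>j\<le>N. pact A (monom (coeff p j) j) v $ i)" by (rule pact_sum_index[OF A v i]) simp
  also have "\<dots> = (\<Sum>j\<le>N. coeff p j * pact A (monom 1 j) v $ i)"
  proof (rule sum.cong[OF refl])
    fix j
    have "monom (coeff p j) j = smult (coeff p j) (monom 1 j)" by (simp add: smult_monom)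
    then show "pact A (monom (coeff p j) j) v $ i = coeff p j * pact A (monom 1 j) v $ i"
      using pact_smult[OF A v] i carrier_vecD[OF pact_carrier[OF A v]] by simp
  qed
  finally show ?thesis .
qed

lemma vec_coeff_poly:
  assumes x: "x \<in> carrier_vec k"
  obtains p :: "'a::field poly" where "x = vec k (coeff p)" "degree p < k \<or> p = 0"
proof
  define p where "p = Poly (list_of_vec x)"
  have *: "coeff p i = (if i < k then x $ i else 0)" for i
    using x by (auto simp: p_def nth_default_def list_of_vec_index)
  show "x = vec k (coeff p)" using * x by (intro eq_vecI) auto
  show "degree p < k \<or> p = 0"
  proof (cases "k = 0")
    case True
    then show ?thesis using * by (auto intro: poly_eqI)
  next
    case False
    show ?thesis by (rule disjI1, rule degree_lessI) (use False * in auto)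
  qed
qed

section \<open>Annihilating polynomials under similarity and block sums\<close>

lemma kills_similar:
  assumes A: "A \<in> carrier_mat n n" and s: "similar_mat A B"
  shows "kills A p \<longleftrightarrow> kills B p"
proof -
  have *: "kills B p" if A: "A \<in> carrier_mat n n" and s: "similar_mat A B" and k: "kills A p" for A B :: "'a mat"
  proof -
    obtain P Q where w: "similar_mat_wit A B P Q" using s unfolding similar_mat_def by blast
    note W = similar_mat_witD2[OF A w]
    have QA: "Q * A = B * Q"
    proof -
      have "Q * A = Q * (P * B * Q)" using W(3) by simp
      also have "\<dots> = Q * (P * (B * Q))" using W by (metis assoc_mult_mat)
      also have "\<dots> = Q * P * (B * Q)" using W by (intro assoc_mult_mat[symmetric]) auto
      also have "\<dots> = B * Q" using W by simp
      finally show ?thesis .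
    qed
    have "pact B p v = 0\<^sub>v n" if v: "v \<in> carrier_vec n" for v
    proof -
      have Pv: "P *\<^sub>v v \<in> carrier_vec n" using W v by auto
      have "v = Q *\<^sub>v (P *\<^sub>v v)"
        using assoc_mult_mat_vec[of Q n n P n v] W v by simp
      then have "pact B p v = Q *\<^sub>v pact A p (P *\<^sub>v v)"
        using pact_intertwine[OF A W(5) W(7) QA Pv, of p] by simp
      also have "pact A p (P *\<^sub>v v) = 0\<^sub>v n" using k A Pv unfolding kills_def by auto
      finally show ?thesis using mult_mat_zero_vec[OF W(7)] by simp
    qed
    then show ?thesis using W(5) unfolding kills_def by auto
  qed
  have "B \<in> carrier_mat n n" using similar_matD[OF s] A by auto
  then show ?thesis using *[OF A s] *[OF _ similar_mat_sym[OF s]] by blast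
qed

lemma pact_four_block:
  assumes A: "A \<in> carrier_mat k k" and B: "B \<in> carrier_mat l l"
    and v: "v \<in> carrier_vec k" and w: "w \<in> carrier_vec l"
  shows "pact (four_block_mat A (0\<^sub>m k l) (0\<^sub>m l k) B) p (v @\<^sub>v w) = pact A p v @\<^sub>v pact B p w"
proof (induction p)
  case 0
  then show ?case using v w by (intro eq_vecI) auto
next
  case (pCons c p)
  have M: "four_block_mat A (0\<^sub>m k l) (0\<^sub>m l k) B \<in> carrier_mat (k + l) (k + l)" using A B by simp
  have vw: "v @\<^sub>v w \<in> carrier_vec (k + l)" using v w by simp
  note c = pact_carrier[OF A v, of p] pact_carrier[OF B w, of p]
  have "A *\<^sub>v pact A p v \<in> carrier_vec k" "B *\<^sub>v pact B p w \<in> carrier_vec l" using A B c by auto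
  moreover have "c \<cdot>\<^sub>v (v @\<^sub>v w) = (c \<cdot>\<^sub>v v) @\<^sub>v (c \<cdot>\<^sub>v w)" using v w by (intro eq_vecI) auto
  ultimately show ?case
    unfolding pact_pCons[OF M vw] pact_pCons[OF A v] pact_pCons[OF B w] pCons.IH
      mult_mat_vec_split[OF A B c]
    using v w append_vec_add[of "c \<cdot>\<^sub>v v" k "A *\<^sub>v pact A p v" "c \<cdot>\<^sub>v w" l "B *\<^sub>v pact B p w"] by simp
qed

lemma vec_append_split:
  assumes "v \<in> carrier_vec (k + l)"
  obtains x y where "x \<in> carrier_vec k" "y \<in> carrier_vec l" "v = x @\<^sub>v y"
  using vec_first_last_append[OF assms] by (metis vec_first_carrier vec_last_carrier)

lemma append_vec_eq_0:
  assumes "x \<in> carrier_vec k" "y \<in> carrier_vec l"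
  shows "x @\<^sub>v y = 0\<^sub>v (k + l) \<longleftrightarrow> x = 0\<^sub>v k \<and> y = 0\<^sub>v l"
proof -
  have "0\<^sub>v (k + l) = 0\<^sub>v k @\<^sub>v 0\<^sub>v l" by (intro eq_vecI) auto
  then show ?thesis using append_vec_eq[OF assms(1) zero_carrier_vec, of y "0\<^sub>v l"] by metis
qed

lemma kills_four_block:
  assumes A: "A \<in> carrier_mat k k" and B: "B \<in> carrier_mat l l"
  shows "kills (four_block_mat A (0\<^sub>m k l) (0\<^sub>m l k) B) p \<longleftrightarrow> kills A p \<and> kills B p"
proof -
  define M where "M = four_block_mat A (0\<^sub>m k l) (0\<^sub>m l k) B"
  have M: "M \<in> carrier_mat (k + l) (k + l)" using A B by (simp add: M_def)
  have eq: "pact M p (x @\<^sub>v y) = 0\<^sub>v (k + l) \<longleftrightarrow> pact A p x = 0\<^sub>v k \<and> pact B p y = 0\<^sub>v l"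
    if "x \<in> carrier_vec k" "y \<in> carrier_vec l" for x y
    unfolding M_def pact_four_block[OF A B that]
    using append_vec_eq_0 pact_carrier[OF A that(1)] pact_carrier[OF B that(2)] by blast
  have "kills M p \<longleftrightarrow> (\<forall>x\<in>carrier_vec k. \<forall>y\<in>carrier_vec l. pact M p (x @\<^sub>v y) = 0\<^sub>v (k + l))"
    using M unfolding kills_def by (simp add: all_vec_append)
  also have "\<dots> \<longleftrightarrow> (\<forall>x\<in>carrier_vec k. \<forall>y\<in>carrier_vec l. pact A p x = 0\<^sub>v k \<and> pact B p y = 0\<^sub>v l)"
    using eq by simp
  also have "\<dots> \<longleftrightarrow> kills A p \<and> kills B p"
    using A B zero_carrier_vec[of k, where 'a='a] zero_carrier_vec[of l, where 'a='a]
    unfolding kills_def carrier_matD(1)[OF A] carrier_matD(1)[OF B] by blast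
  finally show ?thesis unfolding M_def .
qed

text \<open>With \<open>k = degree f\<close>, the vectors \<open>v\<close>, \<open>A v\<close>, ...,
  \<open>A^(k-1) v\<close> are independent because no nonzero polynomial of degree below
  \<open>k\<close> kills \<open>v\<close>. They are extended to a basis, and on their span
  \<open>A\<close> acts as the companion matrix.\<close>

lemma krylov_triangularize:
  fixes A :: "'a::{field,finite} mat"
  assumes A: "A \<in> carrier_mat n n" and v: "v \<in> carrier_vec n" and f: "monic f"
    and ord: "\<And>p. pact A p v = 0\<^sub>v n \<longleftrightarrow> f dvd p" and dpos: "0 < degree f"
  shows "\<exists>l B Z. n = degree f + l \<and> B \<in> carrier_mat (degree f) l \<and> Z \<in> carrier_mat l l \<and>
    similar_mat A (four_block_mat (companion f) B (0\<^sub>m l (degree f)) Z)"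
proof -
  define k where "k = degree f"
  define R where "R = mat n k (\<lambda>(i, j). pact A (monom 1 j) v $ i)"
  have R: "R \<in> carrier_mat n k" by (simp add: R_def)
  have k0: "0 < k" using dpos by (simp add: k_def)
  have R_vec: "R *\<^sub>v vec k (coeff p) = pact A p v" if p: "degree p < k" for p
  proof (rule eq_vecI)
    fix i assume "i < dim_vec (pact A p v)"
    then have i: "i < n" using carrier_vecD[OF pact_carrier[OF A v]] by simp
    have "(R *\<^sub>v vec k (coeff p)) $ i = (\<Sum>j<k. pact A (monom 1 j) v $ i * coeff p j)"
      using i by (simp add: R_def scalar_prod_def lessThan_atLeast0)
    also have "\<dots> = (\<Sum>j\<le>k - 1. coeff p j * pact A (monom 1 j) v $ i)"
      using k0 by (intro sum.cong) auto
    also have "\<dots> = pact A p v $ i"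
      by (rule pact_index[OF A v i, symmetric]) (use p in simp)
    finally show "(R *\<^sub>v vec k (coeff p)) $ i = pact A p v $ i" .
  qed (use carrier_vecD[OF pact_carrier[OF A v]] R in simp)
  have inj: "x = 0\<^sub>v k" if x: "x \<in> carrier_vec k" and Rx: "R *\<^sub>v x = 0\<^sub>v n" for x
  proof -
    obtain p where p: "x = vec k (coeff p)" "degree p < k \<or> p = 0" using vec_coeff_poly[OF x] by blast
    then have dp: "degree p < k" using k0 by auto
    have "f dvd p" using Rx R_vec[OF dp] ord unfolding p(1) by simp
    then have "p = 0" using dp dvd_imp_degree_le[of f p] unfolding k_def by auto
    then show ?thesis unfolding p(1) by (intro eq_vecI) simp_all
  qed
  obtain P where P: "P \<in> carrier_mat n n" "det P \<noteq> 0" and PR: "\<And>i j. i < n \<Longrightarrow> j < k \<Longrightarrow> P $$ (i, j) = R $$ (i, j)"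
    and kn: "k \<le> n"
    using extend_to_basis[OF R inj] by blast
  obtain P' where P': "P' \<in> carrier_mat n n" "P * P' = 1\<^sub>m n" "P' * P = 1\<^sub>m n" "det P' \<noteq> 0"
    using det_nonzero_inverse[OF P] by blast
  obtain l where l: "n = k + l" using kn le_Suc_ex by blast
  define M where "M = P' * A * P"
  have M: "M \<in> carrier_mat n n" using A P P' by (simp add: M_def)
  have sim: "similar_mat A M"
  proof (rule similar_mat_intertwine[OF P'(1) A M P'(4)])
    have "M * P' = P' * A * (P * P')" unfolding M_def using P' A P by (intro assoc_mult_mat) auto
    also have "\<dots> = P' * A" using P' A by simp
    finally show "P' * A = M * P'" by simp
  qed
  define E where "E y = y @\<^sub>v 0\<^sub>v l" for y :: "'a vec"
  have PE: "P *\<^sub>v E y = R *\<^sub>v y" if y: "y \<in> carrier_vec k" for y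
  proof (rule eq_vecI)
    fix i assume "i < dim_vec (R *\<^sub>v y)"
    then have i: "i < n" using R by simp
    have "(P *\<^sub>v E y) $ i = (\<Sum>j<k+l. P $$ (i, j) * E y $ j)"
      using i P y l by (simp add: scalar_prod_def lessThan_atLeast0 E_def)
    also have "\<dots> = (\<Sum>j<k. P $$ (i, j) * E y $ j)"
      by (rule sum.mono_neutral_right) (use y in \<open>auto simp: E_def\<close>)
    also have "\<dots> = (\<Sum>j<k. R $$ (i, j) * y $ j)"
      by (rule sum.cong) (use y i PR in \<open>auto simp: E_def\<close>)
    also have "\<dots> = (R *\<^sub>v y) $ i" using R y i by (simp add: scalar_prod_def lessThan_atLeast0)
    finally show "(P *\<^sub>v E y) $ i = (R *\<^sub>v y) $ i" .
  qed (use P R in simp)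
  have colM: "col M j = E (col (companion f) j)" if j: "j < k" for j
  proof -
    \<comment> \<open>The representative of \<open>X^(j+1)\<close> modulo \<open>f\<close> of degree
      below \<open>k\<close>; its coefficients are column \<open>j\<close> of the companion
      matrix.\<close>
    define r where "r = (if Suc j < k then monom 1 (Suc j) else monom 1 k - f)"
    have r_coeff: "coeff r i = (if i < k then companion f $$ (i, j) else 0)" for i
    proof (cases "Suc j < k")
      case True
      then show ?thesis using j by (auto simp: r_def companion_def k_def coeff_monom)
    next
      case False
      then have jk: "Suc j = k" using j by simp
      show ?thesis
        using f jk coeff_eq_0[of f i] by (auto simp: r_def companion_def k_def coeff_monom)
    qed
    have dr: "degree r < k" using r_coeff k0 by (intro degree_lessI) auto
    have colC: "col (companion f) j = vec k (coeff r)"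
      using j r_coeff by (intro eq_vecI) (auto simp: k_def)
    have ej: "unit_vec n j = E (vec k (coeff (monom 1 j)))"
      using j l by (intro eq_vecI) (auto simp: E_def coeff_monom)
    have dj: "degree (monom (1::'a) j) < k" using j by (simp add: degree_monom_eq)
    have "P *\<^sub>v unit_vec n j = pact A (monom 1 j) v"
      unfolding ej using PE[of "vec k (coeff (monom 1 j))"] R_vec[OF dj] by simp
    then have "A *\<^sub>v (P *\<^sub>v unit_vec n j) = pact A (monom 1 (Suc j)) v"
      using pact_monom_Suc[OF A v, of j] by simp
    also have "\<dots> = pact A r v"
    proof (cases "Suc j < k")
      case False
      then have jk: "Suc j = k" using j by simp
      have "pact A f v = 0\<^sub>v n" using ord by simp
      then show ?thesis using pact_diff[OF A v, of "monom 1 k" f] pact_carrier[OF A v, of "monom 1 k"]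
        by (simp add: r_def jk)
    qed (simp add: r_def)
    also have "\<dots> = P *\<^sub>v E (vec k (coeff r))"
      using PE[of "vec k (coeff r)"] R_vec[OF dr] by simp
    finally have APe: "A *\<^sub>v (P *\<^sub>v unit_vec n j) = P *\<^sub>v E (vec k (coeff r))" .
    have En: "E (vec k (coeff r)) \<in> carrier_vec n" unfolding E_def l by simp
    have "col M j = M *\<^sub>v unit_vec n j" using mult_unit_vec[OF M] j kn by simp
    also have "\<dots> = P' *\<^sub>v (A *\<^sub>v (P *\<^sub>v unit_vec n j))"
      unfolding M_def using A P P' by (simp add: assoc_mult_mat_vec[of _ n n _ n])
    also have "\<dots> = (P' * P) *\<^sub>v E (vec k (coeff r))"
      unfolding APe using assoc_mult_mat_vec[OF P'(1) P(1) En] by simp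
    also have "\<dots> = E (vec k (coeff r))" using P' En by simp
    finally show ?thesis unfolding colC .
  qed
  define B where "B = mat k l (\<lambda>(i, j). M $$ (i, j + k))"
  define Z where "Z = mat l l (\<lambda>(i, j). M $$ (i + k, j + k))"
  have MB: "M = four_block_mat (companion f) B (0\<^sub>m l k) Z"
  proof (rule eq_matI)
    fix i j
    assume "i < dim_row (four_block_mat (companion f) B (0\<^sub>m l k) Z)"
      "j < dim_col (four_block_mat (companion f) B (0\<^sub>m l k) Z)"
    then have ij: "i < k + l" "j < k + l" by (auto simp: k_def B_def Z_def)
    show "M $$ (i, j) = four_block_mat (companion f) B (0\<^sub>m l k) Z $$ (i, j)"
    proof (cases "j < k")
      case True
      have "M $$ (i, j) = col M j $ i" using M ij l by simp
      also have "\<dots> = (if i < k then companion f $$ (i, j) else 0)"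
        unfolding colM[OF True] E_def using ij True by (simp add: k_def)
      finally show ?thesis using ij True by (simp add: B_def Z_def k_def)
    next
      case False
      then show ?thesis using ij by (simp add: B_def Z_def k_def)
    qed
  qed (use M l in \<open>simp_all add: k_def B_def Z_def\<close>)
  have "B \<in> carrier_mat k l" "Z \<in> carrier_mat l l" by (simp_all add: B_def Z_def)
  then show ?thesis using sim MB l unfolding k_def by blast
qed

text \<open>The last coordinate of the cyclic block and its iterates under the matrix span a space of functionals that is
  invariant, because \<open>f\<close> kills everything, and dual to the block; their common kernel is an invariant complement.\<close>

lemma cyclic_block_split:
  fixes B :: "'a::{field,finite} mat"
  assumes f: "monic f" and dpos: "0 < degree f" and B: "B \<in> carrier_mat (degree f) l" and Z: "Z \<in> carrier_mat l l"
    and kl: "kills (four_block_mat (companion f) B (0\<^sub>m l (degree f)) Z) f"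
  shows "similar_mat (four_block_mat (companion f) B (0\<^sub>m l (degree f)) Z)
    (four_block_mat (companion f) (0\<^sub>m (degree f) l) (0\<^sub>m l (degree f)) Z)"
proof -
  define k where "k = degree f"
  define C where "C = companion f"
  define M where "M = four_block_mat C B (0\<^sub>m l k) Z"
  have C: "C \<in> carrier_mat k k" by (simp add: C_def k_def)
  have B: "B \<in> carrier_mat k l" using B by (simp add: k_def)
  have M: "M \<in> carrier_mat (k + l) (k + l)" using C Z by (simp add: M_def)
  have k0: "0 < k" using dpos by (simp add: k_def)
  have Mi: "M ^\<^sub>m i \<in> carrier_mat (k + l) (k + l)" for i using M by simp
  \<comment> \<open>The transpose of the companion matrix: it describes how the iterated functionals
    transform under \<open>M\<close>.\<close>
  define C' where "C' = mat k k (\<lambda>(i, j). if Suc i = k then - coeff f j else if j = Suc i then 1 else (0::'a))"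
  define Q1 where "Q1 = mat k k (\<lambda>(i, j). (M ^\<^sub>m i) $$ (k - 1, j))"
  define Q2 where "Q2 = mat k l (\<lambda>(i, j). (M ^\<^sub>m i) $$ (k - 1, k + j))"
  have C': "C' \<in> carrier_mat k k" and Q1: "Q1 \<in> carrier_mat k k" and Q2: "Q2 \<in> carrier_mat k l"
    by (simp_all add: C'_def Q1_def Q2_def)
  \<comment> \<open>Entry \<open>i\<close> is the last coordinate of \<open>M^i y\<close> within the
    cyclic block. \<open>Q1\<close> and \<open>Q2\<close> are the restrictions of this map to the
    two blocks.\<close>
  define Q where "Q y = vec k (\<lambda>i. pact M (monom 1 i) y $ (k - 1))" for y
  have Q_append: "Q (x @\<^sub>v y) = Q1 *\<^sub>v x + Q2 *\<^sub>v y" if x: "x \<in> carrier_vec k" and y: "y \<in> carrier_vec l" for x y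
  proof (rule eq_vecI)
    fix i assume "i < dim_vec (Q1 *\<^sub>v x + Q2 *\<^sub>v y)"
    then have i: "i < k" using Q2 by simp
    have xy: "x @\<^sub>v y \<in> carrier_vec (k + l)" using x y by simp
    have r: "row (M ^\<^sub>m i) (k - 1) = row Q1 i @\<^sub>v row Q2 i"
      using carrier_matD[OF M] i k0 by (intro eq_vecI) (auto simp: Q1_def Q2_def)
    have "Q (x @\<^sub>v y) $ i = row (M ^\<^sub>m i) (k - 1) \<bullet> (x @\<^sub>v y)"
      using i k0 carrier_matD[OF M] by (simp add: Q_def pact_monom[OF M xy])
    also have "\<dots> = row Q1 i \<bullet> x + row Q2 i \<bullet> y"
      unfolding r by (rule scalar_prod_append) (use Q1 Q2 x y i in auto)
    finally show "Q (x @\<^sub>v y) $ i = (Q1 *\<^sub>v x + Q2 *\<^sub>v y) $ i" using i Q1 Q2 by simp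
  qed (use Q2 in \<open>simp add: Q_def\<close>)
  have QM: "Q (M *\<^sub>v y) = C' *\<^sub>v Q y" if y: "y \<in> carrier_vec (k + l)" for y
  proof (rule eq_vecI)
    fix i assume "i < dim_vec (C' *\<^sub>v Q y)"
    then have i: "i < k" using C' by simp
    have k1: "k - 1 < k + l" using k0 by simp
    have "Q (M *\<^sub>v y) $ i = pact M (monom 1 (Suc i)) y $ (k - 1)"
      using i by (simp add: Q_def pact_mult_mat_vec[OF M y] pact_monom_Suc[OF M y])
    also have "\<dots> = (C' *\<^sub>v Q y) $ i"
    proof (cases "Suc i = k")
      case True
      \<comment> \<open>Here it matters that \<open>f\<close> kills the whole space and not just the
        cyclic block: the \<open>k\<close>-th iterate is expressed by lower ones for every
        \<open>y\<close>.\<close>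
      have "pact M f y = 0\<^sub>v (k + l)" using kl y carrier_matD(1)[OF M] unfolding kills_def M_def C_def k_def by metis
      then have "0 = pact M f y $ (k - 1)" using k1 by simp
      also have "\<dots> = (\<Sum>j\<le>k. coeff f j * pact M (monom 1 j) y $ (k - 1))"
        by (rule pact_index[OF M y k1]) (simp add: k_def)
      also have "\<dots> = (\<Sum>j<k. coeff f j * pact M (monom 1 j) y $ (k - 1)) + pact M (monom 1 k) y $ (k - 1)"
        using f by (simp add: k_def lessThan_Suc_atMost[symmetric])
      finally have "pact M (monom 1 k) y $ (k - 1) = - (\<Sum>j<k. coeff f j * pact M (monom 1 j) y $ (k - 1))"
        by (simp add: eq_neg_iff_add_eq_0 add.commute)
      also have "\<dots> = (\<Sum>j<k. - coeff f j * pact M (monom 1 j) y $ (k - 1))" by (simp add: sum_negf)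
      finally show ?thesis using True i
        by (simp add: C'_def Q_def scalar_prod_def lessThan_atLeast0)
    next
      case False
      have "(C' *\<^sub>v Q y) $ i = (\<Sum>j<k. (if j = Suc i then 1 else 0) * pact M (monom 1 j) y $ (k - 1))"
        using i False by (simp add: C'_def Q_def scalar_prod_def lessThan_atLeast0)
      also have "\<dots> = (\<Sum>j<k. if j = Suc i then pact M (monom 1 j) y $ (k - 1) else 0)"
        by (rule sum.cong) auto
      also have "\<dots> = pact M (monom 1 (Suc i)) y $ (k - 1)" using i False by simp
      finally show ?thesis by simp
    qed
    finally show "Q (M *\<^sub>v y) $ i = (C' *\<^sub>v Q y) $ i" .
  qed (use C' in \<open>simp add: Q_def\<close>)
  have M_append: "M *\<^sub>v (x @\<^sub>v y) = (C *\<^sub>v x + B *\<^sub>v y) @\<^sub>v Z *\<^sub>v y"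
    if "x \<in> carrier_vec k" "y \<in> carrier_vec l" for x y
  proof -
    have "0\<^sub>m l k *\<^sub>v x + Z *\<^sub>v y = Z *\<^sub>v y" using that Z by (intro eq_vecI) auto
    then show ?thesis
      unfolding M_def using four_block_mat_mult_vec[OF C B zero_carrier_mat Z that] by simp
  qed
  have M_left: "M *\<^sub>v (x @\<^sub>v 0\<^sub>v l) = (C *\<^sub>v x) @\<^sub>v 0\<^sub>v l" if x: "x \<in> carrier_vec k" for x
  proof -
    have "C *\<^sub>v x + 0\<^sub>v k = C *\<^sub>v x" using x C by (intro right_zero_vec) auto
    then show ?thesis
      unfolding M_append[OF x zero_carrier_vec] mult_mat_zero_vec[OF B] mult_mat_zero_vec[OF Z] by simp
  qed
  have pact_left: "pact M p (x @\<^sub>v 0\<^sub>v l) = pact C p x @\<^sub>v 0\<^sub>v l" if x: "x \<in> carrier_vec k" for x p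
  proof (induction p)
    case 0
    then show ?case using x by (intro eq_vecI) auto
  next
    case (pCons c p)
    have xe: "x @\<^sub>v 0\<^sub>v l \<in> carrier_vec (k + l)" using x by simp
    have cp: "pact C p x \<in> carrier_vec k" using C x by simp
    have "C *\<^sub>v pact C p x \<in> carrier_vec k" using C cp by auto
    then show ?case unfolding pact_pCons[OF M xe] pact_pCons[OF C x] pCons.IH M_left[OF cp]
      using x carrier_matD[OF C] by (intro eq_vecI) auto
  qed
  have Q_left: "Q (x @\<^sub>v 0\<^sub>v l) = Q1 *\<^sub>v x" if x: "x \<in> carrier_vec k" for x
  proof -
    have "Q1 *\<^sub>v x + 0\<^sub>v k = Q1 *\<^sub>v x" using x Q1 by (intro right_zero_vec) auto
    then show ?thesis unfolding Q_append[OF x zero_carrier_vec] mult_mat_zero_vec[OF Q2] .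
  qed
  have detQ1: "det Q1 \<noteq> 0"
  proof
    assume "det Q1 = 0"
    then obtain x where x: "x \<in> carrier_vec k" "x \<noteq> 0\<^sub>v k" "Q1 *\<^sub>v x = 0\<^sub>v k"
      using det_0_iff_vec_prod_zero[OF Q1] by blast
    obtain p where p: "x = vec k (coeff p)" "degree p < k \<or> p = 0" using vec_coeff_poly[OF x(1)] by blast
    have p0: "p \<noteq> 0"
    proof
      assume "p = 0"
      then have "x = 0\<^sub>v k" unfolding p(1) by (intro eq_vecI) simp_all
      then show False using x(2) by contradiction
    qed
    then have dp: "degree p < k" using p(2) by blast
    \<comment> \<open>Chosen so that \<open>X^i p\<close> has degree exactly \<open>k - 1\<close>:
      it needs no reduction modulo \<open>f\<close>, and its last coordinate is the leading
      coefficient of \<open>p\<close>.\<close>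
    define i where "i = k - 1 - degree p"
    have ik: "i < k" and id: "i + degree p = k - 1" using dp by (auto simp: i_def)
    have e: "unit_vec k 0 \<in> carrier_vec k" by simp
    have xp: "x = pact C p (unit_vec k 0)"
      using pact_companion_small[of p f] dp p(1) by (simp add: C_def k_def)
    have dm: "degree (monom 1 i * p) < degree f"
      using p0 dp id by (simp add: degree_mult_eq degree_monom_eq k_def)
    have "(Q1 *\<^sub>v x) $ i = pact C (monom 1 i) x $ (k - 1)"
      unfolding Q_left[OF x(1), symmetric] using ik k0 x(1) carrier_vecD[OF pact_carrier[OF C x(1)]]
      by (simp add: Q_def pact_left[OF x(1)])
    also have "\<dots> = pact C (monom 1 i * p) (unit_vec k 0) $ (k - 1)"
      unfolding pact_mult[OF C e] xp[symmetric] ..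
    also have "\<dots> = coeff (monom 1 i * p) (k - 1)"
      using pact_companion_small[OF dm] k0 by (simp add: C_def k_def)
    also have "\<dots> = lead_coeff p" unfolding id[symmetric] by (simp add: coeff_monom_mult)
    finally have "lead_coeff p = 0" using x(3) ik by simp
    then show False using p0 by simp
  qed
  have simC: "similar_mat C C'"
  proof (rule similar_mat_intertwine[OF Q1 C C' detQ1])
    show "Q1 * C = C' * Q1"
    proof (rule mat_eq_by_mult_vec)
      fix y :: "'a vec" assume y: "y \<in> carrier_vec k"
      have Cy: "C *\<^sub>v y \<in> carrier_vec k" using C y by auto
      have ye: "y @\<^sub>v 0\<^sub>v l \<in> carrier_vec (k + l)" using y by simp
      have "Q1 *\<^sub>v (C *\<^sub>v y) = C' *\<^sub>v (Q1 *\<^sub>v y)"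
        unfolding Q_left[OF Cy, symmetric] Q_left[OF y, symmetric] M_left[OF y, symmetric] by (rule QM[OF ye])
      then show "(Q1 * C) *\<^sub>v y = (C' * Q1) *\<^sub>v y"
        using assoc_mult_mat_vec[OF Q1 C y] assoc_mult_mat_vec[OF C' Q1 y] by simp
    qed (use Q1 C C' in auto)
  qed
  \<comment> \<open>New coordinates: the functionals \<open>Q\<close> in place of the first block,
    the old coordinates on the second. The kernel of \<open>Q\<close> becomes the complement;
    \<open>Q1\<close> later turns \<open>C'\<close> back into \<open>C\<close>.\<close>
  define T where "T = four_block_mat Q1 Q2 (0\<^sub>m l k) (1\<^sub>m l)"
  have T: "T \<in> carrier_mat (k + l) (k + l)" using Q1 by (simp add: T_def)
  have T_append: "T *\<^sub>v (x @\<^sub>v y) = Q (x @\<^sub>v y) @\<^sub>v y" if x: "x \<in> carrier_vec k" and y: "y \<in> carrier_vec l" for x y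
  proof -
    have "0\<^sub>m l k *\<^sub>v x + 1\<^sub>m l *\<^sub>v y = y" using that by (intro eq_vecI) auto
    then show ?thesis unfolding T_def Q_append[OF that]
      using four_block_mat_mult_vec[OF Q1 Q2 zero_carrier_mat one_carrier_mat that] by simp
  qed
  define N where "N = four_block_mat C' (0\<^sub>m k l) (0\<^sub>m l k) Z"
  have N: "N \<in> carrier_mat (k + l) (k + l)" using C' Z by (simp add: N_def)
  have "det T = det Q1 * det (1\<^sub>m l)"
    unfolding T_def by (rule det_four_block_mat_lower_left_zero[OF Q1 Q2 refl one_carrier_mat])
  then have detT: "det T \<noteq> 0" using detQ1 by simp
  have simM: "similar_mat M N"
  proof (rule similar_mat_intertwine[OF T M N detT])
    show "T * M = N * T"
    proof (rule mat_eq_by_mult_vec)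
      fix z :: "'a vec" assume z: "z \<in> carrier_vec (k + l)"
      obtain x y where xy: "x \<in> carrier_vec k" "y \<in> carrier_vec l" "z = x @\<^sub>v y"
        using vec_append_split[OF z] by blast
      have c: "C *\<^sub>v x + B *\<^sub>v y \<in> carrier_vec k" "Z *\<^sub>v y \<in> carrier_vec l" using C B Z xy by auto
      have "T *\<^sub>v (M *\<^sub>v z) = Q (M *\<^sub>v z) @\<^sub>v (Z *\<^sub>v y)"
        unfolding xy(3) M_append[OF xy(1,2)] by (rule T_append[OF c])
      also have "\<dots> = (C' *\<^sub>v Q z) @\<^sub>v (Z *\<^sub>v y)" using QM[OF z] by simp
      also have "\<dots> = N *\<^sub>v (Q z @\<^sub>v y)"
        unfolding N_def by (rule mult_mat_vec_split[OF C' Z _ xy(2), symmetric]) (simp add: Q_def)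
      also have "\<dots> = N *\<^sub>v (T *\<^sub>v z)" unfolding xy(3) T_append[OF xy(1,2)] ..
      finally show "(T * M) *\<^sub>v z = (N * T) *\<^sub>v z"
        using assoc_mult_mat_vec[OF T M z] assoc_mult_mat_vec[OF N T z] by simp
    qed (use T M N in auto)
  qed
  have "similar_mat N (four_block_mat C (0\<^sub>m k l) (0\<^sub>m l k) Z)"
    unfolding N_def
    by (rule similar_mat_four_block_0_0[OF similar_mat_sym[OF simC] similar_mat_refl[OF Z] C' Z])
  then show ?thesis using similar_mat_trans[OF simM] unfolding M_def C_def k_def by blast
qed

text \<open>A vector of maximal order is split off, so its order \<open>f\<close> kills everything.
  The conclusion \<open>kills Z f\<close> is what makes all later invariant factors divide
  \<open>f\<close>.\<close>

lemma cyclic_decomposition: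
  fixes A :: "'a::{field,finite} mat"
  assumes A: "A \<in> carrier_mat n n" and n: "0 < n"
  obtains f l Z where "monic f" "0 < degree f" "n = degree f + l" "Z \<in> carrier_mat l l" "kills Z f"
    "similar_mat A (four_block_mat (companion f) (0\<^sub>m (degree f) l) (0\<^sub>m l (degree f)) Z)"
proof -
  obtain v f where v: "v \<in> carrier_vec n" and f: "monic f" "kills A f"
    and ord: "\<And>p. pact A p v = 0\<^sub>v n \<longleftrightarrow> f dvd p"
    using ex_max_order_vec[OF A] by blast
  have dpos: "0 < degree f"
  proof (rule ccontr)
    assume "\<not> 0 < degree f"
    then have "f dvd 1" using f(1) by (metis degree_eq_zeroE dvd_refl gr0I lead_coeff_pCons(2) one_pCons pCons_eq_0_iff)
    then have "pact A 1 (unit_vec n 0) = 0\<^sub>v n"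
      using pact_0_dvd[OF A unit_vec_carrier, of f 0 1] f(2) unit_vec_carrier[of n 0]
      unfolding kills_def carrier_matD(1)[OF A] by blast
    then have "unit_vec n 0 = (0\<^sub>v n :: 'a vec)" by (simp add: pact_1[OF A])
    then show False using n by simp
  qed
  obtain l B Z where l: "n = degree f + l" and B: "B \<in> carrier_mat (degree f) l" and Z: "Z \<in> carrier_mat l l"
    and sim: "similar_mat A (four_block_mat (companion f) B (0\<^sub>m l (degree f)) Z)"
    using krylov_triangularize[OF A v f(1) ord dpos] by blast
  have "kills (four_block_mat (companion f) B (0\<^sub>m l (degree f)) Z) f"
    using kills_similar[OF A sim] f(2) by blast
  from similar_mat_trans[OF sim cyclic_block_split[OF f(1) dpos B Z this]]
  have sim': "similar_mat A (four_block_mat (companion f) (0\<^sub>m (degree f) l) (0\<^sub>m l (degree f)) Z)" .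
  have "kills Z f" using kills_similar[OF A sim'] f(2) kills_four_block[OF companion_carrier Z] by blast
  then show ?thesis using that f(1) dpos l Z sim' by blast
qed

section \<open>Block sums of companion matrices\<close>

definition companions :: "'a::field poly list \<Rightarrow> 'a mat" where
  "companions fs = diag_block_mat (map companion fs)"

abbreviation total_degree :: "'a::zero poly list \<Rightarrow> nat" where
  "total_degree fs \<equiv> sum_list (map degree fs)"

lemma companions_Nil: "companions [] = 1\<^sub>m 0"
  unfolding companions_def by (simp add: mat_eq_iff)

lemma companions_carrier: "companions fs \<in> carrier_mat (total_degree fs) (total_degree fs)"
  unfolding companions_def
  by (rule carrier_matI) (simp_all add: dim_diag_block_mat o_def)

lemma companions_Cons:
  "companions (f # fs) = four_block_mat (companion f)
     (0\<^sub>m (degree f) (total_degree fs)) (0\<^sub>m (total_degree fs) (degree f)) (companions fs)"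
  using companions_carrier[of fs] by (simp add: companions_def Let_def)

lemma kills_companions_iff:
  assumes "\<forall>f\<in>set fs. monic f"
  shows "kills (companions fs) p \<longleftrightarrow> (\<forall>f\<in>set fs. f dvd p)"
  using assms
proof (induction fs)
  case Nil
  have "pact (1\<^sub>m 0) p v = 0\<^sub>v 0" if "v \<in> carrier_vec 0" for v
    using pact_carrier[OF one_carrier_mat that, of p] by (metis carrier_vecD vec_of_dim_0)
  then show ?case by (simp add: kills_def companions_Nil)
next
  case (Cons f fs)
  then show ?case
    unfolding companions_Cons kills_four_block[OF companion_carrier companions_carrier]
    by (simp add: kills_companion_iff)
qed

text \<open>Expansion along the first row, where only the last entry can be nonzero and its minor is
  an identity matrix.\<close>

lemma det_companion:
  assumes "monic f"
  shows "det (companion f) = (-1) ^ degree f * coeff f 0"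
proof (cases "degree f")
  case 0
  have "det (companion f) = 1" using companion_carrier[of f] 0 by (intro det_dim_zero) simp
  then show ?thesis using assms 0 by simp
next
  case (Suc d)
  define C where "C = companion f"
  have C: "C \<in> carrier_mat (Suc d) (Suc d)" using companion_carrier[of f] Suc by (simp add: C_def)
  have md: "mat_delete C 0 d = 1\<^sub>m d"
    using Suc by (intro eq_matI) (auto simp: mat_delete_def C_def companion_def)
  have "det C = (\<Sum>j<Suc d. C $$ (0, j) * cofactor C 0 j)" by (rule laplace_expansion_row[OF C]) simp
  also have "\<dots> = (\<Sum>j<Suc d. if j = d then - coeff f 0 * cofactor C 0 d else 0)"
    using Suc by (intro sum.cong) (auto simp: C_def companion_def)
  also have "\<dots> = - coeff f 0 * (-1) ^ d" by (simp add: cofactor_def md)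
  finally show ?thesis unfolding C_def Suc by simp
qed

lemma det_companions:
  assumes "\<forall>f\<in>set fs. monic f"
  shows "det (companions fs) = (\<Prod>f\<leftarrow>fs. (-1) ^ degree f * coeff f 0)"
  using assms
proof (induction fs)
  case Nil
  then show ?case by (simp add: companions_Nil)
next
  case (Cons f fs)
  have "det (companions (f # fs)) = det (companion f) * det (companions fs)"
    unfolding companions_Cons
    by (rule det_four_block_mat_lower_left_zero[OF companion_carrier zero_carrier_mat refl companions_carrier])
  then show ?case using Cons by (simp add: det_companion)
qed

section \<open>Conjugacy classes of the general linear group\<close>

lemma carrier_GL: "carrier (GL n :: 'a::field mat monoid) = {A \<in> carrier_mat n n. det A \<noteq> 0}"
proof -
  have "carrier (GL n :: 'a mat monoid) = Units (ring_mat TYPE('a) n ())" by (simp add: GL_def units_of_def)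
  also have "\<dots> = {A \<in> carrier_mat n n. det A \<noteq> 0}"
  proof (intro equalityI subsetI)
    fix A assume A: "A \<in> Units (ring_mat TYPE('a) n ())"
    then have "A \<in> carrier_mat n n" by (simp add: Units_def ring_mat_def)
    then show "A \<in> {A \<in> carrier_mat n n. det A \<noteq> 0}" using unit_imp_det_non_zero[OF A] by simp
  next
    fix A assume "A \<in> {A \<in> carrier_mat n n. det (A :: 'a mat) \<noteq> 0}"
    then show "A \<in> Units (ring_mat TYPE('a) n ())" using det_non_zero_imp_unit[of A n "()"] by simp
  qed
  finally show ?thesis .
qed

lemma mult_GL [simp]: "x \<otimes>\<^bsub>GL n\<^esub> y = x * y"
  by (simp add: GL_def units_of_def ring_mat_def)

lemma one_GL [simp]: "\<one>\<^bsub>GL n\<^esub> = 1\<^sub>m n"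
  by (simp add: GL_def units_of_def ring_mat_def)

lemma group_GL: "group (GL n :: 'a::field mat monoid)"
proof -
  interpret semiring "ring_mat TYPE('a) n ()" by (rule semiring_mat)
  show ?thesis unfolding GL_def by (rule units_group)
qed

text \<open>Sending \<open>x\<close> to \<open>x d x^-1\<close> maps the group onto the class of
  \<open>d\<close>, and the fibre over \<open>g\<close> is a coset of the centralizer of
  \<open>g\<close>. Hence a sum over the group weighted by centralizer orders becomes a sum over
  classes, each counted with the group order.\<close>

lemma (in group) sum_card_centralizers_conj_class:
  assumes fin: "finite (carrier G)" and d: "d \<in> carrier G"
  shows "(\<Sum>g\<in>{g \<in> carrier G. \<exists>x\<in>carrier G. x \<otimes> d = g \<otimes> x}. card {h \<in> carrier G. g \<otimes> h = h \<otimes> g})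
    = card (carrier G)"
proof -
  define \<phi> where "\<phi> x = x \<otimes> d \<otimes> inv x" for x
  define K where "K = {g \<in> carrier G. \<exists>x\<in>carrier G. x \<otimes> d = g \<otimes> x}"
  have \<phi>_iff: "\<phi> x = g \<longleftrightarrow> x \<otimes> d = g \<otimes> x" if "x \<in> carrier G" "g \<in> carrier G" for x g
    using that d by (metis \<phi>_def inv_solve_right m_closed)
  have \<phi>K: "\<phi> ` carrier G \<subseteq> K"
  proof
    fix g assume "g \<in> \<phi> ` carrier G"
    then obtain x where x: "x \<in> carrier G" "g = \<phi> x" by blast
    have g: "g \<in> carrier G" using x d by (simp add: \<phi>_def)
    then show "g \<in> K" using x \<phi>_iff[OF x(1) g] by (auto simp: K_def)
  qed
  have fibre: "card {x \<in> carrier G. \<phi> x = g} = card {h \<in> carrier G. g \<otimes> h = h \<otimes> g}" if gK: "g \<in> K" for g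
  proof -
    obtain y where g: "g \<in> carrier G" and y: "y \<in> carrier G" "y \<otimes> d = g \<otimes> y"
      using gK unfolding K_def by blast
    have "bij_betw (\<lambda>h. h \<otimes> y) {h \<in> carrier G. g \<otimes> h = h \<otimes> g} {x \<in> carrier G. \<phi> x = g}"
    proof (rule bij_betw_byWitness[where f' = "\<lambda>x. x \<otimes> inv y"])
      show "\<forall>h\<in>{h \<in> carrier G. g \<otimes> h = h \<otimes> g}. h \<otimes> y \<otimes> inv y = h"
        using y by (simp add: m_assoc)
      show "\<forall>x\<in>{x \<in> carrier G. \<phi> x = g}. x \<otimes> inv y \<otimes> y = x"
        using y by (simp add: m_assoc)
      show "(\<lambda>h. h \<otimes> y) ` {h \<in> carrier G. g \<otimes> h = h \<otimes> g} \<subseteq> {x \<in> carrier G. \<phi> x = g}"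
      proof
        fix z assume "z \<in> (\<lambda>h. h \<otimes> y) ` {h \<in> carrier G. g \<otimes> h = h \<otimes> g}"
        then obtain h where h: "h \<in> carrier G" "g \<otimes> h = h \<otimes> g" "z = h \<otimes> y" by blast
        have "z \<otimes> d = h \<otimes> (g \<otimes> y)" using h y d by (simp add: m_assoc)
        also have "\<dots> = g \<otimes> z" using h g y by (simp flip: m_assoc)
        finally show "z \<in> {x \<in> carrier G. \<phi> x = g}" using \<phi>_iff[of z g] g h y by simp
      qed
      show "(\<lambda>x. x \<otimes> inv y) ` {x \<in> carrier G. \<phi> x = g} \<subseteq> {h \<in> carrier G. g \<otimes> h = h \<otimes> g}"
      proof
        fix z assume "z \<in> (\<lambda>x. x \<otimes> inv y) ` {x \<in> carrier G. \<phi> x = g}"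
        then obtain x where x: "x \<in> carrier G" "\<phi> x = g" "z = x \<otimes> inv y" by blast
        have xd: "x \<otimes> d = g \<otimes> x" using \<phi>_iff x g by blast
        have "inv y \<otimes> g = inv y \<otimes> (g \<otimes> y) \<otimes> inv y" using y(1) g by (simp add: m_assoc)
        also have "\<dots> = inv y \<otimes> (y \<otimes> d) \<otimes> inv y" using y(2) by simp
        also have "\<dots> = d \<otimes> inv y" using y(1) d by (simp flip: m_assoc)
        finally have yg: "inv y \<otimes> g = d \<otimes> inv y" .
        have "z \<otimes> g = x \<otimes> (d \<otimes> inv y)" using x y g yg by (simp add: m_assoc)
        also have "\<dots> = g \<otimes> x \<otimes> inv y" using xd x y d by (simp flip: m_assoc)
        also have "\<dots> = g \<otimes> z" using x y g by (simp add: m_assoc)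
        finally show "z \<in> {h \<in> carrier G. g \<otimes> h = h \<otimes> g}" using x y by simp
      qed
    qed
    then show ?thesis by (rule bij_betw_same_card[symmetric])
  qed
  have finK: "finite K" using fin by (simp add: K_def)
  have "card (carrier G) = (\<Sum>x\<in>carrier G. 1)" by simp
  also have "\<dots> = (\<Sum>g\<in>K. \<Sum>x\<in>{x \<in> carrier G. \<phi> x = g}. 1)"
    by (rule sum.group[OF fin finK \<phi>K, symmetric])
  also have "\<dots> = (\<Sum>g\<in>K. card {h \<in> carrier G. g \<otimes> h = h \<otimes> g})"
    using fibre by (intro sum.cong) auto
  finally show ?thesis by (simp add: K_def)
qed

lemma (in group) class_number_times_order:
  assumes fin: "finite (carrier G)"
  shows "class_number G * card (carrier G) = card {(x, y) \<in> carrier G \<times> carrier G. x \<otimes> y = y \<otimes> x}"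
proof -
  let ?f = "\<lambda>g. \<lambda>x\<in>carrier G. g \<otimes> x \<otimes> inv g"
  have inv: "invariants (carrier G) ?f g = {x \<in> carrier G. g \<otimes> x = x \<otimes> g}" if g: "g \<in> carrier G" for g
    unfolding invariants_def using g by (auto simp: inv_solve_right')
  have "class_number G * card (carrier G) = (\<Sum>g\<in>carrier G. card (invariants (carrier G) ?f g))"
    using group_action.burnside[OF action_by_conjugation fin fin]
    by (simp add: class_number_def conjugacy_classes_def Coset.order_def)
  also have "\<dots> = (\<Sum>g\<in>carrier G. card {x \<in> carrier G. g \<otimes> x = x \<otimes> g})" using inv by simp
  also have "\<dots> = card (SIGMA g:carrier G. {x \<in> carrier G. g \<otimes> x = x \<otimes> g})"
    using fin by (simp add: card_SigmaI)
  also have "(SIGMA g:carrier G. {x \<in> carrier G. g \<otimes> x = x \<otimes> g}) = {(x, y) \<in> carrier G \<times> carrier G. x \<otimes> y = y \<otimes> x}"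
    by auto
  finally show ?thesis .
qed

text \<open>The type-class field as a record with a carrier, the form in which the multiplicative
  group of a finite field is known to be cyclic.\<close>

definition field_ring :: "'a::field itself \<Rightarrow> 'a ring" where
  "field_ring T = \<lparr>carrier = UNIV, monoid.mult = times, one = 1, ring.zero = 0, add = (+)\<rparr>"

lemma field_field_ring: "Ring.field (field_ring TYPE('a::field))"
proof -
  have *: "\<exists>y. x + y = 0" for x :: 'a
    by (rule exI[of _ "- x"]) simp
  interpret cring "field_ring TYPE('a)"
    by unfold_locales (auto simp: field_ring_def Units_def algebra_simps intro: *)
  show ?thesis
  proof (rule cring_fieldI)
    have "\<exists>y. y * x = 1 \<and> x * y = 1" if "x \<noteq> 0" for x :: 'a
      by (rule exI[of _ "inverse x"]) (use that in simp)
    then show "Units (field_ring TYPE('a)) = carrier (field_ring TYPE('a)) - {\<zero>\<^bsub>field_ring TYPE('a)\<^esub>}"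
      by (auto simp: field_ring_def Units_def)
  qed
qed

lemma ex_primitive_element: "\<exists>g::'a::{field,finite}. g \<noteq> 0 \<and> (\<forall>x. x \<noteq> 0 \<longrightarrow> (\<exists>i. x = g ^ i))"
proof -
  interpret F: Ring.field "field_ring TYPE('a)" by (rule field_field_ring)
  have pw: "x [^]\<^bsub>field_ring TYPE('a)\<^esub> (i::nat) = x ^ i" for x :: 'a and i
    by (induction i) (simp_all add: field_ring_def nat_pow_def)
  have "finite (carrier (field_ring TYPE('a)))" by (simp add: field_ring_def)
  from F.finite_field_mult_group_has_gen[OF this] obtain a :: 'a where
    a: "a \<in> carrier (mult_of (field_ring TYPE('a)))"
    "carrier (mult_of (field_ring TYPE('a))) = {a [^]\<^bsub>field_ring TYPE('a)\<^esub> i |i::nat. i \<in> UNIV}" by blast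
  have c: "carrier (mult_of (field_ring TYPE('a))) = UNIV - {0}" by (simp add: field_ring_def)
  have "a \<noteq> 0 \<and> (\<forall>x. x \<noteq> 0 \<longrightarrow> (\<exists>i. x = a ^ i))"
    using a unfolding c pw by blast
  then show ?thesis by blast
qed

text \<open>A similarity invariant that stands in for the dimension of the kernel of
  \<open>p(A)\<close>. It is multiplicative over blocks and never zero, so the contribution of a
  common block can be cancelled.\<close>

definition kernel_card :: "'a::field mat \<Rightarrow> 'a poly \<Rightarrow> nat" where
  "kernel_card A p = card {v \<in> carrier_vec (dim_row A). pact A p v = 0\<^sub>v (dim_row A)}"

lemma kernel_card_eq_iff_kills:
  fixes A :: "'a::{field,finite} mat"
  assumes A: "A \<in> carrier_mat n n"
  shows "kernel_card A p = CARD('a) ^ n \<longleftrightarrow> kills A p"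
proof -
  have "kernel_card A p = card (carrier_vec n :: 'a vec set)
      \<longleftrightarrow> {v \<in> carrier_vec n. pact A p v = 0\<^sub>v n} = carrier_vec n"
    unfolding kernel_card_def carrier_matD(1)[OF A]
    by (metis (no_types, lifting) card_subset_eq finite_carrier_vec mem_Collect_eq subsetI)
  also have "\<dots> \<longleftrightarrow> kills A p" unfolding kills_def carrier_matD(1)[OF A] by blast
  finally show ?thesis unfolding card_carrier_vec .
qed

lemma kernel_card_pos:
  fixes A :: "'a::{field,finite} mat"
  assumes A: "A \<in> carrier_mat n n"
  shows "0 < kernel_card A p"
proof -
  have "0\<^sub>v n \<in> {v \<in> carrier_vec n. pact A p v = 0\<^sub>v n}" using A by simp
  then show ?thesis unfolding kernel_card_def carrier_matD(1)[OF A]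
    by (metis (no_types, lifting) card_gt_0_iff empty_iff finite_Collect_conjI finite_carrier_vec finite_subset mem_Collect_eq subsetI)
qed

lemma kernel_card_four_block:
  assumes A: "A \<in> carrier_mat k k" and B: "B \<in> carrier_mat l l"
  shows "kernel_card (four_block_mat A (0\<^sub>m k l) (0\<^sub>m l k) B) p = kernel_card A p * kernel_card B p"
proof -
  define M where "M = four_block_mat A (0\<^sub>m k l) (0\<^sub>m l k) B"
  have M: "M \<in> carrier_mat (k + l) (k + l)" using A B by (simp add: M_def)
  define S where "S = {v \<in> carrier_vec k. pact A p v = 0\<^sub>v k}"
  define T where "T = {v \<in> carrier_vec l. pact B p v = 0\<^sub>v l}"
  have eq: "pact M p (x @\<^sub>v y) = 0\<^sub>v (k + l) \<longleftrightarrow> pact A p x = 0\<^sub>v k \<and> pact B p y = 0\<^sub>v l"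
    if "x \<in> carrier_vec k" "y \<in> carrier_vec l" for x y
    unfolding M_def pact_four_block[OF A B that]
    using append_vec_eq_0 pact_carrier[OF A that(1)] pact_carrier[OF B that(2)] by blast
  have "bij_betw (\<lambda>(x, y). x @\<^sub>v y) (S \<times> T) {v \<in> carrier_vec (k + l). pact M p v = 0\<^sub>v (k + l)}"
  proof (rule bij_betw_imageI)
    show "inj_on (\<lambda>(x, y). x @\<^sub>v y) (S \<times> T)"
    proof (rule inj_onI, clarify)
      fix x y x' y' assume "x \<in> S" "x' \<in> S" "x @\<^sub>v y = x' @\<^sub>v y'"
      then show "x = x' \<and> y = y'" using append_vec_eq[of x k x' y y'] unfolding S_def by blast
    qed
    show "(\<lambda>(x, y). x @\<^sub>v y) ` (S \<times> T) = {v \<in> carrier_vec (k + l). pact M p v = 0\<^sub>v (k + l)}"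
    proof (intro equalityI subsetI)
      fix v assume "v \<in> (\<lambda>(x, y). x @\<^sub>v y) ` (S \<times> T)"
      then obtain x y where "x \<in> S" "y \<in> T" "v = x @\<^sub>v y" by auto
      then show "v \<in> {v \<in> carrier_vec (k + l). pact M p v = 0\<^sub>v (k + l)}"
        using eq[of x y] unfolding S_def T_def by simp
    next
      fix v assume v: "v \<in> {v \<in> carrier_vec (k + l). pact M p v = 0\<^sub>v (k + l)}"
      then obtain x y where xy: "x \<in> carrier_vec k" "y \<in> carrier_vec l" "v = x @\<^sub>v y"
        using vec_append_split[of v k l] by blast
      then have "x \<in> S" "y \<in> T" using v eq[OF xy(1,2)] unfolding S_def T_def by simp_all
      then show "v \<in> (\<lambda>(x, y). x @\<^sub>v y) ` (S \<times> T)" using xy(3) by force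
    qed
  qed
  from bij_betw_same_card[OF this] show ?thesis
    unfolding kernel_card_def carrier_matD(1)[OF A] carrier_matD(1)[OF B] M_def[symmetric] carrier_matD(1)[OF M]
    unfolding S_def[symmetric] T_def[symmetric] card_cartesian_product by simp
qed

lemma similar_mat_intertwiner:
  assumes A: "A \<in> carrier_mat n n" and s: "similar_mat A B"
  obtains P where "P \<in> carrier_mat n n" "det P \<noteq> (0::'a::field)" "P * A = B * P"
proof -
  obtain P Q where w: "similar_mat_wit A B P Q" using s unfolding similar_mat_def by blast
  note W = similar_mat_witD2[OF A w]
  have "Q * A = Q * (P * B * Q)" using W(3) by simp
  also have "\<dots> = Q * (P * (B * Q))" using W(5-7) by (simp add: assoc_mult_mat[of _ n n _ n _ n])
  also have "\<dots> = Q * P * (B * Q)" using W by (intro assoc_mult_mat[symmetric]) auto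
  also have "\<dots> = B * Q" using W by simp
  finally have "Q * A = B * Q" .
  moreover have "det Q * det P = 1" using det_mult[OF W(7) W(6)] W(2) by simp
  then have "det Q \<noteq> 0" by auto
  ultimately show ?thesis using that W(7) by blast
qed

lemma kernel_card_similar_le:
  fixes A B :: "'a::{field,finite} mat"
  assumes A: "A \<in> carrier_mat n n" and s: "similar_mat A B"
  shows "kernel_card A p \<le> kernel_card B p"
proof -
  obtain P where P: "P \<in> carrier_mat n n" "det P \<noteq> 0" "P * A = B * P"
    using similar_mat_intertwiner[OF A s] by blast
  have B: "B \<in> carrier_mat n n" using similar_matD[OF s] A by auto
  have inj: "inj_on (\<lambda>x. P *\<^sub>v x) (carrier_vec n)"
    using det_0_iff_vec_prod_zero[OF P(1)] P(2) by (intro inj_on_mult_mat_vec[OF P(1)]) blast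
  show ?thesis
    unfolding kernel_card_def carrier_matD(1)[OF A] carrier_matD(1)[OF B]
  proof (rule card_inj_on_le)
    show "inj_on (\<lambda>x. P *\<^sub>v x) {v \<in> carrier_vec n. pact A p v = 0\<^sub>v n}"
      by (rule inj_on_subset[OF inj]) blast
    show "(\<lambda>x. P *\<^sub>v x) ` {v \<in> carrier_vec n. pact A p v = 0\<^sub>v n} \<subseteq> {v \<in> carrier_vec n. pact B p v = 0\<^sub>v n}"
    proof
      fix y assume "y \<in> (\<lambda>x. P *\<^sub>v x) ` {v \<in> carrier_vec n. pact A p v = 0\<^sub>v n}"
      then obtain v where v: "v \<in> carrier_vec n" "pact A p v = 0\<^sub>v n" "y = P *\<^sub>v v" by blast
      have "pact B p y = 0\<^sub>v n"
        using pact_intertwine[OF A B P(1) P(3) v(1), of p] v mult_mat_zero_vec[OF P(1)] by simp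
      moreover have "y \<in> carrier_vec n" using v P by auto
      ultimately show "y \<in> {v \<in> carrier_vec n. pact B p v = 0\<^sub>v n}" by blast
    qed
    show "finite {v \<in> carrier_vec n. pact B p v = (0\<^sub>v n :: 'a vec)}"
      by (rule finite_subset[OF _ finite_carrier_vec[of n]]) blast
  qed
qed

lemma kernel_card_similar:
  fixes A B :: "'a::{field,finite} mat"
  assumes A: "A \<in> carrier_mat n n" and s: "similar_mat A B"
  shows "kernel_card A p = kernel_card B p"
proof -
  have "B \<in> carrier_mat n n" using similar_matD[OF s] A by auto
  then show ?thesis
    using kernel_card_similar_le[OF A s] kernel_card_similar_le[OF _ similar_mat_sym[OF s]] by (metis le_antisym)
qed

lemma monic_dvd_antisym:
  fixes f g :: "'a::field poly"
  assumes f: "monic f" and g: "monic g" and "f dvd g" "g dvd f"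
  shows "f = g"
proof -
  obtain u where u: "g = f * u" using assms(3) by blast
  have nz: "f \<noteq> 0" "g \<noteq> 0" using f g by auto
  then have u0: "u \<noteq> 0" using u by auto
  have "degree g = degree f" using assms(3,4) nz by (intro antisym dvd_imp_degree_le)
  then have "degree u = 0" using nz u u0 by (simp add: degree_mult_eq)
  moreover have "lead_coeff u = 1" using f g u lead_coeff_mult[of f u] by simp
  ultimately have "u = 1" by (metis degree_eq_zeroE lead_coeff_pCons(2) one_pCons pCons_eq_0_iff)
  then show ?thesis using u by simp
qed

text \<open>The first entry of a chain generates the annihilator of the block matrix. Its contribution then cancels
  from all kernel sizes, which are multiplicative over blocks.\<close>

lemma companions_unique:
  fixes fs gs :: "'a::{field,finite} poly list"
  assumes "length fs = length gs"
    and "\<forall>f\<in>set fs. monic f" "\<forall>f\<in>set gs. monic f"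
    and "sorted_wrt (\<lambda>f g. g dvd f) fs" "sorted_wrt (\<lambda>f g. g dvd f) gs"
    and "\<And>p. kernel_card (companions fs) p = kernel_card (companions gs) p"
  shows "fs = gs"
  using assms
proof (induction fs gs rule: list_induct2)
  case (Cons f fs g gs)
  \<comment> \<open>The zero polynomial kills everything, so its kernel size recovers the total
    degree.\<close>
  have kill0: "kernel_card (companions hs) 0 = CARD('a) ^ total_degree hs" for hs :: "'a poly list"
    unfolding kernel_card_eq_iff_kills[OF companions_carrier] by (simp add: kills_def)
  have td: "total_degree (f # fs) = total_degree (g # gs)"
    using Cons.prems(5)[of 0] CARD_gt_1[where 'a='a] unfolding kill0 by (simp add: power_inject_exp)
  have kill: "kills (companions (f # fs)) p \<longleftrightarrow> kills (companions (g # gs)) p" for p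
    using Cons.prems(5)[of p] td
      kernel_card_eq_iff_kills[OF companions_carrier, of "f # fs" p]
      kernel_card_eq_iff_kills[OF companions_carrier, of "g # gs" p] by simp
  have "kills (companions (g # gs)) g" "kills (companions (f # fs)) f"
    unfolding kills_companions_iff[OF Cons.prems(1)] kills_companions_iff[OF Cons.prems(2)]
    using Cons.prems(3,4) by auto
  then have "kills (companions (f # fs)) g" "kills (companions (g # gs)) f" using kill by blast+
  then have "f dvd g" "g dvd f"
    unfolding kills_companions_iff[OF Cons.prems(1)] kills_companions_iff[OF Cons.prems(2)] by simp_all
  then have fg: "f = g" using monic_dvd_antisym[of f g] Cons.prems(1,2) by simp
  have "kernel_card (companions fs) p = kernel_card (companions gs) p" for p
    using Cons.prems(5)[of p] kernel_card_pos[OF companion_carrier, of g p]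
    unfolding companions_Cons fg
      kernel_card_four_block[OF companion_carrier companions_carrier] by simp
  then show ?case using Cons fg by simp
qed simp

text \<open>Invariant factors padded with ones to length \<open>r\<close>; nonzero constant terms express invertibility.\<close>

definition divisor_chains :: "nat \<Rightarrow> nat \<Rightarrow> 'a::field poly list set" where
  "divisor_chains r n = {fs. length fs = r \<and> (\<forall>f\<in>set fs. monic f \<and> coeff f 0 \<noteq> 0) \<and>
     total_degree fs = n \<and> sorted_wrt (\<lambda>f g. g dvd f) fs}"

lemma companions_append_ones: "companions (fs @ replicate m 1) = companions fs"
proof (induction fs)
  case Nil
  have "companions (replicate m (1::'a poly)) = 1\<^sub>m 0"
    using companions_carrier[of "replicate m (1::'a poly)"]
    by (intro eq_matI) (auto simp: sum_list_replicate)
  then show ?case by (simp add: companions_Nil)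
next
  case (Cons f fs)
  then show ?case by (simp add: companions_Cons sum_list_replicate)
qed

lemma ex_similar_companions:
  fixes A :: "'a::{field,finite} mat"
  assumes "A \<in> carrier_mat n n"
  shows "\<exists>fs. length fs = n \<and> (\<forall>f\<in>set fs. monic f) \<and> total_degree fs = n \<and>
    sorted_wrt (\<lambda>f g. g dvd f) fs \<and> similar_mat A (companions fs)"
  using assms
proof (induction n arbitrary: A rule: less_induct)
  case (less n)
  note A = less.prems
  show ?case
  proof (cases "n = 0")
    case True
    have "A = 1\<^sub>m 0" using A True by (intro eq_matI) auto
    then show ?thesis using True similar_mat_refl[of "1\<^sub>m 0" 0] by (intro exI[of _ "[]"]) (simp add: companions_Nil)
  next
    case False
    then have n0: "0 < n" by simp
    obtain f l Z where f: "monic f" "0 < degree f" and n: "n = degree f + l" and Z: "Z \<in> carrier_mat l l"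
      and kf: "kills Z f"
      and sim: "similar_mat A (four_block_mat (companion f) (0\<^sub>m (degree f) l) (0\<^sub>m l (degree f)) Z)"
      using cyclic_decomposition[OF A n0] by blast
    have "l < n" using n f by simp
    from less.IH[OF this Z] obtain fs where fs: "length fs = l" "\<forall>f\<in>set fs. monic f" "total_degree fs = l"
      "sorted_wrt (\<lambda>f g. g dvd f) fs" "similar_mat Z (companions fs)" by blast
    \<comment> \<open>The \<open>degree f - 1\<close> ones raise the length from
      \<open>l + 1\<close> to \<open>n = degree f + l\<close> and change neither the total degree
      nor the matrix.\<close>
    define gs where "gs = f # fs @ replicate (degree f - 1) 1"
    have dvd: "\<forall>g\<in>set fs. g dvd f"
      using kills_similar[OF Z fs(5)] kf kills_companions_iff[OF fs(2)] by blast
    have "length gs = n" using f fs(1) n by (simp add: gs_def)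
    moreover have "\<forall>g\<in>set gs. monic g" using f fs(2) by (auto simp: gs_def)
    moreover have "total_degree gs = n" using fs(3) n by (simp add: gs_def sum_list_replicate)
    moreover have "sorted_wrt (\<lambda>f g. g dvd f) (replicate (degree f - 1) (1 :: 'a poly))"
      by (simp add: sorted_wrt_iff_nth_less)
    then have "sorted_wrt (\<lambda>f g. g dvd f) gs"
      using dvd fs(4) by (auto simp: gs_def sorted_wrt_append)
    moreover have "companions gs = companions (f # fs)"
      using companions_append_ones[of "f # fs" "degree f - 1"] by (simp add: gs_def)
    moreover have "similar_mat (four_block_mat (companion f) (0\<^sub>m (degree f) l) (0\<^sub>m l (degree f)) Z) (companions (f # fs))"
      unfolding companions_Cons fs(3)
      by (rule similar_mat_four_block_0_0[OF similar_mat_refl[OF companion_carrier] fs(5) companion_carrier Z])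
    ultimately show ?thesis using similar_mat_trans[OF sim] by metis
  qed
qed

section \<open>Divisor chains as representatives of the classes of the general linear group\<close>

lemma det_companions_eq_0_iff:
  assumes "\<forall>f\<in>set fs. monic f"
  shows "det (companions fs) = 0 \<longleftrightarrow> (\<exists>f\<in>set fs. coeff f 0 = 0)"
  unfolding det_companions[OF assms] by (induction fs) auto

lemma ex_similar_chain:
  fixes A :: "'a::{field,finite} mat"
  assumes A: "A \<in> carrier (GL n)"
  shows "\<exists>fs\<in>divisor_chains n n. similar_mat A (companions fs)"
proof -
  have A': "A \<in> carrier_mat n n" "det A \<noteq> 0" using A by (auto simp: carrier_GL)
  obtain fs where fs: "length fs = n" "\<forall>f\<in>set fs. monic f" "total_degree fs = n"
    "sorted_wrt (\<lambda>f g. g dvd f) fs" "similar_mat A (companions fs)"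
    using ex_similar_companions[OF A'(1)] by blast
  have "\<forall>f\<in>set fs. coeff f 0 \<noteq> 0"
    using det_similar[OF fs(5)] A'(2) det_companions_eq_0_iff[OF fs(2)] by auto
  then have "fs \<in> divisor_chains n n" unfolding divisor_chains_def using fs by blast
  then show ?thesis using fs(5) by blast
qed

lemma companions_chain_GL:
  assumes "fs \<in> divisor_chains r n"
  shows "companions fs \<in> carrier (GL n)"
  using assms companions_carrier[of fs] det_companions_eq_0_iff[of fs] by (auto simp: carrier_GL divisor_chains_def)

lemma similar_chain_unique:
  fixes A :: "'a::{field,finite} mat"
  assumes A: "A \<in> carrier_mat n n" and "fs \<in> divisor_chains r n" "gs \<in> divisor_chains r n"
    and "similar_mat A (companions fs)" "similar_mat A (companions gs)"
  shows "fs = gs"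
proof (rule companions_unique)
  show "kernel_card (companions fs) p = kernel_card (companions gs) p" for p
    using kernel_card_similar[OF A assms(4), of p] kernel_card_similar[OF A assms(5), of p] by simp
qed (use assms in \<open>auto simp: divisor_chains_def\<close>)

lemma similar_mat_GL_iff:
  assumes A: "A \<in> carrier (GL n)" and B: "B \<in> carrier (GL n)"
  shows "similar_mat A (B :: 'a::field mat) \<longleftrightarrow> (\<exists>x\<in>carrier (GL n). x * B = A * x)"
proof
  assume s: "similar_mat A B"
  have "B \<in> carrier_mat n n" using B by (simp add: carrier_GL)
  from similar_mat_intertwiner[OF this similar_mat_sym[OF s]]
  show "\<exists>x\<in>carrier (GL n). x * B = A * x" by (auto simp: carrier_GL)
next
  assume "\<exists>x\<in>carrier (GL n). x * B = A * x"
  then obtain x where "x \<in> carrier_mat n n" "det x \<noteq> 0" "x * B = A * x" by (auto simp: carrier_GL)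
  then have "similar_mat B A" using A B by (intro similar_mat_intertwine[of x n B A]) (auto simp: carrier_GL)
  then show "similar_mat A B" by (rule similar_mat_sym)
qed

lemma finite_carrier_GL [simp]: "finite (carrier (GL n :: 'a::{field,finite} mat monoid))"
  unfolding carrier_GL by (rule finite_subset[OF _ finite_carrier_mat[of n n]]) blast

lemma finite_chains: "finite (divisor_chains n n :: 'a::{field,finite} poly list set)"
proof (rule inj_on_finite)
  show "inj_on companions (divisor_chains n n :: 'a poly list set)"
  proof (rule inj_onI)
    fix fs gs :: "'a poly list"
    assume *: "fs \<in> divisor_chains n n" "gs \<in> divisor_chains n n" "companions fs = companions gs"
    have c: "companions fs \<in> carrier_mat n n" using companions_chain_GL[OF *(1)] by (simp add: carrier_GL)
    show "fs = gs"
      by (rule similar_chain_unique[OF c *(1,2)]) (use similar_mat_refl[OF c] *(3) in auto)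
  qed
  show "companions ` divisor_chains n n \<subseteq> carrier (GL n)" using companions_chain_GL by blast
qed simp

text \<open>Each class contains the block matrix of exactly one chain, and the centralizer orders
  over a class add up to the group order. \<open>F\<close> will be a power of a character.\<close>

lemma sum_centralizers_GL:
  fixes F :: "'a::{field,finite} \<Rightarrow> complex"
  shows "(\<Sum>g\<in>carrier (GL n). of_nat (card {h \<in> carrier (GL n). g * h = h * g}) * F (det g))
    = of_nat (card (carrier (GL n :: 'a mat monoid))) * (\<Sum>fs\<in>divisor_chains n n. F (det (companions fs)))"
proof -
  interpret group "GL n :: 'a mat monoid" by (rule group_GL)
  define rc where "rc g = (THE fs. fs \<in> divisor_chains n n \<and> similar_mat g (companions fs))" for g :: "'a mat"
  define c where "c g = card {h \<in> carrier (GL n). g * h = h * g}" for g :: "'a mat"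
  have rc: "rc g \<in> divisor_chains n n \<and> similar_mat g (companions (rc g))" if g: "g \<in> carrier (GL n)" for g
    unfolding rc_def
  proof (rule theI')
    show "\<exists>!fs. fs \<in> divisor_chains n n \<and> similar_mat g (companions fs)"
      using ex_similar_chain[OF g] similar_chain_unique[of g n] g by (auto simp: carrier_GL)
  qed
  have rc_iff: "rc g = fs \<longleftrightarrow> similar_mat g (companions fs)" if g: "g \<in> carrier (GL n)" and fs: "fs \<in> divisor_chains n n" for g fs
    using rc[OF g] similar_chain_unique[of g n fs n "rc g"] g fs by (auto simp: carrier_GL)
  have "(\<Sum>g\<in>carrier (GL n). of_nat (c g) * F (det g))
      = (\<Sum>fs\<in>divisor_chains n n. \<Sum>g\<in>{g \<in> carrier (GL n). rc g = fs}. of_nat (c g) * F (det g))"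
    by (rule sum.group[symmetric]) (use rc finite_chains in auto)
  also have "\<dots> = (\<Sum>fs\<in>divisor_chains n n. of_nat (card (carrier (GL n :: 'a mat monoid))) * F (det (companions fs)))"
  proof (rule sum.cong[OF refl])
    fix fs :: "'a poly list" assume fs: "fs \<in> divisor_chains n n"
    have d: "companions fs \<in> carrier (GL n)" by (rule companions_chain_GL[OF fs])
    have "(\<Sum>g\<in>{g \<in> carrier (GL n). rc g = fs}. of_nat (c g) * F (det g))
      = (\<Sum>g\<in>{g \<in> carrier (GL n). rc g = fs}. of_nat (c g) * F (det (companions fs)))"
    proof (rule sum.cong[OF refl])
      fix g assume "g \<in> {g \<in> carrier (GL n). rc g = fs}"
      then have "similar_mat g (companions fs)" using rc_iff[OF _ fs] by blast
      then show "of_nat (c g) * F (det g) = of_nat (c g) * F (det (companions fs))"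
        using det_similar by metis
    qed
    also have "\<dots> = of_nat (\<Sum>g\<in>{g \<in> carrier (GL n). rc g = fs}. c g) * F (det (companions fs))"
      by (simp add: sum_distrib_right)
    also have "(\<Sum>g\<in>{g \<in> carrier (GL n). rc g = fs}. c g) = card (carrier (GL n :: 'a mat monoid))"
    proof -
      have "{g \<in> carrier (GL n). rc g = fs} = {g \<in> carrier (GL n). \<exists>x\<in>carrier (GL n). x * companions fs = g * x}"
        using rc_iff[OF _ fs] similar_mat_GL_iff[OF _ d] by blast
      then show ?thesis
        using sum_card_centralizers_conj_class[OF finite_carrier_GL d] by (simp add: c_def)
    qed
    finally show "(\<Sum>g\<in>{g \<in> carrier (GL n). rc g = fs}. of_nat (c g) * F (det g))
      = of_nat (card (carrier (GL n :: 'a mat monoid))) * F (det (companions fs))" .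
  qed
  finally show ?thesis by (simp add: c_def sum_distrib_left)
qed

section \<open>Bounds on the number of chains\<close>

text \<open>The coefficient of \<open>t^n\<close> in the product of
  \<open>(1 - t^k) / (1 - q t^k)\<close> over \<open>k = 1, ..., r\<close>. It counts divisor chains
  of length \<open>r\<close> and total degree \<open>n\<close>: a last entry of degree
  \<open>d\<close> divides all \<open>r + 1\<close> entries, so it uses up degree
  \<open>(r + 1) d\<close>, and for \<open>d \<ge> 1\<close> there are
  \<open>(q - 1) q^(d-1)\<close> candidates for it. For \<open>r = n\<close> this is
  \<open>k(GL(n, q))\<close>.\<close>

fun chain_count :: "real \<Rightarrow> nat \<Rightarrow> nat \<Rightarrow> real" where
  "chain_count q 0 n = (if n = 0 then 1 else 0)"
| "chain_count q (Suc r) n = chain_count q r n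
     + (\<Sum>d=1..n div Suc r. (q - 1) * q ^ (d - 1) * chain_count q r (n - Suc r * d))"

lemma sum_geometric_le:
  fixes x :: real
  assumes "0 \<le> x" "x < 1"
  shows "(\<Sum>d=1..N. x ^ d) \<le> x / (1 - x)"
proof -
  have "(1 - x) * (\<Sum>d=1..N. x ^ d) = x - x ^ Suc N"
  proof (induction N)
    case (Suc N)
    have "(1 - x) * (\<Sum>d=1..Suc N. x ^ d) = (1 - x) * (\<Sum>d=1..N. x ^ d) + (1 - x) * x ^ Suc N"
      by (simp add: distrib_left)
    also have "\<dots> = x - x ^ Suc N + (1 - x) * x ^ Suc N" unfolding Suc.IH ..
    also have "\<dots> = x - x ^ Suc (Suc N)" by (simp add: algebra_simps)
    finally show ?case .
  qed simp
  also have "\<dots> \<le> x" using assms by simp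
  finally show ?thesis using assms by (simp add: pos_le_divide_eq mult.commute)
qed

text \<open>The factors depending on \<open>r\<close> and the correction at \<open>n = 0\<close> are what makes the induction on \<open>r\<close> go through.\<close>

lemma chain_count_le:
  assumes q: "2 \<le> q"
  shows "chain_count q (Suc r) n \<le> (1 - 1 / q ^ Suc r) * (1 + (1 - 1 / q ^ r) / (q\<^sup>2 - 1)) * q ^ n
    + (if n = 0 then 1 / q else 0)"
proof (induction r arbitrary: n)
  case 0
  have "(\<Sum>d=1..n. (q - 1) * q ^ (d - 1) * (if n - d = 0 then 1 else 0))
      = (\<Sum>d=1..n. if d = n then (q - 1) * q ^ (n - 1) else 0)"
    by (intro sum.cong) auto
  also have "\<dots> = (if n = 0 then 0 else (q - 1) * q ^ (n - 1))" by (cases n) simp_all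
  finally have "chain_count q 1 n = (if n = 0 then 1 else (q - 1) * q ^ (n - 1))" by simp
  \<comment> \<open>In fact equality: \<open>1 / q\<close> is exactly what \<open>1 - 1 / q\<close>
    lacks from the value 1 at \<open>n = 0\<close>.\<close>
  also have "\<dots> \<le> (1 - 1 / q) * q ^ n + (if n = 0 then 1 / q else 0)"
    using q by (cases n) (simp_all add: field_simps)
  finally show ?case by simp
next
  case (Suc r)
  define s where "s = Suc r"
  define C where "C = (1 - 1 / q ^ s) * (1 + (1 - 1 / q ^ r) / (q\<^sup>2 - 1))"
  have q0: "0 < q" "1 < q" using q by simp_all
  have q2: "0 < q\<^sup>2 - 1" using q0 by (simp add: one_less_power)
  have IH: "chain_count q s m \<le> C * q ^ m + (if m = 0 then 1 / q else 0)" for m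
    using Suc unfolding s_def C_def .
  have C0: "0 \<le> C" unfolding C_def using q0 q2 by (intro mult_nonneg_nonneg add_nonneg_nonneg divide_nonneg_pos) simp_all
  define x where "x = 1 / q ^ s"
  have "q ^ 1 \<le> q ^ s" using q0 by (intro power_increasing) (simp_all add: s_def)
  then have x: "0 < x" "x \<le> 1 / q" using q0 by (simp_all add: x_def frac_le)
  moreover have "1 / q < 1" using q0 by simp
  ultimately have x1: "x < 1" by linarith
  note x = x x1
  have "chain_count q (Suc s) n = chain_count q s n
      + (\<Sum>d=1..n div Suc s. (q - 1) * q ^ (d - 1) * chain_count q s (n - Suc s * d))" by simp
  also have "\<dots> \<le> C * q ^ n + (if n = 0 then 1 / q else 0)
      + (\<Sum>d=1..n div Suc s. (q - 1) * q ^ (d - 1) * (C * q ^ (n - Suc s * d) + (if n - Suc s * d = 0 then 1 / q else 0)))"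
    using q0 by (intro add_mono IH sum_mono mult_left_mono) auto
  also have "(\<Sum>d=1..n div Suc s. (q - 1) * q ^ (d - 1) * (C * q ^ (n - Suc s * d) + (if n - Suc s * d = 0 then 1 / q else 0)))
     = (\<Sum>d=1..n div Suc s. (q - 1) * q ^ (d - 1) * (C * q ^ (n - Suc s * d)))
     + (\<Sum>d=1..n div Suc s. (q - 1) * q ^ (d - 1) * (if n - Suc s * d = 0 then 1 / q else 0))"
    by (simp add: distrib_left sum.distrib)
  also have "(\<Sum>d=1..n div Suc s. (q - 1) * q ^ (d - 1) * (C * q ^ (n - Suc s * d)))
     = (\<Sum>d=1..n div Suc s. C * (1 - 1 / q) * q ^ n * x ^ d)"
  proof (rule sum.cong[OF refl])
    fix d assume d: "d \<in> {1..n div Suc s}"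
    then have "Suc s * d \<le> n" by (simp add: less_eq_div_iff_mult_less_eq mult.commute del: mult_Suc)
    then have n: "q ^ n = q ^ (n - Suc s * d) * (q ^ d * q ^ (s * d))"
      by (simp add: power_add[symmetric])
    have qd: "q ^ d = q * q ^ (d - 1)" using d by (cases d) simp_all
    have xd: "x ^ d = 1 / q ^ (s * d)" by (simp add: x_def power_mult power_one_over)
    show "(q - 1) * q ^ (d - 1) * (C * q ^ (n - Suc s * d)) = C * (1 - 1 / q) * q ^ n * x ^ d"
      unfolding n xd using q0 by (simp add: qd field_simps)
  qed
  also have "\<dots> = C * (1 - 1 / q) * q ^ n * (\<Sum>d=1..n div Suc s. x ^ d)" by (simp add: sum_distrib_left)
  also have "\<dots> \<le> C * (1 - 1 / q) * q ^ n * (x / (1 - x))"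
    using x q0 C0 by (intro mult_left_mono sum_geometric_le) auto
  \<comment> \<open>The correction at 0 is met by at most one \<open>d\<close>, the one with
    \<open>(s + 1) d = n\<close>, and then \<open>d + s \<le> n\<close>.\<close>
  also have "(\<Sum>d=1..n div Suc s. (q - 1) * q ^ (d - 1) * (if n - Suc s * d = 0 then 1 / q else 0))
     \<le> (q - 1) / q\<^sup>2 * (x * q ^ n)"
  proof (cases "Suc s dvd n \<and> 0 < n")
    case True
    then obtain e where e: "n = Suc s * e" "0 < e" by (auto simp: dvd_def)
    have "(\<Sum>d=1..n div Suc s. (q - 1) * q ^ (d - 1) * (if n - Suc s * d = 0 then 1 / q else 0))
      = (\<Sum>d=1..e. if d = e then (q - 1) * q ^ (e - 1) * (1 / q) else 0)"
    proof (rule sum.cong)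
      show "{1..n div Suc s} = {1..e}" unfolding e by (simp del: mult_Suc)
      fix d assume "d \<in> {1..e}"
      then have "n - Suc s * d = 0 \<longleftrightarrow> d = e" unfolding e by (auto simp del: mult_Suc)
      then show "(q - 1) * q ^ (d - 1) * (if n - Suc s * d = 0 then 1 / q else 0)
        = (if d = e then (q - 1) * q ^ (e - 1) * (1 / q) else 0)" by simp
    qed
    also have "\<dots> = (q - 1) * q ^ (e - 1) * (1 / q)" using e by simp
    also have "\<dots> = (q - 1) / q\<^sup>2 * q ^ e" using e q0 by (cases e) (simp_all add: field_simps power2_eq_square)
    also have "(q - 1) / q\<^sup>2 * q ^ e \<le> (q - 1) / q\<^sup>2 * (x * q ^ n)"
    proof -
      have "s \<le> s * e" using e by simp
      then have "q ^ e * q ^ s \<le> q ^ e * q ^ (s * e)" using q0 by (intro mult_left_mono power_increasing) auto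
      then have "q ^ e * q ^ s \<le> q ^ n" unfolding e by (simp add: power_add)
      then have "q ^ e \<le> x * q ^ n" using q0 by (simp add: x_def field_simps)
      then show ?thesis using q0 by (intro mult_left_mono) auto
    qed
    finally show ?thesis .
  next
    case False
    have "(\<Sum>d=1..n div Suc s. (q - 1) * q ^ (d - 1) * (if n - Suc s * d = 0 then 1 / q else 0)) = 0"
    proof (rule sum.neutral, rule ballI)
      fix d assume d: "d \<in> {1..n div Suc s}"
      then have le: "Suc s * d \<le> n" by (simp add: less_eq_div_iff_mult_less_eq mult.commute del: mult_Suc)
      have "n - Suc s * d \<noteq> 0"
      proof
        assume "n - Suc s * d = 0"
        then have n: "n = Suc s * d" using le by simp
        have "Suc s dvd n" unfolding n by (rule dvd_triv_left)
        moreover have "0 < n" using n d by simp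
        ultimately show False using False by blast
      qed
      then show "(q - 1) * q ^ (d - 1) * (if n - Suc s * d = 0 then 1 / q else 0) = 0" by simp
    qed
    then show ?thesis using q0 x by simp
  qed
  finally have m0: "chain_count q (Suc s) n \<le> C * q ^ n + (if n = 0 then 1 / q else 0)
      + (C * (1 - 1 / q) * q ^ n * (x / (1 - x)) + (q - 1) / q\<^sup>2 * (x * q ^ n))" by simp
  have "q ^ n * (C + C * (1 - 1 / q) * (x / (1 - x)) + (q - 1) / q\<^sup>2 * x)
      = C * q ^ n + (C * (1 - 1 / q) * q ^ n * (x / (1 - x)) + (q - 1) / q\<^sup>2 * (x * q ^ n))"
    by (simp only: distrib_left mult.assoc mult.commute mult.left_commute add.assoc)
  with m0 have main: "chain_count q (Suc s) n \<le> q ^ n * (C + C * (1 - 1 / q) * (x / (1 - x)) + (q - 1) / q\<^sup>2 * x)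
      + (if n = 0 then 1 / q else 0)"
    by linarith
  \<comment> \<open>The origin of \<open>q\<^sup>2 - 1\<close>. The geometric series turns the
    factor \<open>1 - x\<close> of \<open>C\<close> exactly into \<open>1 - x / q\<close>. The
    remaining \<open>(q - 1) x / q\<^sup>2\<close> is paid for by raising \<open>1 - q x\<close> to
    \<open>1 - x\<close> in the other factor, a gain of
    \<open>(q - 1) x (1 - x / q) / (q\<^sup>2 - 1)\<close>; this is enough because
    \<open>x \<le> 1 / q\<close> gives
    \<open>1 - x / q \<ge> (q\<^sup>2 - 1) / q\<^sup>2\<close>.\<close>
  have "C + C * (1 - 1 / q) * (x / (1 - x)) + (q - 1) / q\<^sup>2 * x \<le> (1 - x / q) * (1 + (1 - x) / (q\<^sup>2 - 1))"
  proof -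
    have r: "1 / q ^ r = q * x" using q0 by (simp add: x_def s_def field_simps)
    have Cx: "C = (1 - x) * (1 + (1 - q * x) / (q\<^sup>2 - 1))" unfolding C_def r x_def ..
    have "C + C * (1 - 1 / q) * (x / (1 - x)) = C / (1 - x) * (1 - x / q)"
      using x by (simp add: field_simps)
    also have "\<dots> = (1 - x / q) * (1 + (1 - q * x) / (q\<^sup>2 - 1))" unfolding Cx using x by simp
    finally have 1: "C + C * (1 - 1 / q) * (x / (1 - x)) = (1 - x / q) * (1 + (1 - q * x) / (q\<^sup>2 - 1))" .
    have "x / q \<le> (1 / q) / q" using x(2) q0 by (intro divide_right_mono) auto
    then have "1 / q\<^sup>2 * (q\<^sup>2 - 1) \<le> 1 - x / q" using q0 by (simp add: field_simps power2_eq_square)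
    then have "1 / q\<^sup>2 \<le> (1 - x / q) / (q\<^sup>2 - 1)" using q2 by (simp add: pos_le_divide_eq)
    then have "(q - 1) * x * (1 / q\<^sup>2) \<le> (q - 1) * x * ((1 - x / q) / (q\<^sup>2 - 1))"
      using q0 x by (intro mult_left_mono) auto
    also have "\<dots> = (1 - x / q) * ((1 - x) / (q\<^sup>2 - 1) - (1 - q * x) / (q\<^sup>2 - 1))"
      by (simp add: diff_divide_distrib[symmetric] algebra_simps)
    finally show ?thesis unfolding 1 by (simp add: algebra_simps)
  qed
  then have "q ^ n * (C + C * (1 - 1 / q) * (x / (1 - x)) + (q - 1) / q\<^sup>2 * x)
     \<le> q ^ n * ((1 - x / q) * (1 + (1 - x) / (q\<^sup>2 - 1)))"
    using q0 by (intro mult_left_mono) auto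
  with main have "chain_count q (Suc s) n \<le> q ^ n * ((1 - x / q) * (1 + (1 - x) / (q\<^sup>2 - 1))) + (if n = 0 then 1 / q else 0)"
    by linarith
  moreover have "x / q = 1 / q ^ Suc s" by (simp add: x_def field_simps)
  ultimately show ?case unfolding x_def s_def by (simp add: mult.commute mult.left_commute)
qed

lemma chain_count_le_power:
  assumes q: "2 \<le> q"
  shows "chain_count q n n \<le> q\<^sup>2 / (q\<^sup>2 - 1) * q ^ n"
proof (cases n)
  case 0
  have "1 < q\<^sup>2" using q by (simp add: one_less_power)
  then show ?thesis using 0 by (simp add: field_simps)
next
  case (Suc r)
  have q0: "1 < q" and q2: "0 < q\<^sup>2 - 1" using q by (simp_all add: one_less_power)
  have "(1 - 1 / q ^ Suc r) * (1 + (1 - 1 / q ^ r) / (q\<^sup>2 - 1)) \<le> 1 * (1 + 1 / (q\<^sup>2 - 1))"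
    using q0 q2 by (intro mult_mono add_mono divide_right_mono add_nonneg_nonneg divide_nonneg_pos) auto
  also have "\<dots> = q\<^sup>2 / (q\<^sup>2 - 1)" using q2 by (simp add: field_simps)
  finally have "(1 - 1 / q ^ Suc r) * (1 + (1 - 1 / q ^ r) / (q\<^sup>2 - 1)) * q ^ n \<le> q\<^sup>2 / (q\<^sup>2 - 1) * q ^ n"
    using q0 by (intro mult_right_mono) auto
  then show ?thesis using chain_count_le[OF q, of r n] Suc by simp
qed

lemma chain_count_1: "chain_count q 1 n = (if n = 0 then 1 else (q - 1) * q ^ (n - 1))"
proof -
  have "(\<Sum>d=1..n. (q - 1) * q ^ (d - 1) * (if n - d = 0 then 1 else 0))
      = (\<Sum>d=1..n. if d = n then (q - 1) * q ^ (n - 1) else 0)"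
    by (intro sum.cong) auto
  also have "\<dots> = (if n = 0 then 0 else (q - 1) * q ^ (n - 1))" by (cases n) simp_all
  finally show ?thesis by simp
qed

text \<open>Class numbers of \<open>GL(1, q)\<close>, \<open>GL(2, q)\<close>,
  \<open>GL(3, 3)\<close> and \<open>GL(4, 3)\<close>, for the starting points of the inductions,
  where the general bound is too weak.\<close>

lemma chain_count_small:
  "chain_count q 1 1 = q - 1"
  "chain_count q 2 2 = q\<^sup>2 - 1"
  "chain_count 3 3 3 = 24"
  "chain_count 3 4 4 = 78"
proof -
  show "chain_count q 1 1 = q - 1" unfolding chain_count_1 by simp
  have c2: "chain_count q 2 n = chain_count q 1 n
      + (\<Sum>d=1..n div 2. (q - 1) * q ^ (d - 1) * chain_count q 1 (n - 2 * d))" for q n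
    using chain_count.simps(2)[of q 1 n] by (simp only: Suc_1)
  have c3: "chain_count q 3 n = chain_count q 2 n
      + (\<Sum>d=1..n div 3. (q - 1) * q ^ (d - 1) * chain_count q 2 (n - 3 * d))" for q n
    using chain_count.simps(2)[of q 2 n] by (simp only: numeral_3_eq_3[symmetric] Suc_numeral semiring_norm)
  have c4: "chain_count q 4 n = chain_count q 3 n
      + (\<Sum>d=1..n div 4. (q - 1) * q ^ (d - 1) * chain_count q 3 (n - 4 * d))" for q n
    using chain_count.simps(2)[of q 3 n] by (simp only: Suc_numeral semiring_norm)
  have s2: "(\<Sum>d=1..2. f d) = f 1 + f 2" for f :: "nat \<Rightarrow> real" by (simp add: numeral_2_eq_2)
  show "chain_count q 2 2 = q\<^sup>2 - 1"
    unfolding c2 chain_count_1 by (simp add: power2_eq_square algebra_simps)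
  have v: "chain_count 3 2 0 = 1" "chain_count 3 2 1 = 2" "chain_count 3 2 3 = 22" "chain_count 3 2 4 = 72"
    unfolding c2 chain_count_1 by (simp_all add: s2 del: One_nat_def)
  have w: "chain_count 3 3 0 = 1" "chain_count 3 3 4 = 76" unfolding c3 using v by simp_all
  show "chain_count 3 3 3 = 24" unfolding c3 using v by simp
  show "chain_count 3 4 4 = 78" unfolding c4 using w by simp
qed

section \<open>Commuting pairs in affine groups\<close>

definition det_mats :: "nat \<Rightarrow> 'a::field set \<Rightarrow> 'a mat set" where
  "det_mats n D = {A \<in> carrier_mat n n. det A \<in> D}"

definition unit_group :: "'a::field set \<Rightarrow> bool" where
  "unit_group D \<longleftrightarrow> 1 \<in> D \<and> 0 \<notin> D \<and> (\<forall>x\<in>D. \<forall>y\<in>D. x * y \<in> D) \<and> (\<forall>x\<in>D. inverse x \<in> D)"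

definition commuting_pairs :: "'a::semiring_0 mat set \<Rightarrow> ('a mat \<times> 'a mat) set" where
  "commuting_pairs S = {(g, h). g \<in> S \<and> h \<in> S \<and> g * h = h * g}"

definition affine_commuting_pairs :: "nat \<Rightarrow> 'a::field mat set \<Rightarrow> (('a vec \<times> 'a mat) \<times> ('a vec \<times> 'a mat)) set" where
  "affine_commuting_pairs n S = {((a, g), (b, h)). a \<in> carrier_vec n \<and> b \<in> carrier_vec n \<and>
     g \<in> S \<and> h \<in> S \<and> a + g *\<^sub>v b = b + h *\<^sub>v a \<and> g * h = h * g}"

lemma finite_det_mats [simp]: "finite (det_mats n D :: 'a::{field,finite} mat set)"
  unfolding det_mats_def by (rule finite_subset[OF _ finite_carrier_mat[of n n]]) blast

lemma finite_commuting_pairs [simp]: "finite S \<Longrightarrow> finite (commuting_pairs S)"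
  unfolding commuting_pairs_def by (rule finite_subset[of _ "S \<times> S"]) auto

text \<open>The level sets of the functional given by \<open>w\<close> are translates of one
  another, so the \<open>q\<close> of them share the space equally.\<close>

lemma card_hyperplane:
  fixes w :: "'a::{field,finite} vec"
  assumes w: "w \<in> carrier_vec n" "w \<noteq> 0\<^sub>v n"
  shows "CARD('a) * card {l \<in> carrier_vec n. l \<bullet> w = 0} = CARD('a) ^ n"
proof -
  define f where "f c = {l \<in> carrier_vec n. l \<bullet> w = c}" for c
  obtain i where i: "i < n" "w $ i \<noteq> 0" using w by (metis carrier_vecD eq_vecI index_zero_vec)
  have "card (f c) = card (f 0)" for c
  proof -
    define u where "u = (c / w $ i) \<cdot>\<^sub>v unit_vec n i"
    have u: "u \<in> carrier_vec n" by (simp add: u_def)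
    have uw: "u \<bullet> w = c" using i w by (simp add: u_def)
    have "bij_betw (\<lambda>l. l + u) (f 0) (f c)"
    proof (rule bij_betw_byWitness[where f' = "\<lambda>l. l - u"])
      show "\<forall>l\<in>f 0. l + u - u = l" using u by (auto simp: f_def)
      show "\<forall>l\<in>f c. l - u + u = l" using u by (auto simp: f_def)
      show "(\<lambda>l. l + u) ` f 0 \<subseteq> f c" using u w uw by (auto simp: f_def add_scalar_prod_distrib)
      show "(\<lambda>l. l - u) ` f c \<subseteq> f 0" using u w uw by (auto simp: f_def minus_scalar_prod_distrib)
    qed
    then show ?thesis by (rule bij_betw_same_card[symmetric])
  qed
  then have "(\<Sum>c\<in>UNIV. card (f c)) = (\<Sum>c\<in>(UNIV :: 'a set). card (f 0))" by (intro sum.cong refl) blast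
  then have "(\<Sum>c\<in>UNIV. card (f c)) = CARD('a) * card (f 0)" by simp
  moreover have "(\<Sum>c\<in>UNIV. card (f c)) = card (carrier_vec n :: 'a vec set)"
  proof -
    have "(\<Sum>c\<in>UNIV. \<Sum>l\<in>{l \<in> carrier_vec n. l \<bullet> w = c}. 1) = (\<Sum>l\<in>(carrier_vec n :: 'a vec set). 1::nat)"
      by (rule sum.group) auto
    then show ?thesis by (simp add: f_def)
  qed
  ultimately show ?thesis by (simp add: f_def card_carrier_vec)
qed

lemma card_pairs_hyperplane:
  fixes u w :: "'a::{field,finite} vec"
  assumes u: "u \<in> carrier_vec n" and w: "w \<in> carrier_vec n" and nz: "\<not> (u = 0\<^sub>v n \<and> w = 0\<^sub>v n)"
  shows "CARD('a) * card {(a, b). a \<in> carrier_vec n \<and> b \<in> carrier_vec n \<and> u \<bullet> a + w \<bullet> b = 0} = CARD('a) ^ (n + n)"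
proof -
  have sp: "(a @\<^sub>v b) \<bullet> (u @\<^sub>v w) = u \<bullet> a + w \<bullet> b" if "a \<in> carrier_vec n" "b \<in> carrier_vec n" for a b
    using scalar_prod_append[OF that u w] comm_scalar_prod[OF that(1) u] comm_scalar_prod[OF that(2) w] by simp
  have "bij_betw (\<lambda>(a, b). a @\<^sub>v b) {(a, b). a \<in> carrier_vec n \<and> b \<in> carrier_vec n \<and> u \<bullet> a + w \<bullet> b = 0}
      {l \<in> carrier_vec (n + n). l \<bullet> (u @\<^sub>v w) = 0}"
  proof (rule bij_betw_imageI)
    show "inj_on (\<lambda>(a, b). a @\<^sub>v b) {(a, b). a \<in> carrier_vec n \<and> b \<in> carrier_vec n \<and> u \<bullet> a + w \<bullet> b = 0}"
    proof (rule inj_onI, clarify)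
      fix a b a' b' :: "'a vec"
      assume "a \<in> carrier_vec n" "a' \<in> carrier_vec n" "a @\<^sub>v b = a' @\<^sub>v b'"
      then show "a = a' \<and> b = b'" using append_vec_eq[of a n a' b b'] by blast
    qed
    show "(\<lambda>(a, b). a @\<^sub>v b) ` {(a, b). a \<in> carrier_vec n \<and> b \<in> carrier_vec n \<and> u \<bullet> a + w \<bullet> b = 0}
      = {l \<in> carrier_vec (n + n). l \<bullet> (u @\<^sub>v w) = 0}"
    proof (intro equalityI subsetI)
      fix l assume "l \<in> (\<lambda>(a, b). a @\<^sub>v b) ` {(a, b). a \<in> carrier_vec n \<and> b \<in> carrier_vec n \<and> u \<bullet> a + w \<bullet> b = 0}"
      then show "l \<in> {l \<in> carrier_vec (n + n). l \<bullet> (u @\<^sub>v w) = 0}" using sp by auto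
    next
      fix l assume l: "l \<in> {l \<in> carrier_vec (n + n). l \<bullet> (u @\<^sub>v w) = 0}"
      then obtain a b where ab: "a \<in> carrier_vec n" "b \<in> carrier_vec n" "l = a @\<^sub>v b"
        using vec_append_split[of l n n] by blast
      then have "(a, b) \<in> {(a, b). a \<in> carrier_vec n \<and> b \<in> carrier_vec n \<and> u \<bullet> a + w \<bullet> b = 0}"
        using l sp by simp
      then show "l \<in> (\<lambda>(a, b). a @\<^sub>v b) ` {(a, b). a \<in> carrier_vec n \<and> b \<in> carrier_vec n \<and> u \<bullet> a + w \<bullet> b = 0}"
        using ab(3) by force
    qed
  qed
  from bij_betw_same_card[OF this] show ?thesis
    using card_hyperplane[of "u @\<^sub>v w" "n + n"] append_vec_eq_0[OF u w] u w nz by simp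
qed

lemma scalar_prod_transpose:
  fixes A :: "'a::comm_semiring_0 mat"
  assumes A: "A \<in> carrier_mat n m" and l: "l \<in> carrier_vec n" and v: "v \<in> carrier_vec m"
  shows "(transpose_mat A *\<^sub>v l) \<bullet> v = l \<bullet> (A *\<^sub>v v)"
proof -
  have "(transpose_mat A *\<^sub>v l) \<bullet> v = (\<Sum>j<m. (\<Sum>i<n. A $$ (i, j) * l $ i) * v $ j)"
    using A l v by (simp add: scalar_prod_def lessThan_atLeast0)
  also have "\<dots> = (\<Sum>j<m. \<Sum>i<n. l $ i * (A $$ (i, j) * v $ j))"
    unfolding sum_distrib_right by (intro sum.cong refl) (simp add: mult.left_commute mult.commute)
  also have "\<dots> = (\<Sum>i<n. \<Sum>j<m. l $ i * (A $$ (i, j) * v $ j))" by (rule sum.swap)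
  also have "\<dots> = l \<bullet> (A *\<^sub>v v)"
    using A l v by (simp add: scalar_prod_def lessThan_atLeast0 sum_distrib_left)
  finally show ?thesis .
qed

lemma sum_if_mem:
  fixes a b :: nat
  assumes "finite A" "K \<subseteq> A"
  shows "(\<Sum>x\<in>A. if x \<in> K then a else b) = card K * a + (card A - card K) * b"
proof -
  have "(\<Sum>x\<in>A. if x \<in> K then a else b)
      = (\<Sum>x\<in>A - K. if x \<in> K then a else b) + (\<Sum>x\<in>K. if x \<in> K then a else b)"
    by (rule sum.subset_diff[OF assms(2,1)])
  also have "\<dots> = (\<Sum>x\<in>A - K. b) + (\<Sum>x\<in>K. a)" by (intro arg_cong2[where f = "(+)"] sum.cong) auto
  finally show ?thesis using assms by (simp add: card_Diff_subset finite_subset)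
qed

text \<open>Both sides come from counting the triples \<open>(l, a, b)\<close> with \<open>l \<bullet> ((a + g b) - (b + h a)) = 0\<close>.\<close>

lemma card_affine_solutions:
  fixes g h :: "'a::{field,finite} mat"
  assumes g: "g \<in> carrier_mat n n" and h: "h \<in> carrier_mat n n"
  shows "card {(a, b). a \<in> carrier_vec n \<and> b \<in> carrier_vec n \<and> a + g *\<^sub>v b = b + h *\<^sub>v a}
    = CARD('a) ^ n * card {l \<in> carrier_vec n. transpose_mat g *\<^sub>v l = l \<and> transpose_mat h *\<^sub>v l = l}"
proof -
  define q where "q = CARD('a)"
  define V where "V = (carrier_vec n :: 'a vec set)"
  have cV: "card V = q ^ n" and fV: "finite V" by (simp_all add: V_def q_def card_carrier_vec)
  define K where "K = {(a, b). a \<in> V \<and> b \<in> V \<and> a + g *\<^sub>v b = b + h *\<^sub>v a}"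
  define L where "L = {l \<in> V. transpose_mat g *\<^sub>v l = l \<and> transpose_mat h *\<^sub>v l = l}"
  define T where "T a b = (a + g *\<^sub>v b) - (b + h *\<^sub>v a)" for a b
  have Tc: "T a b \<in> V" if "a \<in> V" "b \<in> V" for a b
    using that g h by (auto simp: T_def V_def)
  have T0: "T a b = 0\<^sub>v n \<longleftrightarrow> (a, b) \<in> K" if ab: "a \<in> V" "b \<in> V" for a b
  proof -
    have c: "a + g *\<^sub>v b \<in> carrier_vec n" "b + h *\<^sub>v a \<in> carrier_vec n" using ab g h by (auto simp: V_def)
    have "T a b = 0\<^sub>v n \<longleftrightarrow> a + g *\<^sub>v b = b + h *\<^sub>v a"
    proof
      assume z: "T a b = 0\<^sub>v n"
      show "a + g *\<^sub>v b = b + h *\<^sub>v a"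
      proof (rule eq_vecI)
        fix i assume "i < dim_vec (b + h *\<^sub>v a)"
        then have i: "i < n" using carrier_matD[OF h] by simp
        have "T a b $ i = 0" using z i by simp
        then show "(a + g *\<^sub>v b) $ i = (b + h *\<^sub>v a) $ i"
          unfolding T_def using i c by (simp add: index_minus_vec(1)[of i "b + h *\<^sub>v a" "a + g *\<^sub>v b"] del: index_add_vec)
      qed (use carrier_matD[OF g] carrier_matD[OF h] in simp)
    qed (use c in \<open>simp add: T_def\<close>)
    then show ?thesis using ab by (simp add: K_def)
  qed
  have lT: "l \<bullet> T a b = (l - transpose_mat h *\<^sub>v l) \<bullet> a + (transpose_mat g *\<^sub>v l - l) \<bullet> b"
    if l: "l \<in> V" and a: "a \<in> V" and b: "b \<in> V" for l a b
  proof -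
    note c = l[unfolded V_def] a[unfolded V_def] b[unfolded V_def]
    have d: "g *\<^sub>v b \<in> carrier_vec n" "h *\<^sub>v a \<in> carrier_vec n"
      "transpose_mat g *\<^sub>v l \<in> carrier_vec n" "transpose_mat h *\<^sub>v l \<in> carrier_vec n"
      using c g h by auto
    have "l \<bullet> T a b = l \<bullet> a + l \<bullet> (g *\<^sub>v b) - (l \<bullet> b + l \<bullet> (h *\<^sub>v a))"
      unfolding T_def using c d by (simp add: scalar_prod_minus_distrib[of _ n] scalar_prod_add_distrib[of _ n])
    moreover have "(l - transpose_mat h *\<^sub>v l) \<bullet> a = l \<bullet> a - l \<bullet> (h *\<^sub>v a)"
      using minus_scalar_prod_distrib[OF c(1) d(4) c(2)] scalar_prod_transpose[OF h c(1,2)] by simp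
    moreover have "(transpose_mat g *\<^sub>v l - l) \<bullet> b = l \<bullet> (g *\<^sub>v b) - l \<bullet> b"
      using minus_scalar_prod_distrib[OF d(3) c(1) c(3)] scalar_prod_transpose[OF g c(1,3)] by simp
    ultimately show ?thesis by simp
  qed
  define S where "S = {(l, ab). l \<in> V \<and> ab \<in> V \<times> V \<and> l \<bullet> T (fst ab) (snd ab) = 0}"
  have S1: "card S = (\<Sum>ab\<in>V \<times> V. card {l \<in> V. l \<bullet> T (fst ab) (snd ab) = 0})"
  proof -
    have "bij_betw (\<lambda>(ab, l). (l, ab)) (SIGMA ab:V \<times> V. {l \<in> V. l \<bullet> T (fst ab) (snd ab) = 0}) S"
      by (rule bij_betw_byWitness[where f' = "\<lambda>(l, ab). (ab, l)"]) (auto simp: S_def)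
    from bij_betw_same_card[OF this, symmetric] show ?thesis using fV by (simp add: card_SigmaI)
  qed
  have S2: "card S = (\<Sum>l\<in>V. card {ab \<in> V \<times> V. l \<bullet> T (fst ab) (snd ab) = 0})"
  proof -
    have "S = (SIGMA l:V. {ab \<in> V \<times> V. l \<bullet> T (fst ab) (snd ab) = 0})" by (auto simp: S_def)
    then show ?thesis using fV by (simp add: card_SigmaI)
  qed
  have KV: "K \<subseteq> V \<times> V" and LV: "L \<subseteq> V" by (auto simp: K_def L_def)
  have "q * card S = (\<Sum>ab\<in>V \<times> V. q * card {l \<in> V. l \<bullet> T (fst ab) (snd ab) = 0})"
    unfolding S1 by (rule sum_distrib_left)
  also have "\<dots> = (\<Sum>ab\<in>V \<times> V. if ab \<in> K then q * q ^ n else q ^ n)"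
  proof (rule sum.cong[OF refl])
    fix ab assume "ab \<in> V \<times> V"
    then obtain a b where ab: "ab = (a, b)" "a \<in> V" "b \<in> V" by auto
    show "q * card {l \<in> V. l \<bullet> T (fst ab) (snd ab) = 0} = (if ab \<in> K then q * q ^ n else q ^ n)"
    proof (cases "ab \<in> K")
      case True
      then have "T a b = 0\<^sub>v n" using T0 ab by simp
      then have "{l \<in> V. l \<bullet> T a b = 0} = V" by (auto simp: V_def)
      then show ?thesis using True ab cV by simp
    next
      case False
      then have "T a b \<noteq> 0\<^sub>v n" using T0 ab by simp
      then show ?thesis using False card_hyperplane[of "T a b" n] Tc[OF ab(2,3)] ab by (simp add: V_def q_def)
    qed
  qed
  also have "\<dots> = card K * (q * q ^ n) + (q ^ n * q ^ n - card K) * q ^ n"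
    using sum_if_mem[OF _ KV] fV by (simp add: card_cartesian_product cV)
  finally have e1: "q * card S = card K * (q * q ^ n) + (q ^ n * q ^ n - card K) * q ^ n" .
  have "q * card S = (\<Sum>l\<in>V. q * card {ab \<in> V \<times> V. l \<bullet> T (fst ab) (snd ab) = 0})"
    unfolding S2 by (rule sum_distrib_left)
  also have "\<dots> = (\<Sum>l\<in>V. if l \<in> L then q * (q ^ n * q ^ n) else q ^ n * q ^ n)"
  proof (rule sum.cong[OF refl])
    fix l assume l: "l \<in> V"
    define u where "u = l - transpose_mat h *\<^sub>v l"
    define w where "w = transpose_mat g *\<^sub>v l - l"
    have tc: "transpose_mat g *\<^sub>v l \<in> carrier_vec n" "transpose_mat h *\<^sub>v l \<in> carrier_vec n"
      using l g h by (auto simp: V_def)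
    have uw: "u \<in> carrier_vec n" "w \<in> carrier_vec n" using l tc by (auto simp: u_def w_def V_def)
    have z: "x - y = 0\<^sub>v n \<longleftrightarrow> x = y" if "x \<in> carrier_vec n" "y \<in> carrier_vec n" for x y :: "'a vec"
    proof
      assume zz: "x - y = 0\<^sub>v n"
      show "x = y"
      proof (rule eq_vecI)
        fix i assume "i < dim_vec y"
        then have i: "i < n" using that by simp
        have "(x - y) $ i = 0" using zz i by simp
        then show "x $ i = y $ i" using that i by simp
      qed (use that in simp)
    qed (use that in simp)
    have uw0: "u = 0\<^sub>v n \<and> w = 0\<^sub>v n \<longleftrightarrow> l \<in> L"
      unfolding u_def w_def using z[of l "transpose_mat h *\<^sub>v l"] z[of "transpose_mat g *\<^sub>v l" l] tc l
      by (auto simp: L_def V_def)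
    have S': "{ab \<in> V \<times> V. l \<bullet> T (fst ab) (snd ab) = 0} = {(a, b). a \<in> carrier_vec n \<and> b \<in> carrier_vec n \<and> u \<bullet> a + w \<bullet> b = 0}"
      using lT[OF l] by (auto simp: u_def w_def V_def)
    show "q * card {ab \<in> V \<times> V. l \<bullet> T (fst ab) (snd ab) = 0} = (if l \<in> L then q * (q ^ n * q ^ n) else q ^ n * q ^ n)"
    proof (cases "l \<in> L")
      case True
      then have "{(a, b). a \<in> carrier_vec n \<and> b \<in> carrier_vec n \<and> u \<bullet> a + w \<bullet> b = 0} = V \<times> V"
        using uw0 by (auto simp: V_def)
      then show ?thesis unfolding S' using True by (simp add: card_cartesian_product cV)
    next
      case False
      then show ?thesis unfolding S' using card_pairs_hyperplane[OF uw] uw0 by (simp add: q_def power_add)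
    qed
  qed
  also have "\<dots> = card L * (q * (q ^ n * q ^ n)) + (q ^ n - card L) * (q ^ n * q ^ n)"
    using sum_if_mem[OF fV LV] by (simp add: cV)
  finally have e2: "q * card S = card L * (q * (q ^ n * q ^ n)) + (q ^ n - card L) * (q ^ n * q ^ n)" .
  \<comment> \<open>These two bounds make the truncated subtractions in \<open>e1\<close> and
    \<open>e2\<close> genuine, so that the equations can be compared over the integers and
    \<open>(q - 1) q^n\<close> cancelled.\<close>
  have Kle: "card K \<le> q ^ n * q ^ n" using card_mono[OF _ KV] fV by (simp add: card_cartesian_product cV)
  have Lle: "card L \<le> q ^ n" using card_mono[OF fV LV] by (simp add: cV)
  define Q where "Q = int (q ^ n)"
  have "int (card K) * (int q * Q) + (Q * Q - int (card K)) * Q = int (card L) * (int q * (Q * Q)) + (Q - int (card L)) * (Q * Q)"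
    using arg_cong[OF e1[unfolded e2], of int] Kle Lle by (simp add: Q_def of_nat_diff)
  then have "(int q - 1) * Q * int (card K) = (int q - 1) * Q * (Q * int (card L))" by (simp add: algebra_simps)
  moreover have "1 < q" unfolding q_def by (rule CARD_gt_1)
  moreover then have "Q \<noteq> 0" by (simp add: Q_def)
  ultimately have "int (card K) = Q * int (card L)" by simp
  then have "card K = q ^ n * card L" unfolding Q_def by (metis of_nat_eq_iff of_nat_mult)
  then show ?thesis by (simp add: K_def L_def V_def q_def)
qed

text \<open>An exchange of summation: instead of the row vectors fixed by each commuting pair, the
  commuting pairs inside each stabilizer are counted. The transpose encodes the action on row
  vectors.\<close>

lemma card_affine_commuting_pairs:
  fixes S :: "'a::{field,finite} mat set"
  assumes S: "S \<subseteq> carrier_mat n n"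
  shows "card (affine_commuting_pairs n S)
    = CARD('a) ^ n * (\<Sum>l\<in>carrier_vec n. card (commuting_pairs {g \<in> S. transpose_mat g *\<^sub>v l = l}))"
proof -
  have fS: "finite S" using S finite_carrier_mat finite_subset by blast
  define E where "E g h = {(a, b). a \<in> carrier_vec n \<and> b \<in> carrier_vec n \<and> a + g *\<^sub>v b = b + h *\<^sub>v a}" for g h :: "'a mat"
  define F where "F g h = {l \<in> carrier_vec n. transpose_mat g *\<^sub>v l = l \<and> transpose_mat h *\<^sub>v l = l}" for g h :: "'a mat"
  have fE: "finite (E g h)" for g h
    by (rule finite_subset[of _ "carrier_vec n \<times> carrier_vec n"]) (auto simp: E_def)
  have fF: "finite (F g h)" for g h
    by (rule finite_subset[of _ "carrier_vec n"]) (auto simp: F_def)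
  have "bij_betw (\<lambda>((g, h), (a, b)). ((a, g), (b, h))) (SIGMA (g, h):commuting_pairs S. E g h) (affine_commuting_pairs n S)"
    by (rule bij_betw_byWitness[where f' = "\<lambda>((a, g), (b, h)). ((g, h), (a, b))"])
      (auto simp: commuting_pairs_def affine_commuting_pairs_def E_def)
  from bij_betw_same_card[OF this]
  have "card (affine_commuting_pairs n S) = (\<Sum>(g, h)\<in>commuting_pairs S. card (E g h))"
    using fS fE by (simp add: card_SigmaI split_def)
  also have "\<dots> = (\<Sum>(g, h)\<in>commuting_pairs S. CARD('a) ^ n * card (F g h))"
  proof (rule sum.cong[OF refl], clarify)
    fix g h assume "(g, h) \<in> commuting_pairs S"
    then have "g \<in> carrier_mat n n" "h \<in> carrier_mat n n" using S by (auto simp: commuting_pairs_def)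
    then show "card (E g h) = CARD('a) ^ n * card (F g h)"
      unfolding E_def F_def by (rule card_affine_solutions)
  qed
  also have "\<dots> = CARD('a) ^ n * (\<Sum>(g, h)\<in>commuting_pairs S. card (F g h))"
    by (simp add: sum_distrib_left split_def)
  also have "(\<Sum>(g, h)\<in>commuting_pairs S. card (F g h)) = card (SIGMA (g, h):commuting_pairs S. F g h)"
    using fS fF by (simp add: card_SigmaI split_def)
  also have "\<dots> = card (SIGMA l:carrier_vec n. commuting_pairs {g \<in> S. transpose_mat g *\<^sub>v l = l})"
  proof -
    have "bij_betw (\<lambda>(gh, l). (l, gh)) (SIGMA (g, h):commuting_pairs S. F g h)
        (SIGMA l:carrier_vec n. commuting_pairs {g \<in> S. transpose_mat g *\<^sub>v l = l})"
      by (rule bij_betw_byWitness[where f' = "\<lambda>(l, gh). (gh, l)"])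
        (auto simp: commuting_pairs_def F_def)
    then show ?thesis by (rule bij_betw_same_card)
  qed
  also have "\<dots> = (\<Sum>l\<in>carrier_vec n. card (commuting_pairs {g \<in> S. transpose_mat g *\<^sub>v l = l}))"
    using fS by (intro card_SigmaI) auto
  finally show ?thesis .
qed

section \<open>Transitivity on nonzero row vectors and their stabilizers\<close>

lemma transpose_mult_vec:
  fixes A B :: "'a::comm_semiring_1 mat"
  assumes "A \<in> carrier_mat n n" "B \<in> carrier_mat n n" "l \<in> carrier_vec n"
  shows "transpose_mat (A * B) *\<^sub>v l = transpose_mat B *\<^sub>v (transpose_mat A *\<^sub>v l)"
  using assms by (simp add: transpose_mult[of A n n B n] assoc_mult_mat_vec[of _ n n _ n])

text \<open>Conjugation by \<open>x\<close> carries the stabilizer of the row vector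
  \<open>l x\<close> into that of \<open>l\<close> and preserves determinants. Applied to
  \<open>x\<close> and to its inverse, the inequality becomes an equality.\<close>

lemma card_commuting_pairs_fixers_le:
  fixes x :: "'a::{field,finite} mat"
  assumes x: "x \<in> carrier_mat n n" "det x \<noteq> 0" and l: "l \<in> carrier_vec n"
  shows "card (commuting_pairs {g \<in> det_mats n D. transpose_mat g *\<^sub>v (transpose_mat x *\<^sub>v l) = transpose_mat x *\<^sub>v l})
    \<le> card (commuting_pairs {g \<in> det_mats n D. transpose_mat g *\<^sub>v l = l})"
proof -
  obtain y where y: "y \<in> carrier_mat n n" "x * y = 1\<^sub>m n" "y * x = 1\<^sub>m n"
    using det_nonzero_inverse[OF x] by blast
  define \<phi> where "\<phi> g = x * g * y" for g
  have \<phi>c: "\<phi> g \<in> carrier_mat n n" if "g \<in> carrier_mat n n" for g using that x y by (simp add: \<phi>_def)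
  have cancel: "y * \<phi> g * x = g" if g: "g \<in> carrier_mat n n" for g
  proof -
    have "y * \<phi> g * x = y * (\<phi> g * x)" using y \<phi>c[OF g] x by (intro assoc_mult_mat)
    also have "\<phi> g * x = x * g * (y * x)" unfolding \<phi>_def using x y g by (intro assoc_mult_mat) auto
    also have "\<dots> = x * g" using x y g by simp
    also have "y * (x * g) = y * x * g" using x y g by (intro assoc_mult_mat[symmetric])
    also have "\<dots> = g" using y g by simp
    finally show ?thesis .
  qed
  have mult: "\<phi> g * \<phi> h = \<phi> (g * h)" if g: "g \<in> carrier_mat n n" and h: "h \<in> carrier_mat n n" for g h
  proof -
    have "\<phi> g * \<phi> h = x * g * (y * \<phi> h)" unfolding \<phi>_def[of g] using x y g \<phi>c[OF h] by (intro assoc_mult_mat) auto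
    also have "y * \<phi> h = y * (x * (h * y))" unfolding \<phi>_def using x y h by (simp add: assoc_mult_mat[of _ n n _ n _ n])
    also have "\<dots> = y * x * (h * y)" using x y h by (intro assoc_mult_mat[symmetric]) auto
    also have "\<dots> = h * y" using y h by simp
    also have "x * g * (h * y) = \<phi> (g * h)" unfolding \<phi>_def using x y g h by (simp add: assoc_mult_mat[of _ n n _ n _ n])
    finally show ?thesis .
  qed
  have det: "det (\<phi> g) = det g" if g: "g \<in> carrier_mat n n" for g
  proof -
    have "det x * det y = 1" using det_mult[OF x(1) y(1)] y(2) by simp
    then have "det g * (det x * det y) = det g" by simp
    then show ?thesis unfolding \<phi>_def using x y g
      by (simp add: det_mult[of _ n] mult.commute mult.left_commute)
  qed
  have fixl: "transpose_mat (\<phi> g) *\<^sub>v l = l"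
    if g: "g \<in> carrier_mat n n" and f: "transpose_mat g *\<^sub>v (transpose_mat x *\<^sub>v l) = transpose_mat x *\<^sub>v l" for g
  proof -
    have "transpose_mat (\<phi> g) *\<^sub>v l = transpose_mat y *\<^sub>v (transpose_mat g *\<^sub>v (transpose_mat x *\<^sub>v l))"
      unfolding \<phi>_def using transpose_mult_vec[of "x * g" n y l] transpose_mult_vec[of x n g l] x y g l by simp
    also have "\<dots> = transpose_mat (x * y) *\<^sub>v l" unfolding f using transpose_mult_vec[OF x(1) y(1) l] by simp
    also have "\<dots> = l" using y l by simp
    finally show ?thesis .
  qed
  show ?thesis
  proof (rule card_inj_on_le[where f = "\<lambda>(g, h). (\<phi> g, \<phi> h)"])
    show "inj_on (\<lambda>(g, h). (\<phi> g, \<phi> h))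
      (commuting_pairs {g \<in> det_mats n D. transpose_mat g *\<^sub>v (transpose_mat x *\<^sub>v l) = transpose_mat x *\<^sub>v l})"
    proof (rule inj_onI, clarify)
      fix g h g' h'
      assume *: "(g, h) \<in> commuting_pairs {g \<in> det_mats n D. transpose_mat g *\<^sub>v (transpose_mat x *\<^sub>v l) = transpose_mat x *\<^sub>v l}"
        "(g', h') \<in> commuting_pairs {g \<in> det_mats n D. transpose_mat g *\<^sub>v (transpose_mat x *\<^sub>v l) = transpose_mat x *\<^sub>v l}"
        and eq: "\<phi> g = \<phi> g'" "\<phi> h = \<phi> h'"
      have "g \<in> carrier_mat n n" "h \<in> carrier_mat n n" "g' \<in> carrier_mat n n" "h' \<in> carrier_mat n n"
        using * by (auto simp: commuting_pairs_def det_mats_def)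
      then show "g = g' \<and> h = h'" using cancel eq by metis
    qed
    show "(\<lambda>(g, h). (\<phi> g, \<phi> h)) `
      commuting_pairs {g \<in> det_mats n D. transpose_mat g *\<^sub>v (transpose_mat x *\<^sub>v l) = transpose_mat x *\<^sub>v l}
      \<subseteq> commuting_pairs {g \<in> det_mats n D. transpose_mat g *\<^sub>v l = l}"
      using \<phi>c mult det fixl by (auto simp: commuting_pairs_def det_mats_def)
    show "finite (commuting_pairs {g \<in> det_mats n D. transpose_mat g *\<^sub>v l = l})" by simp
  qed
qed

text \<open>Right multiplication by \<open>y\<close> moves the row and keeps the determinant;
  equality again comes from using a matrix and its inverse.\<close>

lemma card_row_translate_le:
  fixes y :: "'a::{field,finite} mat"
  assumes y: "y \<in> carrier_mat n n" "det y = 1" and e: "e \<in> carrier_vec n" and l: "l \<in> carrier_vec n"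
  shows "card {g \<in> det_mats n D. transpose_mat g *\<^sub>v e = l}
    \<le> card {g \<in> det_mats n D. transpose_mat g *\<^sub>v e = transpose_mat y *\<^sub>v l}"
proof -
  obtain z where z: "z \<in> carrier_mat n n" "y * z = 1\<^sub>m n"
    using det_nonzero_inverse[OF y(1)] y(2) by force
  have cancel: "g * y * z = g" if "g \<in> carrier_mat n n" for g
    using that y z by (simp add: assoc_mult_mat[of _ n n _ n _ n])
  show ?thesis
  proof (rule card_inj_on_le[where f = "\<lambda>g. g * y"])
    show "inj_on (\<lambda>g. g * y) {g \<in> det_mats n D. transpose_mat g *\<^sub>v e = l}"
    proof (rule inj_onI)
      fix g h assume g: "g \<in> {g \<in> det_mats n D. transpose_mat g *\<^sub>v e = l}"
        and h: "h \<in> {g \<in> det_mats n D. transpose_mat g *\<^sub>v e = l}" and eq: "g * y = h * y"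
      have "g = g * y * z" using cancel[of g] g by (simp add: det_mats_def)
      also have "\<dots> = h" unfolding eq using cancel[of h] h by (simp add: det_mats_def)
      finally show "g = h" .
    qed
    show "(\<lambda>g. g * y) ` {g \<in> det_mats n D. transpose_mat g *\<^sub>v e = l}
      \<subseteq> {g \<in> det_mats n D. transpose_mat g *\<^sub>v e = transpose_mat y *\<^sub>v l}"
      using y e transpose_mult_vec[of _ n y e] by (auto simp: det_mats_def det_mult)
  qed simp
qed

text \<open>The vector is completed to an invertible matrix as first column and becomes a first row
  by transposition. Scaling the second row corrects the determinant, and this is where
  \<open>n \<ge> 2\<close> enters.\<close>

lemma ex_SL_row:
  fixes l :: "'a::{field,finite} vec"
  assumes n: "2 \<le> n" and l: "l \<in> carrier_vec n" "l \<noteq> 0\<^sub>v n"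
  obtains x where "x \<in> carrier_mat n n" "det x = 1" "transpose_mat x *\<^sub>v unit_vec n 0 = l"
proof -
  define R where "R = mat n 1 (\<lambda>(i, j). l $ i)"
  have R: "R \<in> carrier_mat n 1" by (simp add: R_def)
  obtain i where i: "i < n" "l $ i \<noteq> 0" using l by (metis carrier_vecD eq_vecI index_zero_vec)
  have inj: "v = 0\<^sub>v 1" if v: "v \<in> carrier_vec 1" and Rv: "R *\<^sub>v v = 0\<^sub>v n" for v
  proof -
    have "(R *\<^sub>v v) $ i = l $ i * v $ 0" using i v by (simp add: R_def scalar_prod_def)
    then have "v $ 0 = 0" using Rv i by simp
    then show ?thesis using v by (intro eq_vecI) auto
  qed
  obtain P where P: "P \<in> carrier_mat n n" "det P \<noteq> 0" "\<And>i j. i < n \<Longrightarrow> j < 1 \<Longrightarrow> P $$ (i, j) = R $$ (i, j)"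
    using extend_to_basis[OF R inj] by blast
  define x where "x = multrow 1 (inverse (det P)) (transpose_mat P)"
  have x: "x \<in> carrier_mat n n" using P by (simp add: x_def)
  have "det x = inverse (det P) * det (transpose_mat P)"
    unfolding x_def by (rule det_multrow) (use n P in auto)
  then have "det x = 1" using P det_transpose[OF P(1)] by simp
  moreover have "transpose_mat x *\<^sub>v unit_vec n 0 = l"
  proof -
    have "transpose_mat x *\<^sub>v unit_vec n 0 = row x 0"
      using mult_unit_vec[of "transpose_mat x" n n 0] x n by simp
    also have "\<dots> = l"
      using P l n by (intro eq_vecI) (auto simp: x_def R_def)
    finally show ?thesis .
  qed
  ultimately show ?thesis using that x by blast
qed

text \<open>The affine group as the stabilizer of the first unit row vector. The translation part
  stands below the 1, so that the matrix product is the semidirect multiplication.\<close>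

definition affine_mat :: "nat \<Rightarrow> 'a::field vec \<Rightarrow> 'a mat \<Rightarrow> 'a mat" where
  "affine_mat m v A = four_block_mat (1\<^sub>m 1) (0\<^sub>m 1 m) (mat m 1 (\<lambda>(i, j). v $ i)) A"

lemma affine_mat_carrier:
  "A \<in> carrier_mat m m \<Longrightarrow> affine_mat m v A \<in> carrier_mat (Suc m) (Suc m)"
  unfolding affine_mat_def using four_block_carrier_mat[of "1\<^sub>m 1" 1 1 A m m] by simp

lemma det_affine_mat: "A \<in> carrier_mat m m \<Longrightarrow> det (affine_mat m v A) = det A"
  unfolding affine_mat_def
  by (subst det_four_block_mat_upper_right_zero[of _ 1 _ m]) auto

lemma affine_mat_mult:
  assumes A: "A \<in> carrier_mat m m" and B: "B \<in> carrier_mat m m" and v: "v \<in> carrier_vec m" and w: "w \<in> carrier_vec m"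
  shows "affine_mat m v A * affine_mat m w B = affine_mat m (v + A *\<^sub>v w) (A * B)"
proof -
  define cv where "cv v = mat m 1 (\<lambda>(i, j). v $ i)" for v :: "'a vec"
  have cv: "cv v \<in> carrier_mat m 1" for v by (simp add: cv_def)
  have "affine_mat m v A * affine_mat m w B = four_block_mat (1\<^sub>m 1 * 1\<^sub>m 1 + 0\<^sub>m 1 m * cv w)
     (1\<^sub>m 1 * 0\<^sub>m 1 m + 0\<^sub>m 1 m * B) (cv v * 1\<^sub>m 1 + A * cv w) (cv v * 0\<^sub>m 1 m + A * B)"
    unfolding affine_mat_def cv_def[symmetric]
    by (rule mult_four_block_mat[OF one_carrier_mat zero_carrier_mat cv A one_carrier_mat zero_carrier_mat cv B])
  also have "1\<^sub>m 1 * 1\<^sub>m 1 + 0\<^sub>m 1 m * cv w = (1\<^sub>m 1 :: 'a mat)" unfolding left_mult_zero_mat[OF cv] by simp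
  also have "1\<^sub>m 1 * 0\<^sub>m 1 m + 0\<^sub>m 1 m * B = 0\<^sub>m 1 m" unfolding left_mult_zero_mat[OF B] by simp
  also have "cv v * 0\<^sub>m 1 m + A * B = A * B"
    unfolding right_mult_zero_mat[OF cv] using A B by (intro left_add_zero_mat) auto
  also have "cv v * 1\<^sub>m 1 + A * cv w = cv (v + A *\<^sub>v w)"
    using cv A v w by (intro eq_matI) (auto simp: cv_def scalar_prod_def)
  finally show ?thesis unfolding affine_mat_def cv_def .
qed

lemma affine_mat_inject:
  assumes "A \<in> carrier_mat m m" "B \<in> carrier_mat m m" "v \<in> carrier_vec m" "w \<in> carrier_vec m"
    and eq: "affine_mat m v A = affine_mat m w B"
  shows "v = w \<and> A = B"
proof
  show "v = w"
  proof (rule eq_vecI)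
    fix i assume "i < dim_vec w"
    then show "v $ i = w $ i"
      using arg_cong[OF eq, of "\<lambda>M. M $$ (Suc i, 0)"] assms by (simp add: affine_mat_def)
  qed (use assms in simp)
  show "A = B"
  proof (rule eq_matI)
    fix i j assume "i < dim_row B" "j < dim_col B"
    then show "A $$ (i, j) = B $$ (i, j)"
      using arg_cong[OF eq, of "\<lambda>M. M $$ (Suc i, Suc j)"] assms by (simp add: affine_mat_def)
  qed (use assms in auto)
qed

lemma transpose_mult_unit_vec:
  fixes g :: "'a::semiring_1 mat"
  assumes "g \<in> carrier_mat n n" "i < n"
  shows "transpose_mat g *\<^sub>v unit_vec n i = row g (i :: nat)"
  using mult_unit_vec[of "transpose_mat g" n n i] assms by simp

lemma fixers_unit_vec:
  "{g \<in> det_mats (Suc m) D. transpose_mat g *\<^sub>v unit_vec (Suc m) 0 = unit_vec (Suc m) 0}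
    = (\<lambda>(v, A). affine_mat m v A) ` (carrier_vec m \<times> det_mats m (D :: 'a::field set))"
proof (intro equalityI subsetI)
  fix g assume "g \<in> {g \<in> det_mats (Suc m) D. transpose_mat g *\<^sub>v unit_vec (Suc m) 0 = unit_vec (Suc m) 0}"
  then have g: "g \<in> carrier_mat (Suc m) (Suc m)" "det g \<in> D" and r: "row g 0 = unit_vec (Suc m) 0"
    using transpose_mult_unit_vec[of g "Suc m" 0] by (auto simp: det_mats_def)
  define v where "v = vec m (\<lambda>i. g $$ (Suc i, 0))"
  define A where "A = mat m m (\<lambda>(i, j). g $$ (Suc i, Suc j))"
  have A: "A \<in> carrier_mat m m" by (simp add: A_def)
  have g0: "g $$ (0, j) = (if j = 0 then 1 else 0)" if "j < Suc m" for j
    using arg_cong[OF r, of "\<lambda>v. v $ j"] that g by simp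
  have eq: "g = affine_mat m v A"
  proof (rule eq_matI)
    fix i j assume "i < dim_row (affine_mat m v A)" "j < dim_col (affine_mat m v A)"
    then have "i < Suc m" "j < Suc m" using affine_mat_carrier[OF A, of v] by auto
    then show "g $$ (i, j) = affine_mat m v A $$ (i, j)"
      using g0 A by (cases i; cases j) (auto simp: affine_mat_def v_def A_def)
  qed (use g affine_mat_carrier[OF A, of v] in auto)
  have "det A \<in> D" using det_affine_mat[OF A, of v] g(2) unfolding eq[symmetric] by simp
  then have "A \<in> det_mats m D" using A by (simp add: det_mats_def)
  moreover have "v \<in> carrier_vec m" by (simp add: v_def)
  ultimately show "g \<in> (\<lambda>(v, A). affine_mat m v A) ` (carrier_vec m \<times> det_mats m D)" using eq by force
next
  fix g assume "g \<in> (\<lambda>(v, A). affine_mat m v A) ` (carrier_vec m \<times> det_mats m D)"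
  then obtain v A where vA: "v \<in> carrier_vec m" "A \<in> carrier_mat m m" "det A \<in> D" "g = affine_mat m v A"
    by (auto simp: det_mats_def)
  have g: "g \<in> carrier_mat (Suc m) (Suc m)" using affine_mat_carrier vA by blast
  have "row g 0 = unit_vec (Suc m) 0"
    using g vA by (intro eq_vecI) (auto simp: affine_mat_def)
  then show "g \<in> {g \<in> det_mats (Suc m) D. transpose_mat g *\<^sub>v unit_vec (Suc m) 0 = unit_vec (Suc m) 0}"
    using g vA det_affine_mat[of A m v] transpose_mult_unit_vec[OF g, of 0] by (simp add: det_mats_def)
qed

lemma inj_on_affine_mat: "inj_on (\<lambda>(v, A). affine_mat m v A) (carrier_vec m \<times> det_mats m D)"
proof (rule inj_onI, clarify)
  fix v w A B assume "A \<in> det_mats m D" "B \<in> det_mats m D" "v \<in> carrier_vec m" "w \<in> carrier_vec m"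
    "affine_mat m v A = affine_mat m w B"
  then show "v = w \<and> A = B" using affine_mat_inject[of A m B v w] by (simp add: det_mats_def)
qed

lemma card_commuting_pairs_fixers:
  "card (commuting_pairs {g \<in> det_mats (Suc m) D. transpose_mat g *\<^sub>v unit_vec (Suc m) 0 = unit_vec (Suc m) 0})
    = card (affine_commuting_pairs m (det_mats m (D :: 'a::field set)))"
proof -
  define \<Phi> where "\<Phi> = (\<lambda>(v, A). affine_mat m v (A :: 'a mat))"
  define X where "X = (carrier_vec m :: 'a vec set) \<times> det_mats m D"
  have comm: "\<Phi> x * \<Phi> y = \<Phi> y * \<Phi> x \<longleftrightarrow> (x, y) \<in> affine_commuting_pairs m (det_mats m D)"
    if xX: "x \<in> X" and yX: "y \<in> X" for x y
  proof -
    obtain v A w B where xy: "x = (v, A)" "y = (w, B)" "v \<in> carrier_vec m" "w \<in> carrier_vec m"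
      "A \<in> det_mats m D" "B \<in> det_mats m D" using xX yX unfolding X_def by blast
    then have AB: "A \<in> carrier_mat m m" "B \<in> carrier_mat m m" by (auto simp: det_mats_def)
    have c: "v + A *\<^sub>v w \<in> carrier_vec m" "w + B *\<^sub>v v \<in> carrier_vec m" "A * B \<in> carrier_mat m m" "B * A \<in> carrier_mat m m"
      using AB xy by auto
    have "\<Phi> x * \<Phi> y = \<Phi> y * \<Phi> x \<longleftrightarrow> affine_mat m (v + A *\<^sub>v w) (A * B) = affine_mat m (w + B *\<^sub>v v) (B * A)"
      unfolding \<Phi>_def xy using affine_mat_mult[OF AB xy(3,4)] affine_mat_mult[OF AB(2,1) xy(4,3)] by simp
    also have "\<dots> \<longleftrightarrow> v + A *\<^sub>v w = w + B *\<^sub>v v \<and> A * B = B * A"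
      by (rule iffI, rule affine_mat_inject[OF c(3,4,1,2)]) simp_all
    also have "\<dots> \<longleftrightarrow> (x, y) \<in> affine_commuting_pairs m (det_mats m D)"
      using xy by (simp add: affine_commuting_pairs_def)
    finally show ?thesis .
  qed
  have sub: "affine_commuting_pairs m (det_mats m D) \<subseteq> X \<times> X" by (auto simp: affine_commuting_pairs_def X_def)
  have inj: "inj_on \<Phi> X" unfolding \<Phi>_def X_def by (rule inj_on_affine_mat)
  have "bij_betw (map_prod \<Phi> \<Phi>) (affine_commuting_pairs m (det_mats m D)) (commuting_pairs (\<Phi> ` X))"
  proof (rule bij_betw_imageI)
    show "inj_on (map_prod \<Phi> \<Phi>) (affine_commuting_pairs m (det_mats m D))"
      using map_prod_inj_on[OF inj inj] sub by (rule inj_on_subset)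
    show "map_prod \<Phi> \<Phi> ` affine_commuting_pairs m (det_mats m D) = commuting_pairs (\<Phi> ` X)"
    proof (intro equalityI subsetI)
      fix p assume "p \<in> map_prod \<Phi> \<Phi> ` affine_commuting_pairs m (det_mats m D)"
      then obtain x y where xy: "(x, y) \<in> affine_commuting_pairs m (det_mats m D)" "p = (\<Phi> x, \<Phi> y)" by force
      then have "x \<in> X" "y \<in> X" using sub by auto
      then show "p \<in> commuting_pairs (\<Phi> ` X)" using comm xy by (simp add: commuting_pairs_def)
    next
      fix p assume "p \<in> commuting_pairs (\<Phi> ` X)"
      then obtain x y where xy: "x \<in> X" "y \<in> X" "p = (\<Phi> x, \<Phi> y)" "\<Phi> x * \<Phi> y = \<Phi> y * \<Phi> x"
        by (auto simp: commuting_pairs_def)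
      then have "(x, y) \<in> affine_commuting_pairs m (det_mats m D)" using comm by blast
      then show "p \<in> map_prod \<Phi> \<Phi> ` affine_commuting_pairs m (det_mats m D)" using xy(3) by force
    qed
  qed
  from bij_betw_same_card[OF this] show ?thesis
    unfolding fixers_unit_vec \<Phi>_def X_def by simp
qed

lemma card_commuting_pairs_fixers_nonzero:
  fixes l :: "'a::{field,finite} vec"
  assumes m: "1 \<le> m" and l: "l \<in> carrier_vec (Suc m)" "l \<noteq> 0\<^sub>v (Suc m)"
  shows "card (commuting_pairs {g \<in> det_mats (Suc m) D. transpose_mat g *\<^sub>v l = l})
    = card (affine_commuting_pairs m (det_mats m D))"
proof -
  have n: "2 \<le> Suc m" using m by simp
  obtain x where x: "x \<in> carrier_mat (Suc m) (Suc m)" "det x = 1" "transpose_mat x *\<^sub>v unit_vec (Suc m) 0 = l"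
    using ex_SL_row[OF n l] by blast
  have dx: "det x \<noteq> 0" using x(2) by simp
  obtain y where y: "y \<in> carrier_mat (Suc m) (Suc m)" "x * y = 1\<^sub>m (Suc m)" "det y \<noteq> 0"
    using det_nonzero_inverse[OF x(1) dx] by blast
  have e: "unit_vec (Suc m) 0 \<in> carrier_vec (Suc m)" by simp
  have yl: "transpose_mat y *\<^sub>v l = unit_vec (Suc m) 0"
    unfolding x(3)[symmetric] transpose_mult_vec[OF x(1) y(1) e, symmetric] y(2) by simp
  show ?thesis
    unfolding card_commuting_pairs_fixers[symmetric]
    using card_commuting_pairs_fixers_le[OF x(1) dx e, of D] card_commuting_pairs_fixers_le[OF y(1,3) l(1), of D]
    unfolding x(3) yl by (rule le_antisym)
qed

lemma card_det_mats_rows: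
  fixes l :: "'a::{field,finite} vec"
  assumes m: "1 \<le> m" and l: "l \<in> carrier_vec (Suc m)" "l \<noteq> 0\<^sub>v (Suc m)"
  shows "card {g \<in> det_mats (Suc m) D. transpose_mat g *\<^sub>v unit_vec (Suc m) 0 = l}
    = CARD('a) ^ m * card (det_mats m D)"
proof -
  have n: "2 \<le> Suc m" using m by simp
  obtain x where x: "x \<in> carrier_mat (Suc m) (Suc m)" "det x = 1" "transpose_mat x *\<^sub>v unit_vec (Suc m) 0 = l"
    using ex_SL_row[OF n l] by blast
  have dx: "det x \<noteq> 0" using x(2) by simp
  obtain y where y: "y \<in> carrier_mat (Suc m) (Suc m)" "x * y = 1\<^sub>m (Suc m)"
    using det_nonzero_inverse[OF x(1) dx] by blast
  have dy: "det y = 1" using det_mult[OF x(1) y(1)] y(2) x(2) by simp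
  have e: "unit_vec (Suc m) 0 \<in> carrier_vec (Suc m)" by simp
  have yl: "transpose_mat y *\<^sub>v l = unit_vec (Suc m) 0"
    unfolding x(3)[symmetric] transpose_mult_vec[OF x(1) y(1) e, symmetric] y(2) by simp
  have "card {g \<in> det_mats (Suc m) D. transpose_mat g *\<^sub>v unit_vec (Suc m) 0 = l}
    = card {g \<in> det_mats (Suc m) D. transpose_mat g *\<^sub>v unit_vec (Suc m) 0 = unit_vec (Suc m) 0}"
    using card_row_translate_le[OF x(1,2) e e, of D] card_row_translate_le[OF y(1) dy e l(1), of D]
    unfolding x(3) yl by (rule le_antisym[rotated])
  also have "\<dots> = CARD('a) ^ m * card (det_mats m D)"
    unfolding fixers_unit_vec card_image[OF inj_on_affine_mat] card_cartesian_product card_carrier_vec ..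
  finally show ?thesis .
qed

text \<open>The matrices are sorted by their first row. It is nonzero as determinants are, and by
  transitivity every nonzero row occurs equally often.\<close>

lemma card_det_mats_Suc:
  fixes D :: "'a::{field,finite} set"
  assumes m: "1 \<le> m" and D: "0 \<notin> D"
  shows "card (det_mats (Suc m) D) = (CARD('a) ^ Suc m - 1) * (CARD('a) ^ m * card (det_mats m D))"
proof -
  define e where "e = (unit_vec (Suc m) 0 :: 'a vec)"
  define W where "W = carrier_vec (Suc m) - {0\<^sub>v (Suc m) :: 'a vec}"
  have rW: "transpose_mat g *\<^sub>v e \<in> W" if g: "g \<in> det_mats (Suc m) D" for g
  proof -
    have gc: "g \<in> carrier_mat (Suc m) (Suc m)" "det g \<noteq> 0" using g D by (auto simp: det_mats_def)
    have "det (transpose_mat g) \<noteq> 0" using det_transpose[OF gc(1)] gc(2) by simp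
    then have "transpose_mat g *\<^sub>v e \<noteq> 0\<^sub>v (Suc m)"
      using det_0_iff_vec_prod_zero[of "transpose_mat g" "Suc m"] gc(1)
        unit_vec_carrier[of "Suc m" 0, where 'a='a] unit_vec_nonzero[of 0 "Suc m", where 'a='a]
      unfolding e_def by (metis transpose_carrier_mat zero_less_Suc)
    moreover have "transpose_mat g *\<^sub>v e \<in> carrier_vec (Suc m)"
      using gc by (intro mult_mat_vec_carrier[of _ _ "Suc m"]) (auto simp: e_def)
    ultimately show ?thesis by (simp add: W_def)
  qed
  have "card (det_mats (Suc m) D) = (\<Sum>g\<in>det_mats (Suc m) D. 1)" by simp
  also have "\<dots> = (\<Sum>l\<in>W. \<Sum>g\<in>{g \<in> det_mats (Suc m) D. transpose_mat g *\<^sub>v e = l}. 1)"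
    by (rule sum.group[symmetric]) (use rW in \<open>auto simp: W_def\<close>)
  also have "\<dots> = (\<Sum>l\<in>W. CARD('a) ^ m * card (det_mats m D))"
    using card_det_mats_rows[OF m, of _ D] by (intro sum.cong) (auto simp: W_def e_def)
  also have "\<dots> = card W * (CARD('a) ^ m * card (det_mats m D))" by simp
  also have "card W = CARD('a) ^ Suc m - 1"
    unfolding W_def by (subst card_Diff_singleton) (simp_all add: card_carrier_vec)
  finally show ?thesis .
qed

text \<open>The zero row vector is fixed by the whole group and contributes all its commuting pairs;
  every other row vector has the affine group one dimension lower as its stabilizer.\<close>

lemma card_affine_commuting_pairs_Suc:
  fixes D :: "'a::{field,finite} set"
  assumes m: "1 \<le> m"
  shows "card (affine_commuting_pairs (Suc m) (det_mats (Suc m) D))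
    = CARD('a) ^ Suc m * (card (commuting_pairs (det_mats (Suc m) D))
        + (CARD('a) ^ Suc m - 1) * card (affine_commuting_pairs m (det_mats m D)))"
proof -
  define N where "N = card (affine_commuting_pairs m (det_mats m D))"
  define f where "f l = card (commuting_pairs {g \<in> det_mats (Suc m) D. transpose_mat g *\<^sub>v l = l})" for l
  have z: "0\<^sub>v (Suc m) \<in> (carrier_vec (Suc m) :: 'a vec set)" by simp
  have "{g \<in> det_mats (Suc m) D. transpose_mat g *\<^sub>v 0\<^sub>v (Suc m) = 0\<^sub>v (Suc m)} = det_mats (Suc m) D"
    by (auto simp: det_mats_def intro!: mult_mat_zero_vec)
  then have f0: "f (0\<^sub>v (Suc m)) = card (commuting_pairs (det_mats (Suc m) D))" by (simp add: f_def)
  have "(\<Sum>l\<in>carrier_vec (Suc m). f l) = f (0\<^sub>v (Suc m)) + (\<Sum>l\<in>carrier_vec (Suc m) - {0\<^sub>v (Suc m)}. f l)"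
    by (rule sum.remove[OF finite_carrier_vec z])
  also have "(\<Sum>l\<in>carrier_vec (Suc m) - {0\<^sub>v (Suc m)}. f l) = (\<Sum>l\<in>carrier_vec (Suc m) - {0\<^sub>v (Suc m) :: 'a vec}. N)"
    unfolding N_def f_def using card_commuting_pairs_fixers_nonzero[OF m, of _ D] by (intro sum.cong) auto
  also have "\<dots> = (CARD('a) ^ Suc m - 1) * N"
    by (simp add: card_Diff_singleton[OF z] card_carrier_vec del: power_Suc)
  finally have "(\<Sum>l\<in>carrier_vec (Suc m). f l) = f (0\<^sub>v (Suc m)) + (CARD('a) ^ Suc m - 1) * N" .
  moreover have "det_mats (Suc m) D \<subseteq> carrier_mat (Suc m) (Suc m)" by (auto simp: det_mats_def)
  ultimately show ?thesis using card_affine_commuting_pairs[of "det_mats (Suc m) D" "Suc m"] f0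
    unfolding f_def N_def by simp
qed

section \<open>Dimension one\<close>

lemma det_mats_1: "A \<in> det_mats 1 D \<longleftrightarrow> (\<exists>d\<in>D. A = mat 1 1 (\<lambda>_. d :: 'a::field))"
proof
  assume A: "A \<in> det_mats 1 D"
  then have c: "A \<in> carrier_mat 1 1" by (simp add: det_mats_def)
  have "det A = A $$ (0, 0)" using det_single[OF c] by simp
  then have "A $$ (0, 0) \<in> D" using A by (simp add: det_mats_def)
  moreover have "A = mat 1 1 (\<lambda>_. A $$ (0, 0))" using c by (intro eq_matI) auto
  ultimately show "\<exists>d\<in>D. A = mat 1 1 (\<lambda>_. d)" by blast
next
  assume "\<exists>d\<in>D. A = mat 1 1 (\<lambda>_. d)"
  then obtain d where d: "d \<in> D" "A = mat 1 1 (\<lambda>_. d)" by blast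
  have c: "A \<in> carrier_mat 1 1" by (simp add: d)
  then show "A \<in> det_mats 1 D" using det_single[OF c] d by (simp add: det_mats_def)
qed

lemma det_mats_1_image: "det_mats 1 D = (\<lambda>d. mat 1 1 (\<lambda>_. d)) ` (D :: 'a::field set)"
  using det_mats_1 by (auto simp: image_iff)

lemma card_det_mats_1: "card (det_mats 1 (D :: 'a::field set)) = card D"
proof -
  have "inj_on (\<lambda>d. mat 1 1 (\<lambda>_. d :: 'a)) D"
  proof (rule inj_onI)
    fix d d' :: 'a assume "mat 1 1 (\<lambda>_. d) = mat 1 1 (\<lambda>_. d')"
    from arg_cong[OF this, of "\<lambda>M. M $$ (0, 0)"] show "d = d'" by simp
  qed
  then show ?thesis unfolding det_mats_1_image by (rule card_image)
qed

text \<open>In dimension 1 the group need not be transitive on nonzero vectors, but it is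
  commutative and their stabilizers are trivial, so the count is direct.\<close>

lemma card_affine_commuting_pairs_1:
  fixes D :: "'a::{field,finite} set"
  assumes D: "1 \<in> D"
  shows "card (affine_commuting_pairs 1 (det_mats 1 D)) = CARD('a) * (card D * card D + (CARD('a) - 1))"
proof -
  define f where "f l = card (commuting_pairs {g \<in> det_mats 1 D. transpose_mat g *\<^sub>v l = l})" for l
  have z: "0\<^sub>v 1 \<in> (carrier_vec 1 :: 'a vec set)" by simp
  have comm: "g * h = h * g" if "g \<in> det_mats 1 D" "h \<in> det_mats 1 D" for g h
    using that unfolding det_mats_1 by (auto simp: mult.commute scalar_prod_def intro!: eq_matI)
  have "{g \<in> det_mats 1 D. transpose_mat g *\<^sub>v 0\<^sub>v 1 = 0\<^sub>v 1} = det_mats 1 D"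
    by (auto simp: det_mats_def intro!: mult_mat_zero_vec simp del: One_nat_def zero_vec_Suc)
  moreover have "commuting_pairs (det_mats 1 D) = det_mats 1 D \<times> det_mats 1 D"
    using comm by (auto simp: commuting_pairs_def)
  ultimately have f0: "f (0\<^sub>v 1) = card D * card D"
    by (simp only: f_def card_cartesian_product card_det_mats_1)
  have f1: "f l = 1" if l: "l \<in> carrier_vec 1 - {0\<^sub>v 1}" for l
  proof -
    have l0: "l $ 0 \<noteq> 0"
    proof
      assume "l $ 0 = 0"
      then have "l = 0\<^sub>v 1" using l by (intro eq_vecI) auto
      then show False using l by blast
    qed
    have "{g \<in> det_mats 1 D. transpose_mat g *\<^sub>v l = l} = {mat 1 1 (\<lambda>_. 1)}"
    proof (intro equalityI subsetI)
      fix g assume "g \<in> {g \<in> det_mats 1 D. transpose_mat g *\<^sub>v l = l}"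
      then obtain d where d: "g = mat 1 1 (\<lambda>_. d)" and gl: "transpose_mat g *\<^sub>v l = l"
        using det_mats_1 by blast
      have "dim_vec l = 1" using l by auto
      then have "d * l $ 0 = l $ 0" using arg_cong[OF gl, of "\<lambda>v. v $ 0"] by (simp add: d scalar_prod_def)
      then show "g \<in> {mat 1 1 (\<lambda>_. 1)}" using l0 d by simp
    next
      fix g assume "g \<in> {mat 1 1 (\<lambda>_. 1 :: 'a)}"
      then have g: "g = mat 1 1 (\<lambda>_. 1)" by simp
      have "transpose_mat g *\<^sub>v l = l" using l by (intro eq_vecI) (auto simp: g scalar_prod_def)
      then show "g \<in> {g \<in> det_mats 1 D. transpose_mat g *\<^sub>v l = l}" using D det_mats_1 g by blast
    qed
    moreover have "commuting_pairs {g} = {(g, g)}" for g :: "'a mat" by (auto simp: commuting_pairs_def)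
    ultimately show ?thesis by (simp add: f_def)
  qed
  have "(\<Sum>l\<in>carrier_vec 1. f l) = f (0\<^sub>v 1) + (\<Sum>l\<in>carrier_vec 1 - {0\<^sub>v 1}. f l)"
    by (rule sum.remove[OF finite_carrier_vec z])
  also have "(\<Sum>l\<in>carrier_vec 1 - {0\<^sub>v 1}. f l) = (\<Sum>l\<in>carrier_vec 1 - {0\<^sub>v 1 :: 'a vec}. 1)"
    using f1 by (intro sum.cong) auto
  also have "\<dots> = CARD('a) - 1" using card_Diff_singleton[OF z] card_carrier_vec[of 1, where 'a='a] by simp
  finally have "(\<Sum>l\<in>carrier_vec 1. f l) = card D * card D + (CARD('a) - 1)" unfolding f0 .
  moreover have "det_mats 1 D \<subseteq> carrier_mat 1 1" by (auto simp: det_mats_def)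
  ultimately show ?thesis using card_affine_commuting_pairs[of "det_mats 1 D" 1] unfolding f_def by simp
qed

section \<open>Characters and divisor chains\<close>

lemma sum_powers_root_of_unity:
  fixes z :: complex
  assumes "z ^ N = 1"
  shows "(\<Sum>i<N. z ^ i) = (if z = 1 then of_nat N else 0)"
  using assms by (simp add: sum_gp_strict)

lemma power_diff_eq_1:
  fixes g :: "'a::field"
  assumes "g \<noteq> 0" "g ^ i = g ^ j" "i \<le> j"
  shows "g ^ (j - i) = 1"
proof -
  have "g ^ i * g ^ (j - i) = g ^ j" using assms(3) by (simp flip: power_add)
  then have "g ^ j * g ^ (j - i) = g ^ j * 1" using assms(2) by simp
  then show ?thesis using assms(1) by simp
qed

text \<open>Let \<open>g\<close> generate the multiplicative group and let \<open>m\<close> be the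
  least positive exponent with \<open>g^m\<close> in \<open>D\<close>. Then \<open>D\<close>
  consists of the powers of \<open>g^m\<close>, and \<open>\<chi>\<close> sends \<open>g^i\<close>
  to \<open>\<zeta>^i\<close> for a primitive \<open>m\<close>-th root of unity
  \<open>\<zeta>\<close>. The last two clauses are the orthogonality relations: one detects
  \<open>D\<close>, the other kills the sums of nontrivial powers of \<open>\<chi>\<close> over the
  units.\<close>

lemma ex_character:
  fixes D :: "'a::{field,finite} set"
  assumes D: "unit_group D"
  shows "\<exists>m (\<chi> :: 'a \<Rightarrow> complex). 0 < m \<and> card D * m = CARD('a) - 1 \<and>
    (\<forall>x y. x \<noteq> 0 \<longrightarrow> y \<noteq> 0 \<longrightarrow> \<chi> (x * y) = \<chi> x * \<chi> y) \<and> \<chi> 1 = 1 \<and>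
    (\<forall>x. x \<noteq> 0 \<longrightarrow> (\<Sum>a<m. \<chi> x ^ a) = (if x \<in> D then of_nat m else 0)) \<and>
    (\<forall>k. (\<Sum>x\<in>UNIV - {0}. \<chi> x ^ k) = (if m dvd k then of_nat (CARD('a) - 1) else 0))"
proof -
  obtain g :: 'a where g0: "g \<noteq> 0" and gen: "\<And>x. x \<noteq> 0 \<Longrightarrow> \<exists>i. x = g ^ i"
    using ex_primitive_element by blast
  have "\<not> inj (\<lambda>i::nat. g ^ i)"
  proof
    assume "inj (\<lambda>i::nat. g ^ i)"
    then have "finite (UNIV :: nat set)" by (rule finite_imageD[rotated]) simp
    then show False by simp
  qed
  then obtain i j where ij: "i < j" "g ^ i = g ^ j" unfolding inj_def by (metis linorder_neqE_nat)
  have "g ^ (j - i) = 1" using power_diff_eq_1[OF g0 ij(2)] ij(1) by simp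
  then have ex: "\<exists>t. 0 < t \<and> g ^ t = 1" using ij by (intro exI[of _ "j - i"]) simp
  define N where "N = (LEAST t. 0 < t \<and> g ^ t = 1)"
  have N: "0 < N" "g ^ N = 1" using LeastI_ex[OF ex] by (simp_all add: N_def)
  have Nmin: "N \<le> t" if "0 < t" "g ^ t = 1" for t unfolding N_def using that by (intro Least_le) blast
  have bij: "bij_betw (\<lambda>i. g ^ i) {..<N} (UNIV - {0})"
  proof (rule bij_betw_imageI)
    show "inj_on (\<lambda>i. g ^ i) {..<N}"
    proof (rule linorder_inj_onI')
      fix i j assume ij: "i \<in> {..<N}" "j \<in> {..<N}" "i < j"
      show "g ^ i \<noteq> g ^ j"
      proof
        assume "g ^ i = g ^ j"
        then have "g ^ (j - i) = 1" using power_diff_eq_1[OF g0] ij(3) by simp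
        then show False using Nmin[of "j - i"] ij by simp
      qed
    qed
    show "(\<lambda>i. g ^ i) ` {..<N} = UNIV - {0}"
    proof (intro equalityI subsetI)
      fix x assume "x \<in> UNIV - {0 :: 'a}"
      then obtain i where i: "x = g ^ i" using gen by blast
      have "g ^ i = (g ^ N) ^ (i div N) * g ^ (i mod N)" by (simp flip: power_mult power_add)
      then have "x = g ^ (i mod N)" using i N by simp
      then show "x \<in> (\<lambda>i. g ^ i) ` {..<N}" using N by simp
    qed (use g0 in auto)
  qed
  have cN: "CARD('a) - 1 = N" using bij_betw_same_card[OF bij] by (simp add: card_Diff_singleton)
  have D1: "1 \<in> D" and D0: "0 \<notin> D" and Dm: "\<And>x y. x \<in> D \<Longrightarrow> y \<in> D \<Longrightarrow> x * y \<in> D"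
    and Di: "\<And>x. x \<in> D \<Longrightarrow> inverse x \<in> D"
    using D by (auto simp: unit_group_def)
  have exm: "\<exists>t. 0 < t \<and> g ^ t \<in> D" using N D1 by (intro exI[of _ N]) simp
  define m where "m = (LEAST t. 0 < t \<and> g ^ t \<in> D)"
  have m: "0 < m" "g ^ m \<in> D" using LeastI_ex[OF exm] by (simp_all add: m_def)
  have mmin: "m \<le> t" if "0 < t" "g ^ t \<in> D" for t unfolding m_def using that by (intro Least_le) blast
  have Dp: "x ^ k \<in> D" if "x \<in> D" for x k using that D1 Dm by (induction k) auto
  have gD: "g ^ i \<in> D \<longleftrightarrow> m dvd i" for i
  proof
    assume "m dvd i"
    then show "g ^ i \<in> D" using Dp[OF m(2)] by (auto simp: dvd_def power_mult)
  next
    assume gi: "g ^ i \<in> D"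
    have "g ^ i = (g ^ m) ^ (i div m) * g ^ (i mod m)" by (simp flip: power_mult power_add)
    then have "g ^ (i mod m) = inverse ((g ^ m) ^ (i div m)) * g ^ i" using g0 by simp
    then have "g ^ (i mod m) \<in> D" using Dm[OF Di[OF Dp[OF m(2)]] gi] by simp
    then have "i mod m = 0" using mmin[of "i mod m"] m(1) by (metis gr0I mod_less_divisor not_le)
    then show "m dvd i" by auto
  qed
  have mN: "m dvd N" using gD[of N] N D1 by simp
  then obtain e where e: "N = m * e" by blast
  have cD: "card D = e"
  proof -
    have "bij_betw (\<lambda>j. g ^ (m * j)) {..<e} D"
    proof (rule bij_betw_imageI)
      show "inj_on (\<lambda>j. g ^ (m * j)) {..<e}"
      proof (rule inj_onI)
        fix j k assume "j \<in> {..<e}" "k \<in> {..<e}" "g ^ (m * j) = g ^ (m * k)"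
        then have "m * j = m * k"
          by (intro inj_onD[OF bij_betw_imp_inj_on[OF bij]]) (use m(1) in \<open>auto simp: e\<close>)
        then show "j = k" using m by simp
      qed
      show "(\<lambda>j. g ^ (m * j)) ` {..<e} = D"
      proof (intro equalityI subsetI)
        fix x assume x: "x \<in> D"
        then have "x \<in> UNIV - {0}" using D0 by auto
        then obtain i where i: "i < N" "x = g ^ i" using bij unfolding bij_betw_def by blast
        then obtain j where j: "i = m * j" using gD[of i] x by (auto elim: dvdE)
        then have "j < e" using i(1) by (simp add: e)
        then show "x \<in> (\<lambda>j. g ^ (m * j)) ` {..<e}" using i(2) j by simp
      next
        fix x assume "x \<in> (\<lambda>j. g ^ (m * j)) ` {..<e}"
        then obtain j where "x = g ^ (m * j)" by blast
        then show "x \<in> D" using gD[of "m * j"] by simp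
      qed
    qed
    from bij_betw_same_card[OF this] show ?thesis by simp
  qed
  define \<zeta> where "\<zeta> = cis (2 * pi / of_nat m)"
  have \<zeta>m: "\<zeta> ^ m = 1" using m by (simp add: \<zeta>_def DeMoivre)
  have \<zeta>_eq_1: "\<zeta> ^ i = 1 \<longleftrightarrow> m dvd i" for i
  proof
    assume z: "\<zeta> ^ i = 1"
    have "\<zeta> ^ i = (\<zeta> ^ m) ^ (i div m) * \<zeta> ^ (i mod m)" by (simp flip: power_mult power_add)
    then have "\<zeta> ^ (i mod m) = 1" using z \<zeta>m by simp
    then have c: "cis (2 * pi * real (i mod m) / real m) = cis (2 * pi * real 0 / real m)"
      by (simp add: \<zeta>_def DeMoivre mult.commute)
    have "inj_on (\<lambda>k. cis (2 * pi * real k / real m)) {..<m}"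
      using bij_betw_roots_unity[OF m(1)] by (simp add: bij_betw_def)
    from inj_onD[OF this c] have "i mod m = 0" using m(1) by simp
    then show "m dvd i" by auto
  qed (use \<zeta>m in \<open>auto simp: dvd_def power_mult\<close>)
  \<comment> \<open>The chosen exponent is determined only modulo \<open>N\<close>, which is a
    multiple of \<open>m\<close>, so the value is well defined. At 0 it has no meaning, hence the
    nonzero conditions.\<close>
  define \<chi> where "\<chi> x = \<zeta> ^ (SOME i. x = g ^ i)" for x
  have \<zeta>_cong: "\<zeta> ^ i = \<zeta> ^ j" if "g ^ i = g ^ j" "i \<le> j" for i j
  proof -
    have "g ^ (j - i) \<in> D" using power_diff_eq_1[OF g0 that] D1 by simp
    then have "\<zeta> ^ (j - i) = 1" using gD \<zeta>_eq_1 by blast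
    then show ?thesis using that(2) using power_add[of \<zeta> i "j - i"] by simp
  qed
  have \<chi>g: "\<chi> (g ^ i) = \<zeta> ^ i" for i
  proof -
    define j where "j = (SOME j. g ^ i = g ^ j)"
    have "g ^ i = g ^ j" unfolding j_def by (rule someI[of _ i]) simp
    then have "\<zeta> ^ j = \<zeta> ^ i" using \<zeta>_cong[of i j] \<zeta>_cong[of j i] by (metis nat_le_linear)
    then show ?thesis by (simp add: \<chi>_def j_def)
  qed
  show ?thesis
  proof (intro exI conjI allI impI)
    show "0 < m" by (rule m(1))
    show "card D * m = CARD('a) - 1" unfolding cN cD e by simp
    show "\<chi> (x * y) = \<chi> x * \<chi> y" if "x \<noteq> 0" "y \<noteq> 0" for x y
      using gen[OF that(1)] gen[OF that(2)] \<chi>g by (metis power_add)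
    show "\<chi> 1 = 1" using \<chi>g[of 0] by simp
    show "(\<Sum>a<m. \<chi> x ^ a) = (if x \<in> D then of_nat m else 0)" if x: "x \<noteq> 0" for x
    proof -
      obtain i where i: "x = g ^ i" using gen[OF x] by blast
      have "(\<zeta> ^ i) ^ m = 1" using \<zeta>m by (metis mult.commute power_mult power_one)
      then show ?thesis unfolding i \<chi>g using sum_powers_root_of_unity[of "\<zeta> ^ i" m] \<zeta>_eq_1 gD by simp
    qed
    show "(\<Sum>x\<in>UNIV - {0}. \<chi> x ^ k) = (if m dvd k then of_nat (CARD('a) - 1) else 0)" for k
    proof -
      have "(\<Sum>x\<in>UNIV - {0}. \<chi> x ^ k) = (\<Sum>i<N. \<chi> (g ^ i) ^ k)"
        by (rule sum.reindex_bij_betw[OF bij, symmetric])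
      also have "\<dots> = (\<Sum>i<N. (\<zeta> ^ k) ^ i)" unfolding \<chi>g by (simp flip: power_mult add: mult.commute)
      also have "(\<zeta> ^ k) ^ N = 1" unfolding e using \<zeta>m by (metis mult.commute power_mult power_one)
      then have "(\<Sum>i<N. (\<zeta> ^ k) ^ i) = (if \<zeta> ^ k = 1 then of_nat N else 0)"
        by (rule sum_powers_root_of_unity)
      finally show ?thesis unfolding cN \<zeta>_eq_1 .
    qed
  qed
qed

section \<open>Monic polynomials with nonzero constant term and sums over chains\<close>

definition unit_monics :: "nat \<Rightarrow> 'a::field poly set" where
  "unit_monics d = {f. monic f \<and> coeff f 0 \<noteq> 0 \<and> degree f = d}"

lemma bij_betw_pCons_monics:
  "bij_betw (\<lambda>(x, f). pCons x f) (A \<times> {f :: 'a::field poly. monic f \<and> degree f = k})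
     {f. monic f \<and> degree f = Suc k \<and> coeff f 0 \<in> A}"
proof (rule bij_betw_imageI)
  show "inj_on (\<lambda>(x, f). pCons x f) (A \<times> {f :: 'a poly. monic f \<and> degree f = k})" by (auto simp: inj_on_def)
  show "(\<lambda>(x, f). pCons x f) ` (A \<times> {f :: 'a poly. monic f \<and> degree f = k})
    = {f. monic f \<and> degree f = Suc k \<and> coeff f 0 \<in> A}"
  proof (intro equalityI subsetI)
    fix f assume f: "f \<in> {f :: 'a poly. monic f \<and> degree f = Suc k \<and> coeff f 0 \<in> A}"
    obtain x h where h: "f = pCons x h" by (cases f)
    then have "h \<noteq> 0" using f by auto
    then have "(x, h) \<in> A \<times> {f. monic f \<and> degree f = k}" using f h by auto
    then show "f \<in> (\<lambda>(x, f). pCons x f) ` (A \<times> {f. monic f \<and> degree f = k})" using h by force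
  next
    fix f assume "f \<in> (\<lambda>(x, f). pCons x f) ` (A \<times> {f :: 'a poly. monic f \<and> degree f = k})"
    then obtain x h where h: "f = pCons x h" "x \<in> A" "monic h" "degree h = k" by auto
    then have "h \<noteq> 0" by auto
    then show "f \<in> {f. monic f \<and> degree f = Suc k \<and> coeff f 0 \<in> A}" using h by simp
  qed
qed

lemma monics_0: "{f :: 'a::field poly. monic f \<and> degree f = 0} = {1}"
proof (intro equalityI subsetI)
  fix f assume "f \<in> {f :: 'a poly. monic f \<and> degree f = 0}"
  then show "f \<in> {1}" by (auto elim!: degree_eq_zeroE)
qed simp

lemma card_monics:
  "finite {f :: 'a::{field,finite} poly. monic f \<and> degree f = k} \<and>
   card {f :: 'a poly. monic f \<and> degree f = k} = CARD('a) ^ k"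
proof (induction k)
  case 0
  show ?case unfolding monics_0 by simp
next
  case (Suc k)
  have "bij_betw (\<lambda>(x, f). pCons x f) (UNIV \<times> {f :: 'a poly. monic f \<and> degree f = k})
     {f. monic f \<and> degree f = Suc k}"
    using bij_betw_pCons_monics[of "UNIV :: 'a set" k] by simp
  from bij_betw_finite[OF this] bij_betw_same_card[OF this] show ?case
    using Suc by (simp add: card_cartesian_product)
qed

lemma finite_unit_monics: "finite (unit_monics d :: 'a::{field,finite} poly set)"
  by (rule finite_subset[OF _ conjunct1[OF card_monics[of d]]]) (auto simp: unit_monics_def)

text \<open>The constant term runs over the units independently of the \<open>k\<close> coefficients
  between it and the leading one.\<close>

lemma sum_unit_monics_Suc:
  fixes F :: "'a::{field,finite} \<Rightarrow> complex"
  shows "(\<Sum>f\<in>unit_monics (Suc k). F (coeff f 0)) = of_nat (CARD('a) ^ k) * (\<Sum>x\<in>UNIV - {0}. F x)"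
proof -
  define M where "M = {f :: 'a poly. monic f \<and> degree f = k}"
  have "unit_monics (Suc k) = {f. monic f \<and> degree f = Suc k \<and> coeff f 0 \<in> UNIV - {0 :: 'a}}"
    by (auto simp: unit_monics_def)
  then have bij: "bij_betw (\<lambda>(x, f). pCons x f) ((UNIV - {0}) \<times> M) (unit_monics (Suc k))"
    unfolding M_def using bij_betw_pCons_monics[of "UNIV - {0 :: 'a}" k] by simp
  have "(\<Sum>f\<in>unit_monics (Suc k). F (coeff f 0)) = (\<Sum>(x, f)\<in>(UNIV - {0}) \<times> M. F x)"
    using sum.reindex_bij_betw[OF bij, of "\<lambda>f. F (coeff f 0)"] by (simp add: split_def)
  also have "\<dots> = (\<Sum>x\<in>UNIV - {0}. \<Sum>f\<in>M. F x)" by (rule sum.cartesian_product[symmetric])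
  also have "\<dots> = of_nat (card M) * (\<Sum>x\<in>UNIV - {0}. F x)" by (simp add: sum_distrib_left)
  finally show ?thesis using card_monics[of k, where 'a='a] by (simp add: M_def)
qed

lemma chains_0: "divisor_chains 0 n = (if n = 0 then {[]} else {})"
  by (auto simp: divisor_chains_def)

text \<open>The last entry divides all others; dividing it out leaves a chain of length one less.\<close>

lemma bij_betw_chains_Suc:
  "bij_betw (\<lambda>(d, p, fs). map (times p) fs @ [p])
     (SIGMA d:{..n div Suc r}. unit_monics d \<times> divisor_chains r (n - Suc r * d)) (divisor_chains (Suc r) n :: 'a::field poly list set)"
proof (rule bij_betw_imageI)
  have nz: "p \<noteq> 0" if "p \<in> unit_monics d" for p :: "'a poly" and d using that by (auto simp: unit_monics_def)
  show "inj_on (\<lambda>(d, p, fs). map (times p) fs @ [p])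
     (SIGMA d:{..n div Suc r}. unit_monics d \<times> divisor_chains r (n - Suc r * d) :: (nat \<times> 'a poly \<times> 'a poly list) set)"
  proof (rule inj_onI)
    fix x y :: "nat \<times> 'a poly \<times> 'a poly list"
    assume x: "x \<in> (SIGMA d:{..n div Suc r}. unit_monics d \<times> divisor_chains r (n - Suc r * d))"
      and y: "y \<in> (SIGMA d:{..n div Suc r}. unit_monics d \<times> divisor_chains r (n - Suc r * d))"
      and eq: "(\<lambda>(d, p, fs). map (times p) fs @ [p]) x = (\<lambda>(d, p, fs). map (times p) fs @ [p]) y"
    obtain d p fs d' p' fs' where xy: "x = (d, p, fs)" "y = (d', p', fs')" by (metis prod.collapse)
    have *: "p \<in> unit_monics d" "p' \<in> unit_monics d'" using x y by (simp_all add: xy)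
    have eq': "map (times p) fs @ [p] = map (times p') fs' @ [p']" using eq by (simp only: xy prod.case)
    have pp: "p = p'" using eq' by simp
    have "map (times p) fs = map (times p') fs'" using eq' unfolding append1_eq_conv by (rule conjunct1)
    then have m: "map (times p) fs = map (times p) fs'" unfolding pp .
    have "inj (times p)" using nz[OF *(1)] by (auto simp: inj_def)
    then have "fs = fs'" using m by (simp add: inj_map_eq_map)
    moreover have "d = d'" using * pp by (simp add: unit_monics_def)
    ultimately show "x = y" using pp by (simp add: xy)
  qed
  show "(\<lambda>(d, p, fs). map (times p) fs @ [p]) ` (SIGMA d:{..n div Suc r}. unit_monics d \<times> divisor_chains r (n - Suc r * d))
    = (divisor_chains (Suc r) n :: 'a poly list set)"
  proof (intro equalityI subsetI)
    fix gs :: "'a poly list"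
    assume "gs \<in> (\<lambda>(d, p, fs). map (times p) fs @ [p]) ` (SIGMA d:{..n div Suc r}. unit_monics d \<times> divisor_chains r (n - Suc r * d))"
    then obtain d p fs where d: "d \<le> n div Suc r" and p: "p \<in> unit_monics d" and fs: "fs \<in> divisor_chains r (n - Suc r * d)"
      and gs: "gs = map (times p) fs @ [p]" by auto
    have le: "Suc r * d \<le> n" using d by (simp add: less_eq_div_iff_mult_less_eq mult.commute del: mult_Suc)
    have fnz: "f \<noteq> 0" if "f \<in> set fs" for f using fs that by (auto simp: divisor_chains_def)
    have "total_degree (map (times p) fs) = (\<Sum>f\<leftarrow>fs. d + degree f)"
      unfolding map_map
      by (intro arg_cong[of _ _ sum_list] map_cong refl)
        (use fnz nz[OF p] p in \<open>simp add: degree_mult_eq unit_monics_def\<close>)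
    also have "\<dots> = r * d + total_degree fs" using fs by (simp add: sum_list_addf sum_list_triv divisor_chains_def)
    finally have td: "total_degree gs = n" using fs le p by (simp add: gs divisor_chains_def unit_monics_def)
    have "sorted_wrt (\<lambda>f g. g dvd f) (map (times p) fs)"
      using fs by (auto simp: divisor_chains_def sorted_wrt_map intro: sorted_wrt_mono_rel[rotated])
    then have "sorted_wrt (\<lambda>f g. g dvd f) gs" by (auto simp: gs sorted_wrt_append)
    moreover have "\<forall>f\<in>set gs. monic f \<and> coeff f 0 \<noteq> 0"
      using fs p by (auto simp: gs divisor_chains_def unit_monics_def lead_coeff_mult coeff_mult_0)
    moreover have "length gs = Suc r" using fs by (simp add: gs divisor_chains_def)
    ultimately show "gs \<in> divisor_chains (Suc r) n" using td by (simp add: divisor_chains_def)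
  next
    fix gs :: "'a poly list"
    assume gs: "gs \<in> divisor_chains (Suc r) n"
    then have "gs \<noteq> []" by (auto simp: divisor_chains_def)
    then obtain hs p where hp: "gs = hs @ [p]" by (metis append_butlast_last_id)
    have p: "monic p" "coeff p 0 \<noteq> 0" using gs by (auto simp: hp divisor_chains_def)
    have hs: "length hs = r" "\<And>h. h \<in> set hs \<Longrightarrow> p dvd h \<and> monic h \<and> coeff h 0 \<noteq> 0"
      "sorted_wrt (\<lambda>f g. g dvd f) hs" "total_degree hs + degree p = n"
      using gs by (auto simp: hp divisor_chains_def sorted_wrt_append)
    have p0: "p \<noteq> 0" using p by auto
    define fs where "fs = map (\<lambda>h. h div p) hs"
    have hd: "p * (h div p) = h" if "h \<in> set hs" for h using hs(2)[OF that] by simp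
    have mapfs: "map (times p) fs = hs" using hd by (simp add: fs_def o_def map_idI)
    have f: "monic f \<and> coeff f 0 \<noteq> 0" if fin: "f \<in> set fs" for f
    proof -
      have "p * f \<in> set hs" using fin mapfs by (metis image_eqI list.set_map)
      then have "monic (p * f)" "coeff (p * f) 0 \<noteq> 0" using hs(2) by blast+
      then show ?thesis using p by (simp add: lead_coeff_mult coeff_mult_0)
    qed
    have fnz: "f \<noteq> 0" if "f \<in> set fs" for f using f[OF that] by auto
    have lf: "length fs = r" using hs by (simp add: fs_def)
    have "total_degree hs = (\<Sum>f\<leftarrow>fs. degree p + degree f)"
      unfolding mapfs[symmetric] map_map
      by (intro arg_cong[of _ _ sum_list] map_cong refl) (use fnz p0 in \<open>simp add: degree_mult_eq\<close>)
    also have "\<dots> = r * degree p + total_degree fs" using lf by (simp add: sum_list_addf sum_list_triv)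
    finally have td: "n = Suc r * degree p + total_degree fs" using hs(4) by simp
    have "sorted_wrt (\<lambda>f g. p * g dvd p * f) fs" using hs(3) unfolding mapfs[symmetric] sorted_wrt_map .
    then have "sorted_wrt (\<lambda>f g. g dvd f) fs" using p0 by (simp add: dvd_mult_cancel_left)
    then have "fs \<in> divisor_chains r (n - Suc r * degree p)" using lf f td by (simp add: divisor_chains_def)
    moreover have "degree p \<le> n div Suc r"
      using td by (simp add: less_eq_div_iff_mult_less_eq mult.commute del: mult_Suc)
    moreover have "p \<in> unit_monics (degree p)" using p by (simp add: unit_monics_def)
    ultimately have "(degree p, p, fs) \<in> (SIGMA d:{..n div Suc r}. unit_monics d \<times> divisor_chains r (n - Suc r * d))" by simp
    then show "gs \<in> (\<lambda>(d, p, fs). map (times p) fs @ [p]) ` (SIGMA d:{..n div Suc r}. unit_monics d \<times> divisor_chains r (n - Suc r * d))"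
      by (rule rev_image_eqI) (simp add: hp mapfs)
  qed
qed

lemma finite_chains_all: "finite (divisor_chains r n :: 'a::{field,finite} poly list set)"
proof (induction r arbitrary: n)
  case (Suc r)
  have "finite (SIGMA d:{..n div Suc r}. unit_monics d \<times> divisor_chains r (n - Suc r * d) :: (nat \<times> 'a poly \<times> 'a poly list) set)"
    using Suc finite_unit_monics by auto
  then show ?case using bij_betw_finite[OF bij_betw_chains_Suc] by blast
qed (simp add: chains_0)

text \<open>Dividing the last entry out of the chain extracts its weight \<open>Suc r\<close> times.
  This is the recursion of \<open>chain_count\<close> with weights.\<close>

lemma sum_chains_Suc:
  fixes w :: "'a::{field,finite} poly \<Rightarrow> complex"
  assumes w: "\<And>f g. monic f \<Longrightarrow> coeff f 0 \<noteq> 0 \<Longrightarrow> monic g \<Longrightarrow> coeff g 0 \<noteq> 0 \<Longrightarrow> w (f * g) = w f * w g"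
  shows "(\<Sum>fs\<in>divisor_chains (Suc r) n. \<Prod>f\<leftarrow>fs. w f)
    = (\<Sum>d\<le>n div Suc r. (\<Sum>p\<in>unit_monics d. w p ^ Suc r) * (\<Sum>fs\<in>divisor_chains r (n - Suc r * d). \<Prod>f\<leftarrow>fs. w f))"
proof -
  have prod: "(\<Prod>f\<leftarrow>map (times p) fs @ [p]. w f) = w p ^ Suc r * (\<Prod>f\<leftarrow>fs. w f)"
    if p: "p \<in> unit_monics d" and fs: "fs \<in> divisor_chains r k" for p d fs k
  proof -
    have "(\<Prod>f\<leftarrow>fs. w (p * f)) = w p ^ length fs * (\<Prod>f\<leftarrow>fs. w f)"
      if "\<forall>f\<in>set fs. monic f \<and> coeff f 0 \<noteq> 0" for fs
      using that by (induction fs) (use p w[of p] in \<open>auto simp: unit_monics_def\<close>)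
    then show ?thesis using fs by (simp add: divisor_chains_def o_def)
  qed
  have "(\<Sum>fs\<in>divisor_chains (Suc r) n. \<Prod>f\<leftarrow>fs. w f)
     = (\<Sum>x\<in>(SIGMA d:{..n div Suc r}. unit_monics d \<times> divisor_chains r (n - Suc r * d)).
          \<Prod>f\<leftarrow>(\<lambda>(d, p, fs). map (times p) fs @ [p]) x. w f)"
    by (rule sum.reindex_bij_betw[OF bij_betw_chains_Suc, symmetric])
  also have "\<dots> = (\<Sum>x\<in>(SIGMA d:{..n div Suc r}. unit_monics d \<times> divisor_chains r (n - Suc r * d)).
          (\<lambda>(d, p, fs). w p ^ Suc r * (\<Prod>f\<leftarrow>fs. w f)) x)"
    by (rule sum.cong[OF refl]) (use prod in auto)
  also have "\<dots> = (\<Sum>d\<le>n div Suc r. \<Sum>y\<in>unit_monics d \<times> divisor_chains r (n - Suc r * d).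
          (\<lambda>(p, fs). w p ^ Suc r * (\<Prod>f\<leftarrow>fs. w f)) y)"
    by (rule sum.Sigma[symmetric]) (use finite_unit_monics finite_chains_all in auto)
  also have "\<dots> = (\<Sum>d\<le>n div Suc r. (\<Sum>p\<in>unit_monics d. w p ^ Suc r) * (\<Sum>fs\<in>divisor_chains r (n - Suc r * d). \<Prod>f\<leftarrow>fs. w f))"
    by (simp only: sum_product sum.cartesian_product)
  finally show ?thesis .
qed

text \<open>For monic \<open>f\<close>, the determinant of its companion matrix. Being
  multiplicative, it turns a character of the determinant into a multiplicative weight on
  chains.\<close>

definition signed_const :: "'a::field poly \<Rightarrow> 'a" where
  "signed_const f = (-1) ^ degree f * coeff f 0"

lemma signed_const_nonzero: "coeff f 0 \<noteq> 0 \<Longrightarrow> signed_const f \<noteq> 0"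
  by (simp add: signed_const_def)

lemma signed_const_mult:
  "f \<noteq> 0 \<Longrightarrow> g \<noteq> 0 \<Longrightarrow> signed_const (f * g) = signed_const f * signed_const g"
  by (simp add: signed_const_def degree_mult_eq coeff_mult_0 power_add)

lemma sum_scale_nonzero:
  fixes F :: "'a::{field,finite} \<Rightarrow> complex"
  assumes "c \<noteq> 0"
  shows "(\<Sum>x\<in>UNIV - {0}. F (c * x)) = (\<Sum>x\<in>UNIV - {0}. F x)"
proof (rule sum.reindex_bij_betw)
  show "bij_betw (times c) (UNIV - {0}) (UNIV - {0})"
    by (rule bij_betw_byWitness[where f' = "\<lambda>x. inverse c * x"]) (use assms in \<open>auto simp: mult.assoc[symmetric]\<close>)
qed

text \<open>In other words, the \<open>a\<close>-th power of a character of order \<open>m\<close>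
  has order \<open>m div gcd a m\<close>, which is 1 for \<open>a = 0\<close>.\<close>

lemma div_gcd_dvd_iff:
  fixes m a j :: nat
  assumes "0 < m"
  shows "m dvd a * j \<longleftrightarrow> m div gcd a m dvd j"
proof -
  define g where "g = gcd a m"
  have g: "0 < g" using assms by (simp add: g_def)
  obtain a' m' where a: "a = g * a'" and m: "m = g * m'" unfolding g_def by (meson dvd_def gcd_dvd1 gcd_dvd2)
  have "a' = a div g" and m': "m' = m div g" using a m g by simp_all
  then have "coprime a' m'" unfolding g_def using div_gcd_coprime[of a m] assms by simp
  then have "m' dvd a' * j \<longleftrightarrow> m' dvd j" by (simp add: coprime_commute coprime_dvd_mult_right_iff)
  moreover have "m dvd a * j \<longleftrightarrow> m' dvd a' * j" using g by (simp add: a m mult.assoc)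
  ultimately show ?thesis using m' unfolding g_def by simp
qed

text \<open>By orthogonality the \<open>k\<close>-th factor of the generating function keeps only
  its constant term 1 unless \<open>s\<close> divides \<open>k\<close>. The surviving factors, those
  with \<open>k = s j\<close>, form the generating function of \<open>chain_count\<close> in the
  variable \<open>t^s\<close>, which explains both divisions by \<open>s\<close>. For
  \<open>a = 0\<close> all chains are counted.\<close>

lemma sum_chains_character:
  fixes \<chi> :: "'a::{field,finite} \<Rightarrow> complex"
  assumes m: "0 < m"
    and \<chi>mult: "\<And>x y. x \<noteq> 0 \<Longrightarrow> y \<noteq> 0 \<Longrightarrow> \<chi> (x * y) = \<chi> x * \<chi> y" and \<chi>1: "\<chi> 1 = 1"
    and \<chi>sum: "\<And>k. (\<Sum>x\<in>UNIV - {0}. \<chi> x ^ k) = (if m dvd k then of_nat (CARD('a) - 1) else 0)"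
    and s: "s = m div gcd a m"
  shows "(\<Sum>fs\<in>divisor_chains r n. \<Prod>f\<leftarrow>fs. \<chi> (signed_const f) ^ a)
    = (if s dvd n then of_real (chain_count (real CARD('a)) (r div s) (n div s)) else 0)"
proof (induction r arbitrary: n)
  case 0
  have s0: "0 < s" using m by (simp add: s div_greater_zero_iff gcd_le2_nat)
  show ?case using s0 by (auto simp: chains_0 dvd_def)
next
  case (Suc r)
  define q where "q = real CARD('a)"
  have s0: "0 < s" using m by (simp add: s div_greater_zero_iff gcd_le2_nat)
  define w where "w f = \<chi> (signed_const f) ^ a" for f :: "'a poly"
  have w: "w (f * g) = w f * w g" if "monic f" "coeff f 0 \<noteq> 0" "monic g" "coeff g 0 \<noteq> 0" for f g
  proof -
    have "f \<noteq> 0" "g \<noteq> 0" using that by auto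
    then show ?thesis
      using \<chi>mult[OF signed_const_nonzero[OF that(2)] signed_const_nonzero[OF that(4)]]
      by (simp add: w_def signed_const_mult power_mult_distrib)
  qed
  have w0: "(\<Sum>p\<in>unit_monics 0. w p ^ Suc r) = 1"
  proof -
    have "unit_monics 0 = {1 :: 'a poly}" using monics_0 by (auto simp: unit_monics_def)
    then show ?thesis by (simp add: w_def signed_const_def \<chi>1)
  qed
  have wS: "(\<Sum>p\<in>unit_monics d. w p ^ Suc r) = (if s dvd Suc r then of_real ((q - 1) * q ^ (d - 1)) else 0)"
    if d: "1 \<le> d" for d
  proof -
    obtain k where k: "d = Suc k" using d by (cases d) auto
    have "(\<Sum>p\<in>unit_monics d. w p ^ Suc r)
        = (\<Sum>p\<in>unit_monics (Suc k). (\<lambda>x. \<chi> ((-1) ^ d * x) ^ (a * Suc r)) (coeff p 0))"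
      unfolding k by (rule sum.cong[OF refl]) (simp add: w_def signed_const_def unit_monics_def power_mult del: power_Suc mult_Suc_right)
    also have "\<dots> = of_nat (CARD('a) ^ k) * (\<Sum>x\<in>UNIV - {0}. \<chi> ((-1) ^ d * x) ^ (a * Suc r))"
      by (rule sum_unit_monics_Suc)
    \<comment> \<open>The sign only permutes the units.\<close>
    also have "(\<Sum>x\<in>UNIV - {0}. \<chi> ((-1) ^ d * x) ^ (a * Suc r)) = (\<Sum>x\<in>UNIV - {0}. \<chi> x ^ (a * Suc r))"
      by (rule sum_scale_nonzero) simp
    also have "\<dots> = (if s dvd Suc r then of_nat (CARD('a) - 1) else 0)"
      unfolding \<chi>sum div_gcd_dvd_iff[OF m] s ..
    finally show ?thesis by (simp add: k q_def of_nat_diff)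
  qed
  define T where "T r n = (\<Sum>fs\<in>divisor_chains r n. \<Prod>f\<leftarrow>fs. w f)" for r n
  have IH: "T r k = (if s dvd k then of_real (chain_count q (r div s) (k div s)) else 0)" for k
    unfolding T_def w_def q_def by (rule Suc.IH)
  have "T (Suc r) n = (\<Sum>d\<le>n div Suc r. (\<Sum>p\<in>unit_monics d. w p ^ Suc r) * T r (n - Suc r * d))"
    unfolding T_def by (rule sum_chains_Suc) (rule w)
  also have "{..n div Suc r} = insert 0 {1..n div Suc r}" by auto
  also have "(\<Sum>d\<in>insert 0 {1..n div Suc r}. (\<Sum>p\<in>unit_monics d. w p ^ Suc r) * T r (n - Suc r * d))
      = T r n + (\<Sum>d=1..n div Suc r. (\<Sum>p\<in>unit_monics d. w p ^ Suc r) * T r (n - Suc r * d))"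
    by (subst sum.insert) (simp_all add: w0 del: power_Suc)
  also have "(\<Sum>d=1..n div Suc r. (\<Sum>p\<in>unit_monics d. w p ^ Suc r) * T r (n - Suc r * d))
      = (\<Sum>d=1..n div Suc r. (if s dvd Suc r then of_real ((q - 1) * q ^ (d - 1)) else 0) * T r (n - Suc r * d))"
    using wS by (intro sum.cong) auto
  finally have TS: "T (Suc r) n = T r n + \<dots>" .
  have "T (Suc r) n = (if s dvd n then of_real (chain_count q (Suc r div s) (n div s)) else 0)"
  proof (cases "s dvd Suc r")
    \<comment> \<open>Last entries of positive degree cancel out, and \<open>r div s\<close> does
      not change either.\<close>
    case False
    then have "Suc r div s = r div s" by (simp add: div_Suc mod_eq_0_iff_dvd)
    then show ?thesis unfolding TS using False IH by simp
  next
    case True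
    then obtain t where t: "Suc r = s * t" by blast
    then have "t \<noteq> 0" by (metis mult_is_0 nat.simps(3))
    then obtain t' where t': "t = Suc t'" by (cases t) auto
    have St: "Suc r div s = Suc t'" using t t' s0 by simp
    have rt: "r div s = t'" using True St by (simp add: div_Suc mod_eq_0_iff_dvd split: if_splits)
    show ?thesis
    proof (cases "s dvd n")
      case False
      have "\<not> s dvd n - Suc r * d" if "d \<in> {1..n div Suc r}" for d
      proof -
        have le: "Suc r * d \<le> n" using that by (simp add: less_eq_div_iff_mult_less_eq mult.commute del: mult_Suc)
        show ?thesis
        proof
          assume "s dvd n - Suc r * d"
          moreover have "s dvd Suc r * d" using True by (rule dvd_mult2)
          ultimately have "s dvd (n - Suc r * d) + Suc r * d" by (rule dvd_add)
          then show False using False le by simp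
        qed
      qed
      then have "(\<Sum>d=1..n div Suc r. (if s dvd Suc r then of_real ((q - 1) * q ^ (d - 1)) else 0) * T r (n - Suc r * d)) = 0"
        unfolding IH by (intro sum.neutral) auto
      then show ?thesis unfolding TS using False IH by simp
    next
      case sn: True
      then obtain k where k: "n = s * k" by blast
      have nd: "n div Suc r = k div Suc t'" unfolding t t' k using s0 by (simp del: mult_Suc mult_Suc_right)
      have sub: "n - Suc r * d = s * (k - Suc t' * d)" for d
        unfolding t t' k by (simp add: right_diff_distrib' mult.assoc del: mult_Suc mult_Suc_right)
      have "(\<Sum>d=1..n div Suc r. (if s dvd Suc r then of_real ((q - 1) * q ^ (d - 1)) else 0) * T r (n - Suc r * d))
        = (\<Sum>d=1..k div Suc t'. complex_of_real ((q - 1) * q ^ (d - 1) * chain_count q t' (k - Suc t' * d)))"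
        unfolding nd
        by (rule sum.cong[OF refl]) (use True s0 in \<open>simp add: sub IH rt del: mult_Suc mult_Suc_right of_real_power\<close>)
      also have "\<dots> = of_real (\<Sum>d=1..k div Suc t'. (q - 1) * q ^ (d - 1) * chain_count q t' (k - Suc t' * d))"
        by (rule of_real_sum[symmetric])
      finally show ?thesis unfolding TS IH using sn s0 k St rt by simp
    qed
  qed
  then show ?case unfolding T_def w_def q_def .
qed

section \<open>Commuting pairs with prescribed determinants\<close>

lemma sum_commuting_pairs_shift:
  fixes F :: "'a::{field,finite} mat \<Rightarrow> 'a mat \<Rightarrow> complex"
  shows "(\<Sum>(g, h)\<in>commuting_pairs (carrier (GL n)). F g (g * h)) = (\<Sum>(g, h)\<in>commuting_pairs (carrier (GL n)). F g h)"
proof -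
  interpret G: group "GL n :: 'a mat monoid" by (rule group_GL)
  note Gs = G.m_closed[unfolded mult_GL] G.m_assoc[unfolded mult_GL]
  have "bij_betw (\<lambda>(g, h). (g, g * h)) (commuting_pairs (carrier (GL n))) (commuting_pairs (carrier (GL n :: 'a mat monoid)))"
  proof (rule bij_betw_byWitness[where f' = "\<lambda>(g, h). (g, inv\<^bsub>GL n\<^esub> g * h)"])
    have i1: "inv\<^bsub>GL n\<^esub> g * (g * h) = h" "g * (inv\<^bsub>GL n\<^esub> g * h) = h"
      if "g \<in> carrier (GL n)" "h \<in> carrier (GL n)" for g h :: "'a mat"
      using G.inv_solve_left[of h g "g * h"] G.inv_solve_left[of "inv\<^bsub>GL n\<^esub> g * h" g h] that Gs(1) by auto
    have mem: "g \<in> carrier (GL n)" "h \<in> carrier (GL n)"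
      if "(g, h) \<in> commuting_pairs (carrier (GL n))" for g h :: "'a mat"
      using that by (simp_all add: commuting_pairs_def)
    have i2: "inv\<^bsub>GL n\<^esub> g * (g * h) = h" "g * (inv\<^bsub>GL n\<^esub> g * h) = h"
      if "(g, h) \<in> commuting_pairs (carrier (GL n))" for g h :: "'a mat"
      using i1[OF mem[OF that]] .
    show "\<forall>x\<in>commuting_pairs (carrier (GL n :: 'a mat monoid)). (\<lambda>(g, h). (g, inv\<^bsub>GL n\<^esub> g * h)) ((\<lambda>(g, h). (g, g * h)) x) = x"
      using i2(1) by auto
    show "\<forall>x\<in>commuting_pairs (carrier (GL n :: 'a mat monoid)). (\<lambda>(g, h). (g, g * h)) ((\<lambda>(g, h). (g, inv\<^bsub>GL n\<^esub> g * h)) x) = x"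
      using i2(2) by auto
    show "(\<lambda>(g, h). (g, g * h)) ` commuting_pairs (carrier (GL n)) \<subseteq> commuting_pairs (carrier (GL n :: 'a mat monoid))"
    proof clarify
      fix g h :: "'a mat" assume gh: "(g, h) \<in> commuting_pairs (carrier (GL n))"
      then have "g * h = h * g" by (simp add: commuting_pairs_def)
      then have "g * (g * h) = g * h * g" using Gs(2)[OF mem(1)[OF gh] mem(2)[OF gh] mem(1)[OF gh]] by simp
      then show "(g, g * h) \<in> commuting_pairs (carrier (GL n))"
        using Gs(1)[OF mem[OF gh]] mem(1)[OF gh] by (simp add: commuting_pairs_def)
    qed
    show "(\<lambda>(g, h). (g, inv\<^bsub>GL n\<^esub> g * h)) ` commuting_pairs (carrier (GL n)) \<subseteq> commuting_pairs (carrier (GL n :: 'a mat monoid))"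
    proof clarify
      fix g h :: "'a mat" assume "(g, h) \<in> commuting_pairs (carrier (GL n))"
      then have gh: "g \<in> carrier (GL n)" "h \<in> carrier (GL n)" "g * h = h * g" by (auto simp: commuting_pairs_def)
      have "g * (inv\<^bsub>GL n\<^esub> g * h) = inv\<^bsub>GL n\<^esub> g * h * g"
        using gh i1[OF gh(1,2)] Gs by simp
      then show "(g, inv\<^bsub>GL n\<^esub> g * h) \<in> commuting_pairs (carrier (GL n))"
        using gh Gs(1) by (simp add: commuting_pairs_def)
    qed
  qed
  from sum.reindex_bij_betw[OF this, of "\<lambda>(g, h). F g h"] show ?thesis by (simp add: split_def)
qed

lemma sum_commuting_pairs_swap:
  "(\<Sum>(g, h)\<in>commuting_pairs S. F h g) = (\<Sum>(g, h)\<in>commuting_pairs S. F g h)"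
proof -
  have "bij_betw prod.swap (commuting_pairs S) (commuting_pairs S)"
    by (rule bij_betw_byWitness[where f' = prod.swap]) (auto simp: commuting_pairs_def)
  from sum.reindex_bij_betw[OF this, of "\<lambda>(g, h). F g h"] show ?thesis by (simp add: split_def)
qed

text \<open>Commuting pairs are permuted by the unimodular substitutions, so the double character sum depends on
  the gcd of the two exponents only.\<close>

lemma double_character_sum:
  fixes \<chi> :: "'a::{field,finite} \<Rightarrow> complex"
  assumes \<chi>mult: "\<And>x y. x \<noteq> 0 \<Longrightarrow> y \<noteq> 0 \<Longrightarrow> \<chi> (x * y) = \<chi> x * \<chi> y"
  shows "(\<Sum>(g, h)\<in>commuting_pairs (carrier (GL n)). \<chi> (det g) ^ a * \<chi> (det h) ^ b)
    = (\<Sum>(g, h)\<in>commuting_pairs (carrier (GL n)). \<chi> (det g) ^ gcd a b)"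
proof -
  define W where "W a b = (\<Sum>(g, h)\<in>commuting_pairs (carrier (GL n)). \<chi> (det g) ^ a * \<chi> (det h) ^ b)" for a b
  have swap: "W a b = W b a" for a b
    unfolding W_def using sum_commuting_pairs_swap[of "\<lambda>g h. \<chi> (det g) ^ a * \<chi> (det h) ^ b" "carrier (GL n)"]
    by (simp add: split_def mult.commute)
  have shift: "W (a + b) b = W a b" for a b
  proof -
    have "W a b = (\<Sum>(g, h)\<in>commuting_pairs (carrier (GL n)). \<chi> (det g) ^ a * \<chi> (det (g * h)) ^ b)"
      unfolding W_def by (rule sum_commuting_pairs_shift[symmetric])
    also have "\<dots> = W (a + b) b" unfolding W_def
    proof (rule sum.cong[OF refl], clarify)
      fix g h :: "'a mat" assume "(g, h) \<in> commuting_pairs (carrier (GL n))"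
      then have c: "g \<in> carrier_mat n n" "h \<in> carrier_mat n n" "det g \<noteq> 0" "det h \<noteq> 0"
        by (auto simp: commuting_pairs_def carrier_GL)
      then show "\<chi> (det g) ^ a * \<chi> (det (g * h)) ^ b = \<chi> (det g) ^ (a + b) * \<chi> (det h) ^ b"
        using det_mult[OF c(1,2)] by (simp add: \<chi>mult power_mult_distrib power_add mult.assoc)
    qed
    finally show ?thesis by simp
  qed
  have shifts: "W (a + k * b) b = W a b" for a b k
    by (induction k) (simp_all add: shift[of "a + _ * b" b, symmetric] add.assoc add.commute[of b] add.left_commute)
  \<comment> \<open>The Euclidean algorithm: \<open>shifts\<close> is the division step and
    \<open>swap\<close> the exchange.\<close>
  have "W a b = W (gcd a b) 0"
  proof (induction a b rule: gcd_nat_induct)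
    case (step a b)
    have "W a b = W (a mod b) b" using shifts[of "a mod b" "a div b" b] by simp
    also have "\<dots> = W (gcd b (a mod b)) 0" using swap step by simp
    also have "gcd b (a mod b) = gcd a b" by (metis gcd_red_nat)
    finally show ?case .
  qed simp
  then show ?thesis by (simp add: W_def)
qed

text \<open>Scaling the first row is injective and multiplies the determinant. Used with a scalar
  and with its inverse, it shows that all nonzero determinants are equally frequent.\<close>

lemma card_det_fibre_le:
  fixes x y :: "'a::{field,finite}"
  assumes n: "1 \<le> n" and x: "x \<noteq> 0"
  shows "card {A \<in> carrier_mat n n. det A = y} \<le> card {A \<in> carrier_mat n n. det A = x * y}"
proof (rule card_inj_on_le[where f = "multrow 0 x"])
  show "inj_on (multrow 0 x) {A \<in> carrier_mat n n. det A = y}"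
  proof (rule inj_onI)
    fix A B assume A: "A \<in> {A \<in> carrier_mat n n. det A = y}" and B: "B \<in> {A \<in> carrier_mat n n. det A = y}"
      and eq: "multrow 0 x A = multrow 0 x B"
    show "A = B"
    proof (rule eq_matI)
      fix i j assume "i < dim_row B" "j < dim_col B"
      then have ij: "i < n" "j < n" using B by auto
      show "A $$ (i, j) = B $$ (i, j)"
        using arg_cong[OF eq, of "\<lambda>M. M $$ (i, j)"] ij A B x by (auto split: if_splits)
    qed (use A B in auto)
  qed
  show "multrow 0 x ` {A \<in> carrier_mat n n. det A = y} \<subseteq> {A \<in> carrier_mat n n. det A = x * y}"
    using det_multrow[of 0 n _ x] n by auto
  show "finite {A \<in> carrier_mat n n. det A = x * y}" by (rule finite_subset[OF _ finite_carrier_mat[of n n]]) blast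
qed

lemma card_det_mats:
  fixes D :: "'a::{field,finite} set"
  assumes n: "1 \<le> n" and D: "0 \<notin> D"
  shows "card (det_mats n D) = card D * card {A :: 'a mat. A \<in> carrier_mat n n \<and> det A = 1}"
proof -
  define c where "c y = card {A :: 'a mat. A \<in> carrier_mat n n \<and> det A = y}" for y
  have c: "c y = c 1" if "y \<noteq> 0" for y
    using card_det_fibre_le[OF n that, of 1] card_det_fibre_le[OF n, of "inverse y" y] that by (simp add: c_def)
  have "card (det_mats n D) = (\<Sum>A\<in>det_mats n D. 1)" by simp
  also have "\<dots> = (\<Sum>y\<in>D. \<Sum>A\<in>{A \<in> det_mats n D. det A = y}. 1)"
    by (rule sum.group[symmetric]) (auto simp: det_mats_def)
  also have "\<dots> = (\<Sum>y\<in>D. c 1)"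
  proof (rule sum.cong[OF refl])
    fix y assume y: "y \<in> D"
    then have "{A \<in> det_mats n D. det A = y} = {A. A \<in> carrier_mat n n \<and> det A = y}" by (auto simp: det_mats_def)
    moreover have "y \<noteq> 0" using y D by auto
    ultimately show "(\<Sum>A\<in>{A \<in> det_mats n D. det A = y}. 1) = c 1" using c[of y] by (simp add: c_def)
  qed
  finally show ?thesis by (simp add: c_def)
qed

text \<open>The sum of a character of order \<open>s\<close> of the determinant over the conjugacy classes of \<open>GL(n, q)\<close>.\<close>

definition twisted_count :: "real \<Rightarrow> nat \<Rightarrow> nat \<Rightarrow> real" where
  "twisted_count q n s = (if s dvd n then chain_count q (n div s) (n div s) else 0)"

text \<open>On the units, \<open>1/m\<close> times the sum of the powers of \<open>\<chi>\<close> is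
  the indicator of \<open>D\<close>; it is inserted for both members of a pair. Each term then
  involves one character, of order \<open>m div gcd (gcd a b) m\<close>. Since
  \<open>GL(n, q)\<close> has order \<open>m\<close> times that of the subgroup, one factor
  \<open>m\<close> cancels, and the double sum is \<open>m\<close> times the class number of the
  subgroup.\<close>

lemma card_commuting_pairs_det_mats:
  fixes D :: "'a::{field,finite} set"
  assumes D: "unit_group D" and n: "1 \<le> n" and m: "card D * m = CARD('a) - 1"
  shows "real m * card (commuting_pairs (det_mats n D))
    = card (det_mats n D) * (\<Sum>a<m. \<Sum>b<m. twisted_count (real CARD('a)) n (m div gcd (gcd a b) m))"
proof -
  obtain m' \<chi> where m': "0 < m'" "card D * m' = CARD('a) - 1"
    and \<chi>mult: "\<And>x y. x \<noteq> 0 \<Longrightarrow> y \<noteq> 0 \<Longrightarrow> \<chi> (x * y) = \<chi> x * \<chi> y" and \<chi>1: "\<chi> 1 = 1"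
    and \<chi>D: "\<And>x. x \<noteq> 0 \<Longrightarrow> (\<Sum>a<m'. \<chi> x ^ a) = (if x \<in> D then complex_of_nat m' else 0)"
    and \<chi>sum: "\<And>k. (\<Sum>x\<in>UNIV - {0}. \<chi> x ^ k) = (if m' dvd k then of_nat (CARD('a) - 1) else 0)"
    using ex_character[OF D] by blast
  have D0: "0 \<notin> D" and D1: "1 \<in> D" using D by (auto simp: unit_group_def)
  have "0 < card D" using D1 by (auto simp: card_gt_0_iff)
  then have mm: "m' = m" using m m'(2) by (metis mult_cancel1 not_gr0)
  note \<chi>D = \<chi>D[unfolded mm] and \<chi>sum = \<chi>sum[unfolded mm] and m0 = m'(1)[unfolded mm]
  define CP where "CP = commuting_pairs (carrier (GL n :: 'a mat monoid))"
  define G where "G = card (carrier (GL n :: 'a mat monoid))"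
  define tc where "tc s = twisted_count (real CARD('a)) n s" for s
  have single: "(\<Sum>(g, h)\<in>CP. \<chi> (det g) ^ c) = complex_of_nat G * of_real (tc (m div gcd c m))" for c
  proof -
    have "(\<Sum>(g, h)\<in>CP. \<chi> (det g) ^ c)
       = (\<Sum>g\<in>carrier (GL n). \<Sum>h\<in>{h \<in> carrier (GL n). g * h = h * g}. \<chi> (det g) ^ c)"
    proof -
      have "CP = (SIGMA g:carrier (GL n). {h \<in> carrier (GL n). g * h = h * g})"
        by (auto simp: CP_def commuting_pairs_def)
      then show ?thesis by (simp only:) (rule sum.Sigma[symmetric], simp_all)
    qed
    also have "\<dots> = (\<Sum>g\<in>carrier (GL n). of_nat (card {h \<in> carrier (GL n). g * h = h * g}) * \<chi> (det g) ^ c)" by simp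
    also have "\<dots> = complex_of_nat G * (\<Sum>fs\<in>divisor_chains n n. \<chi> (det (companions fs)) ^ c)"
      unfolding G_def by (rule sum_centralizers_GL[of n "\<lambda>x. \<chi> x ^ c"])
    also have "(\<Sum>fs\<in>divisor_chains n n. \<chi> (det (companions fs)) ^ c) = (\<Sum>fs\<in>divisor_chains n n. \<Prod>f\<leftarrow>fs. \<chi> (signed_const f) ^ c)"
    proof (rule sum.cong[OF refl])
      fix fs :: "'a poly list" assume fs: "fs \<in> divisor_chains n n"
      have "\<chi> (\<Prod>f\<leftarrow>fs. signed_const f) ^ c = (\<Prod>f\<leftarrow>fs. \<chi> (signed_const f) ^ c) \<and> (\<Prod>f\<leftarrow>fs. signed_const f) \<noteq> 0"
        if "\<forall>f\<in>set fs. coeff f 0 \<noteq> 0" for fs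
        using that by (induction fs) (auto simp: \<chi>1 \<chi>mult signed_const_nonzero power_mult_distrib)
      moreover have "det (companions fs) = (\<Prod>f\<leftarrow>fs. signed_const f)"
        using fs det_companions[of fs] by (simp add: divisor_chains_def signed_const_def)
      ultimately show "\<chi> (det (companions fs)) ^ c = (\<Prod>f\<leftarrow>fs. \<chi> (signed_const f) ^ c)"
        using fs by (simp add: divisor_chains_def)
    qed
    also have "\<dots> = of_real (tc (m div gcd c m))"
      using sum_chains_character[OF m0 \<chi>mult \<chi>1 \<chi>sum refl, of c n n] by (simp add: tc_def twisted_count_def)
    finally show ?thesis .
  qed
  have Dsub: "commuting_pairs (det_mats n D) = {(g, h) \<in> CP. det g \<in> D \<and> det h \<in> D}"
    using D0 by (auto simp: CP_def commuting_pairs_def det_mats_def carrier_GL)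
  have fCP: "finite CP" by (simp add: CP_def)
  have "(\<Sum>(g, h)\<in>CP. (\<Sum>a<m. \<chi> (det g) ^ a) * (\<Sum>b<m. \<chi> (det h) ^ b))
      = (\<Sum>(g, h)\<in>CP. if det g \<in> D \<and> det h \<in> D then complex_of_nat (m * m) else 0)"
    by (rule sum.cong[OF refl]) (auto simp: CP_def commuting_pairs_def carrier_GL \<chi>D)
  also have "\<dots> = of_nat (m * m) * of_nat (card (commuting_pairs (det_mats n D)))"
    unfolding Dsub using fCP by (simp add: split_def sum.If_cases Int_def mult.commute)
  finally have 1: "(\<Sum>(g, h)\<in>CP. (\<Sum>a<m. \<chi> (det g) ^ a) * (\<Sum>b<m. \<chi> (det h) ^ b))
      = of_nat (m * m) * of_nat (card (commuting_pairs (det_mats n D)))" .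
  have "(\<Sum>(g, h)\<in>CP. (\<Sum>a<m. \<chi> (det g) ^ a) * (\<Sum>b<m. \<chi> (det h) ^ b))
      = (\<Sum>(g, h)\<in>CP. \<Sum>a<m. \<Sum>b<m. \<chi> (det g) ^ a * \<chi> (det h) ^ b)"
    by (simp add: sum_product)
  also have "\<dots> = (\<Sum>a<m. \<Sum>b<m. \<Sum>(g, h)\<in>CP. \<chi> (det g) ^ a * \<chi> (det h) ^ b)"
    unfolding split_def by (subst sum.swap, intro sum.cong refl, subst sum.swap) simp
  also have "\<dots> = (\<Sum>a<m. \<Sum>b<m. complex_of_nat G * of_real (tc (m div gcd (gcd a b) m)))"
    unfolding CP_def
    by (intro sum.cong refl trans[OF double_character_sum[where \<chi> = \<chi> and n = n, OF \<chi>mult] single[unfolded CP_def]])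
  also have "\<dots> = of_real (real G * (\<Sum>a<m. \<Sum>b<m. tc (m div gcd (gcd a b) m)))"
    by (simp add: sum_distrib_left)
  finally have "complex_of_real (real (m * m) * real (card (commuting_pairs (det_mats n D))))
      = complex_of_real (real G * (\<Sum>a<m. \<Sum>b<m. tc (m div gcd (gcd a b) m)))"
    unfolding 1 by simp
  then have 2: "real (m * m) * real (card (commuting_pairs (det_mats n D)))
      = real G * (\<Sum>a<m. \<Sum>b<m. tc (m div gcd (gcd a b) m))"
    by (simp only: of_real_eq_iff)
  have "carrier (GL n :: 'a mat monoid) = det_mats n (UNIV - {0})" by (auto simp: carrier_GL det_mats_def)
  then have "G = (CARD('a) - 1) * card {A :: 'a mat. A \<in> carrier_mat n n \<and> det A = 1}"
    unfolding G_def using card_det_mats[OF n, of "UNIV - {0 :: 'a}"] by (simp add: card_Diff_singleton)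
  also have "\<dots> = m * card (det_mats n D)"
    unfolding card_det_mats[OF n D0] m[symmetric] by simp
  finally have G: "G = m * card (det_mats n D)" .
  have "real m * (real m * card (commuting_pairs (det_mats n D)))
     = real m * (card (det_mats n D) * (\<Sum>a<m. \<Sum>b<m. tc (m div gcd (gcd a b) m)))"
    using 2 unfolding G by (simp add: mult.assoc)
  then show ?thesis using m0 by (simp add: tc_def)
qed

section \<open>The recursion for affine groups\<close>

lemma det_mats_mult_closed:
  "unit_group D \<Longrightarrow> g \<in> det_mats n D \<Longrightarrow> h \<in> det_mats n D \<Longrightarrow> g * h \<in> det_mats n D"
  by (auto simp: det_mats_def unit_group_def det_mult)

lemma group_affine_ext:
  fixes D :: "'a::field set"
  assumes D: "unit_group D"
  shows "group (affine_ext n (det_mats n D))"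
proof -
  define A where "A = affine_ext n (det_mats n D)"
  have car: "carrier A = carrier_vec n \<times> det_mats n D"
    by (simp add: A_def affine_ext_def semidirect_product_def monoid_vec_def)
  have mult: "(a, g) \<otimes>\<^bsub>A\<^esub> (b, h) = (a + g *\<^sub>v b, g * h)" for a g b h
    by (simp add: A_def affine_ext_def semidirect_product_def monoid_vec_def)
  have one: "\<one>\<^bsub>A\<^esub> = (0\<^sub>v n, 1\<^sub>m n)"
    by (simp add: A_def affine_ext_def semidirect_product_def monoid_vec_def)
  have c: "g \<in> carrier_mat n n" if "g \<in> det_mats n D" for g using that by (simp add: det_mats_def)
  have "group A"
  proof (rule groupI)
    fix x y assume "x \<in> carrier A" "y \<in> carrier A"
    then show "x \<otimes>\<^bsub>A\<^esub> y \<in> carrier A"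
      using det_mats_mult_closed[OF D] c
      by (cases x; cases y) (auto simp: car mult intro!: add_carrier_vec mult_mat_vec_carrier)
  next
    show "\<one>\<^bsub>A\<^esub> \<in> carrier A" using D by (simp add: one car det_mats_def unit_group_def)
  next
    fix x y z assume x: "x \<in> carrier A" and y: "y \<in> carrier A" and z: "z \<in> carrier A"
    obtain a g b h d k where e: "x = (a, g)" "y = (b, h)" "z = (d, k)" by (metis surj_pair)
    have m: "a \<in> carrier_vec n" "b \<in> carrier_vec n" "d \<in> carrier_vec n"
      "g \<in> carrier_mat n n" "h \<in> carrier_mat n n" "k \<in> carrier_mat n n"
      using x y z c by (auto simp: car e)
    have "h *\<^sub>v d \<in> carrier_vec n" using m by auto
    then have "g *\<^sub>v (b + h *\<^sub>v d) = g *\<^sub>v b + (g * h) *\<^sub>v d"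
      using m by (simp add: mult_add_distrib_mat_vec[of g n n] assoc_mult_mat_vec[of g n n h n])
    moreover have "g *\<^sub>v b \<in> carrier_vec n" "(g * h) *\<^sub>v d \<in> carrier_vec n" using m by auto
    ultimately show "x \<otimes>\<^bsub>A\<^esub> y \<otimes>\<^bsub>A\<^esub> z = x \<otimes>\<^bsub>A\<^esub> (y \<otimes>\<^bsub>A\<^esub> z)"
      using m by (simp add: e mult assoc_add_vec[of a n] assoc_mult_mat[of g n n h n k n])
  next
    fix x assume "x \<in> carrier A"
    then obtain a g where x: "x = (a, g)" "a \<in> carrier_vec n" "g \<in> det_mats n D" by (auto simp: car)
    show "\<one>\<^bsub>A\<^esub> \<otimes>\<^bsub>A\<^esub> x = x" using x c[OF x(3)] by (simp add: one mult)
  next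
    fix x assume "x \<in> carrier A"
    then obtain a g where x: "x = (a, g)" "a \<in> carrier_vec n" "g \<in> det_mats n D" by (auto simp: car)
    have g: "g \<in> carrier_mat n n" "det g \<in> D" "det g \<noteq> 0" using x(3) D by (auto simp: det_mats_def unit_group_def)
    obtain h where h: "h \<in> carrier_mat n n" "g * h = 1\<^sub>m n" "h * g = 1\<^sub>m n"
      using det_nonzero_inverse[OF g(1,3)] by blast
    have "det g * det h = 1" using det_mult[OF g(1) h(1)] h(2) by simp
    then have "det h = inverse (det g)" by (rule inverse_unique[symmetric])
    then have hD: "h \<in> det_mats n D" using h(1) g(2) D by (simp add: det_mats_def unit_group_def)
    have ha: "h *\<^sub>v a \<in> carrier_vec n" using h x by auto
    have "(- (h *\<^sub>v a), h) \<otimes>\<^bsub>A\<^esub> x = \<one>\<^bsub>A\<^esub>"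
      using ha h by (simp add: x mult one)
    moreover have "(- (h *\<^sub>v a), h) \<in> carrier A" using ha hD by (simp add: car)
    ultimately show "\<exists>y\<in>carrier A. y \<otimes>\<^bsub>A\<^esub> x = \<one>\<^bsub>A\<^esub>" by blast
  qed
  then show ?thesis by (simp add: A_def)
qed

lemma class_number_affine_ext:
  fixes D :: "'a::{field,finite} set"
  assumes D: "unit_group D"
  shows "class_number (affine_ext n (det_mats n D)) * (CARD('a) ^ n * card (det_mats n D))
    = card (affine_commuting_pairs n (det_mats n D))"
proof -
  define A where "A = affine_ext n (det_mats n D)"
  have car: "carrier A = carrier_vec n \<times> det_mats n D"
    by (simp add: A_def affine_ext_def semidirect_product_def monoid_vec_def)
  have mult: "(a, g) \<otimes>\<^bsub>A\<^esub> (b, h) = (a + g *\<^sub>v b, g * h)" for a g b h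
    by (simp add: A_def affine_ext_def semidirect_product_def monoid_vec_def)
  have fin: "finite (carrier A)" by (simp add: car)
  have "card (carrier A) = CARD('a) ^ n * card (det_mats n D)"
    by (simp add: car card_cartesian_product card_carrier_vec)
  moreover have "{(x, y) \<in> carrier A \<times> carrier A. x \<otimes>\<^bsub>A\<^esub> y = y \<otimes>\<^bsub>A\<^esub> x} = affine_commuting_pairs n (det_mats n D)"
    by (auto simp: car mult affine_commuting_pairs_def)
  ultimately show ?thesis
    using group.class_number_times_order[OF group_affine_ext[OF D, of n, folded A_def] fin] by (simp add: A_def)
qed

lemma card_det_mats_pos:
  fixes D :: "'a::{field,finite} set"
  assumes "1 \<in> D"
  shows "0 < card (det_mats n D)"
proof -
  have "1\<^sub>m n \<in> det_mats n D" using assms by (simp add: det_mats_def)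
  then show ?thesis by (auto simp: card_gt_0_iff)
qed

lemma class_number_affine_ext_1:
  fixes D :: "'a::{field,finite} set"
  assumes D: "unit_group D" and m: "card D * m = CARD('a) - 1"
  shows "class_number (affine_ext 1 (det_mats 1 D)) = card D + m"
proof -
  have D1: "1 \<in> D" using D by (simp add: unit_group_def)
  then have e: "0 < card D" by (auto simp: card_gt_0_iff)
  have "class_number (affine_ext 1 (det_mats 1 D)) * (CARD('a) * card D) = CARD('a) * (card D * card D + card D * m)"
    using class_number_affine_ext[OF D, of 1] card_affine_commuting_pairs_1[OF D1] card_det_mats_1[of D]
    unfolding m by simp
  also have "\<dots> = (card D + m) * (CARD('a) * card D)" by (simp add: algebra_simps)
  finally show ?thesis using e by (metis mult_right_cancel mult_is_0 not_gr0 zero_less_card_finite)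
qed

lemma class_number_affine_ext_Suc:
  fixes D :: "'a::{field,finite} set"
  assumes D: "unit_group D" and m: "card D * m = CARD('a) - 1" and n: "1 \<le> n"
  shows "real m * class_number (affine_ext (Suc n) (det_mats (Suc n) D))
    = (\<Sum>a<m. \<Sum>b<m. twisted_count (real CARD('a)) (Suc n) (m div gcd (gcd a b) m))
      + real m * class_number (affine_ext n (det_mats n D))"
proof -
  define q where "q = CARD('a)"
  define H where "H = card (det_mats (Suc n) D)"
  define K where "K n = class_number (affine_ext n (det_mats n D))" for n
  define P where "P = card (commuting_pairs (det_mats (Suc n) D))"
  define S where "S = (\<Sum>a<m. \<Sum>b<m. twisted_count (real CARD('a)) (Suc n) (m div gcd (gcd a b) m))"
  have D1: "1 \<in> D" and D0: "0 \<notin> D" using D by (simp_all add: unit_group_def)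
  have H0: "0 < H" unfolding H_def by (rule card_det_mats_pos[OF D1])
  have q0: "0 < q" by (simp add: q_def)
  have "K (Suc n) * (q ^ Suc n * H) = q ^ Suc n * (P + (q ^ Suc n - 1) * (K n * (q ^ n * card (det_mats n D))))"
    unfolding K_def H_def P_def q_def class_number_affine_ext[OF D] by (rule card_affine_commuting_pairs_Suc[OF n])
  \<comment> \<open>The number of nonzero row vectors times the order of a stabilizer is the order
    of the group one dimension up. Hence \<open>K n\<close> enters the recursion with coefficient
    one.\<close>
  also have "(q ^ Suc n - 1) * (K n * (q ^ n * card (det_mats n D))) = K n * H"
    unfolding H_def card_det_mats_Suc[OF n D0] q_def by (simp add: mult.assoc mult.left_commute del: power_Suc)
  finally have "q ^ Suc n * (K (Suc n) * H) = q ^ Suc n * (P + K n * H)" by (simp add: mult.left_commute del: power_Suc)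
  then have e: "K (Suc n) * H = P + K n * H" using q0 by simp
  have "real m * real P = real H * S"
    unfolding P_def H_def S_def by (rule card_commuting_pairs_det_mats[OF D _ m]) simp
  then have "real H * (real m * K (Suc n)) = real H * (S + real m * K n)"
    using arg_cong[OF e, of "\<lambda>x. real m * real x"] by (simp add: algebra_simps)
  then show ?thesis using H0 by (simp add: K_def S_def)
qed

section \<open>Estimates\<close>

text \<open>For \<open>s \<ge> 2\<close> at most the class number of \<open>GL(n/s, q)\<close>
  occurs, and \<open>n/s\<close> is at most half of \<open>n\<close>.\<close>

lemma twisted_count_le:
  assumes q: "2 \<le> q" and s: "2 \<le> s" and n: "1 \<le> n"
  shows "twisted_count q n s \<le> q\<^sup>2 / (q\<^sup>2 - 1) * q ^ (n div 2)"
proof -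
  have q2: "0 < q\<^sup>2 - 1" using q by (simp add: one_less_power)
  have C: "0 \<le> q\<^sup>2 / (q\<^sup>2 - 1)" using q2 by simp
  show ?thesis
  proof (cases "s dvd n")
    case True
    have "twisted_count q n s \<le> q\<^sup>2 / (q\<^sup>2 - 1) * q ^ (n div s)"
      using True chain_count_le_power[OF q] by (simp add: twisted_count_def)
    also have "\<dots> \<le> q\<^sup>2 / (q\<^sup>2 - 1) * q ^ (n div 2)"
      using C q s by (intro mult_left_mono power_increasing div_le_mono2) auto
    finally show ?thesis .
  next
    case False
    then show ?thesis using C q by (simp add: twisted_count_def)
  qed
qed

text \<open>The number is the order of \<open>(a, b)\<close> in the square of the cyclic group of
  order \<open>m\<close>, so it exceeds 1 away from the identity.\<close>

lemma div_gcd_ge_2: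
  fixes a b m :: nat
  assumes "a < m" "b < m" "(a, b) \<noteq> (0, 0)"
  shows "2 \<le> m div gcd (gcd a b) m"
proof -
  define g where "g = gcd (gcd a b) m"
  have "g dvd m" "g dvd a" "g dvd b" unfolding g_def
    by (rule gcd_dvd2, rule dvd_trans[OF gcd_dvd1 gcd_dvd1], rule dvd_trans[OF gcd_dvd1 gcd_dvd2])
  then obtain k where k: "m = g * k" by blast
  have "g < m"
  proof (cases "a = 0")
    case True
    then have "0 < b" using assms by simp
    then show ?thesis using dvd_imp_le[OF \<open>g dvd b\<close>] assms(2) by linarith
  next
    case False
    then show ?thesis using dvd_imp_le[OF \<open>g dvd a\<close>] assms(1) by linarith
  qed
  moreover have "0 < m" using assms by simp
  ultimately have "g \<noteq> 0" "k \<noteq> 0" "k \<noteq> 1" using k by (intro notI; simp)+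
  then show ?thesis unfolding g_def[symmetric] using k by simp
qed

lemma double_sum_split_0:
  fixes f :: "nat \<Rightarrow> nat \<Rightarrow> real"
  assumes "0 < m"
  shows "(\<Sum>a<m. \<Sum>b<m. f a b) = f 0 0 + (\<Sum>(a, b)\<in>{..<m} \<times> {..<m} - {(0, 0)}. f a b)"
proof -
  have "(\<Sum>a<m. \<Sum>b<m. f a b) = (\<Sum>(a, b)\<in>{..<m} \<times> {..<m}. f a b)" by (rule sum.cartesian_product)
  also have "\<dots> = (case (0, 0) of (a, b) \<Rightarrow> f a b) + (\<Sum>(a, b)\<in>{..<m} \<times> {..<m} - {(0, 0)}. f a b)"
    by (rule sum.remove) (use assms in auto)
  finally show ?thesis by simp
qed

text \<open>The pair \<open>(0, 0)\<close> carries the trivial character and gives the main term;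
  the other \<open>m^2 - 1\<close> pairs are bounded uniformly.\<close>

lemma sum_twisted_count_le:
  assumes q: "2 \<le> q" and m: "0 < m" and n: "1 \<le> n"
  shows "(\<Sum>a<m. \<Sum>b<m. twisted_count q n (m div gcd (gcd a b) m))
    \<le> q\<^sup>2 / (q\<^sup>2 - 1) * (q ^ n + (real m ^ 2 - 1) * q ^ (n div 2))"
proof -
  define C where "C = q\<^sup>2 / (q\<^sup>2 - 1)"
  have "(\<Sum>(a, b)\<in>{..<m} \<times> {..<m} - {(0, 0)}. twisted_count q n (m div gcd (gcd a b) m))
     \<le> (\<Sum>(a, b)\<in>{..<m} \<times> {..<m} - {(0, 0)}. C * q ^ (n div 2))"
  proof (rule sum_mono)
    fix x assume "x \<in> {..<m} \<times> {..<m} - {(0, 0)}"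
    then obtain a b where x: "x = (a, b)" and ab: "a < m" "b < m" "(a, b) \<noteq> (0, 0)" by (cases x) auto
    show "(case x of (a, b) \<Rightarrow> twisted_count q n (m div gcd (gcd a b) m)) \<le> (case x of (a, b) \<Rightarrow> C * q ^ (n div 2))"
      unfolding x prod.case C_def by (rule twisted_count_le[OF q div_gcd_ge_2[OF ab] n])
  qed
  also have "\<dots> = (real m ^ 2 - 1) * (C * q ^ (n div 2))"
    using m by (simp add: card_Diff_singleton card_cartesian_product of_nat_diff power2_eq_square)
  finally have "(\<Sum>a<m. \<Sum>b<m. twisted_count q n (m div gcd (gcd a b) m))
     \<le> twisted_count q n 1 + (real m ^ 2 - 1) * (C * q ^ (n div 2))"
    unfolding double_sum_split_0[OF m] using m by simp
  also have "twisted_count q n 1 \<le> C * q ^ n"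
    unfolding C_def using chain_count_le_power[OF q, of n] by (simp add: twisted_count_def)
  finally show ?thesis unfolding C_def[symmetric] by (simp add: algebra_simps)
qed

text \<open>For \<open>n = 2\<close> only the orders 1 and 2 survive. Order 2 belongs to the at most
  three pairs in \<open>T\<close>, each worth \<open>k(GL(1, q)) = q - 1\<close>. The uniform bound
  on all \<open>m^2 - 1\<close> pairs could not start the induction when
  \<open>m = q - 1\<close>.\<close>

lemma sum_twisted_count_2_le:
  assumes q: "2 \<le> q" and m: "0 < m"
  shows "(\<Sum>a<m. \<Sum>b<m. twisted_count q 2 (m div gcd (gcd a b) m)) \<le> q\<^sup>2 - 1 + 3 * (q - 1)"
proof -
  define T where "T = {(0, m div 2), (m div 2, 0), (m div 2, m div 2)}"
  have le: "twisted_count q 2 (m div gcd (gcd a b) m) \<le> (if (a, b) \<in> T then q - 1 else 0)"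
    if ab: "a < m" "b < m" "(a, b) \<noteq> (0, 0)" for a b
  proof (cases "m div gcd (gcd a b) m dvd 2")
    case True
    then have s: "m div gcd (gcd a b) m = 2" using div_gcd_ge_2[OF ab] dvd_imp_le[OF True] by simp
    define g where "g = gcd (gcd a b) m"
    have "g dvd m" "g dvd a" "g dvd b" unfolding g_def
    by (rule gcd_dvd2, rule dvd_trans[OF gcd_dvd1 gcd_dvd1], rule dvd_trans[OF gcd_dvd1 gcd_dvd2])
    then obtain k i j where k: "m = g * k" "a = g * i" "b = g * j" by (auto simp: dvd_def)
    have "k = 2" using s[folded g_def] m k(1) by auto
    then have mg: "m = 2 * g" using k by simp
    then have "i < 2" "j < 2" using ab(1,2) k by auto
    then have "(a, b) \<in> T" using ab(3) k(2,3) mg by (auto simp: T_def less_2_cases_iff)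
    then show ?thesis using chain_count_small(1)[of q] unfolding s twisted_count_def by simp
  next
    case False
    then show ?thesis using q by (simp add: twisted_count_def)
  qed
  have "(\<Sum>(a, b)\<in>{..<m} \<times> {..<m} - {(0, 0)}. twisted_count q 2 (m div gcd (gcd a b) m))
     \<le> (\<Sum>x\<in>{..<m} \<times> {..<m} - {(0, 0)}. if x \<in> T then q - 1 else 0)"
  proof (rule sum_mono)
    fix x assume "x \<in> {..<m} \<times> {..<m} - {(0, 0)}"
    then obtain a b where x: "x = (a, b)" and ab: "a < m" "b < m" "(a, b) \<noteq> (0, 0)" by (cases x) auto
    show "(case x of (a, b) \<Rightarrow> twisted_count q 2 (m div gcd (gcd a b) m)) \<le> (if x \<in> T then q - 1 else 0)"
      unfolding x prod.case by (rule le[OF ab])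
  qed
  also have "\<dots> = (q - 1) * card (({..<m} \<times> {..<m} - {(0, 0)}) \<inter> T)"
    by (simp add: sum.If_cases Int_def mult.commute)
  also have "\<dots> \<le> (q - 1) * 3"
  proof -
    have "card (({..<m} \<times> {..<m} - {(0, 0)}) \<inter> T) \<le> card T" by (rule card_mono) (auto simp: T_def)
    also have "card T \<le> 3" unfolding T_def by (simp add: card_insert_if)
    finally show ?thesis using q by (intro mult_left_mono) auto
  qed
  finally have "(\<Sum>(a, b)\<in>{..<m} \<times> {..<m} - {(0, 0)}. twisted_count q 2 (m div gcd (gcd a b) m)) \<le> 3 * (q - 1)" by simp
  then show ?thesis unfolding double_sum_split_0[OF m] using m chain_count_small(2)[of q]
    by (simp add: twisted_count_def)
qed

lemma sum_twisted_count_m_eq_2: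
  "(\<Sum>a<2. \<Sum>b<2. twisted_count q n (2 div gcd (gcd a b) 2)) = twisted_count q n 1 + 3 * twisted_count q n 2"
  by (simp add: numeral_2_eq_2)

lemma class_number_bound_large:
  fixes q m e :: nat and K :: "nat \<Rightarrow> nat"
  assumes q: "4 \<le> q" and em: "e * m = q - 1" and m: "2 \<le> m" and e: "1 \<le> e"
    and K1: "K 1 = e + m"
    and KS: "\<And>n. 1 \<le> n \<Longrightarrow> real m * K (Suc n)
      = (\<Sum>a<m. \<Sum>b<m. twisted_count (real q) (Suc n) (m div gcd (gcd a b) m)) + real m * K n"
    and n: "2 \<le> n"
  shows "K n < q ^ n"
  using n
proof (induction n rule: dec_induct)
  case base
  have qm: "real q = real e * real m + 1"
    using em q by (metis of_nat_1 of_nat_add of_nat_mult le_add_diff_inverse2 one_le_numeral order_trans)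
  have "real m * K 2 \<le> (real q)\<^sup>2 - 1 + 3 * (real q - 1) + real m * (real e + real m)"
    using KS[of 1] sum_twisted_count_2_le[of "real q" m] q m unfolding K1 by (simp add: Suc_1[unfolded One_nat_def])
  also have "(real q)\<^sup>2 - 1 + 3 * (real q - 1) = real m * (real e * (real q + 4))"
    unfolding qm by (simp add: power2_eq_square algebra_simps)
  finally have "real m * K 2 \<le> real m * (real e * (real q + 4) + (real e + real m))" by (simp only: distrib_left)
  then have "real (K 2) \<le> real (e * (q + 4) + (e + m))" using m by simp
  then have K2: "K 2 \<le> e * (q + 4) + (e + m)" by (simp only: of_nat_le_iff)
  show ?case
  proof (cases "e = 1")
    case True
    \<comment> \<open>Here \<open>m = q - 1\<close>. For \<open>q = 3\<close> this bound would be
      10, the exceptional value; it drops below \<open>q^2\<close> from \<open>q = 4\<close>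
      on.\<close>
    then have "K 2 \<le> 2 * q + 4" using K2 em q by simp
    also have "\<dots> < q * q"
    proof -
      have "4 * q \<le> q * q" using q by (intro mult_right_mono) auto
      then show ?thesis using q by linarith
    qed
    finally show ?thesis by (simp add: power2_eq_square)
  next
    case False
    then have e2: "2 \<le> e" using e by simp
    have "2 * e \<le> q - 1" unfolding em[symmetric] using m by (simp add: mult.commute)
    moreover have "2 * m \<le> q - 1" unfolding em[symmetric] using e2 by simp
    moreover have "4 \<le> q - 1" unfolding em[symmetric] using mult_le_mono[OF e2 m] by simp
    ultimately have e': "2 * e \<le> q - 1" and s: "e + m \<le> q - 1" and q5: "5 \<le> q" by auto
    have "2 * K 2 \<le> 2 * (e * (q + 4) + (e + m))" using K2 by simp
    also have "\<dots> = 2 * e * (q + 4) + 2 * (e + m)" by (simp add: algebra_simps)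
    also have "\<dots> \<le> (q - 1) * (q + 4) + 2 * (q - 1)"
      using e' s by (intro add_mono mult_right_mono mult_left_mono) auto
    finally have "2 * K 2 \<le> (q - 1) * (q + 4) + 2 * (q - 1)" .
    moreover obtain t where t: "q = t + 5" using q5 le_Suc_ex by (metis add.commute)
    ultimately have "2 * K 2 < 2 * (q * q)" by (simp add: t algebra_simps)
    then show ?thesis by (simp add: power2_eq_square)
  qed
next
  case (step n)
  define Q where "Q = real q"
  have Q: "4 \<le> Q" using q by (simp add: Q_def)
  have m0: "0 < real m" using m by simp
  have Q2: "0 < Q\<^sup>2 - 1" using Q by (simp add: one_less_power)
  define C where "C = Q\<^sup>2 / (Q\<^sup>2 - 1)"
  have C0: "0 < C" unfolding C_def using Q Q2 by simp
  have mq: "m \<le> q - 1" unfolding em[symmetric] using e by simp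
  have mQ: "real m \<le> Q - 1" using mq q by (simp add: Q_def of_nat_diff)
  \<comment> \<open>\<open>k\<close> is \<open>n - 1\<close>. Weakening the exponent
    \<open>Suc n div 2\<close> to \<open>k\<close> lets \<open>Q^k\<close> be factored out of both
    terms of the estimate.\<close>
  obtain k where k: "Suc n = k + 2" "Suc n div 2 \<le> k" using step(1) by (intro that[of "n - 1"]) auto
  have "real m * K (Suc n) \<le> C * (Q ^ Suc n + (real m ^ 2 - 1) * Q ^ (Suc n div 2)) + real m * K n"
    using KS[of n] step(1) sum_twisted_count_le[of Q m "Suc n"] Q m unfolding C_def Q_def by simp
  also have "\<dots> \<le> C * (Q ^ Suc n + real m ^ 2 * Q ^ k) + real m * Q ^ n"
  proof (intro add_mono mult_left_mono order_refl mult_mono)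
    show "Q ^ (Suc n div 2) \<le> Q ^ k" using k(2) Q by (intro power_increasing) auto
    show "real (K n) \<le> Q ^ n" using step.IH by (metis Q_def less_imp_le of_nat_le_iff of_nat_power)
  qed (use C0 Q m in auto)
  also have "\<dots> = Q ^ k * (C * (Q\<^sup>2 + real m ^ 2)) + real m * Q ^ n"
    unfolding k(1) by (simp add: power_add power2_eq_square algebra_simps)
  also have "\<dots> < Q ^ k * (real m * (Q\<^sup>2 - Q)) + real m * Q ^ n"
  proof -
    have "Q\<^sup>2 + real m ^ 2 \<le> real m * (Q\<^sup>2 / 2 + 2)"
    proof -
      have "2 * Q \<le> Q * Q" using Q by (intro mult_right_mono) auto
      then have "2 * real m \<le> Q\<^sup>2" using mQ unfolding power2_eq_square by linarith
      \<comment> \<open>Convexity in \<open>m\<close>: \<open>Q^2 + m^2\<close> lies below its chord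
        between \<open>m = 2\<close> and \<open>m = Q^2 / 2\<close>, and this product is the gap.
        The chord passes through the origin, so a factor \<open>m\<close> splits off.\<close>
      then have "0 \<le> (real m - 2) * (Q\<^sup>2 / 2 - real m)" using m by (intro mult_nonneg_nonneg) auto
      then show ?thesis by (simp add: algebra_simps diff_divide_distrib power2_eq_square)
    qed
    then have "C * (Q\<^sup>2 + real m ^ 2) \<le> C * (real m * (Q\<^sup>2 / 2 + 2))" using C0 by (intro mult_left_mono) auto
    also have "\<dots> = real m * (C * (Q\<^sup>2 / 2 + 2))" by simp
    also have "\<dots> < real m * (Q\<^sup>2 - Q)"
    proof (rule mult_strict_left_mono[OF _ m0])
      \<comment> \<open>The cubic \<open>Q^3 - 2 Q^2 - 6 Q + 2\<close>, arranged so that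
        \<open>Q \<ge> 4\<close> shows it to be positive. Multiplied by \<open>Q / 2\<close> it is
        the difference of the two sides below. It is negative at \<open>Q = 3\<close>, hence the
        separate treatment of that field.\<close>
      have "0 < Q * (Q * (Q - 4)) + 2 * (Q * (Q - 4)) + 2 * Q + 2"
        using Q by (intro add_nonneg_pos add_nonneg_nonneg mult_nonneg_nonneg) auto
      then have "0 < Q * (Q * (Q * (Q - 4)) + 2 * (Q * (Q - 4)) + 2 * Q + 2)" using Q by (intro mult_pos_pos) auto
      then have "Q\<^sup>2 * (Q\<^sup>2 / 2 + 2) < (Q\<^sup>2 - Q) * (Q\<^sup>2 - 1)"
        by (simp add: algebra_simps power2_eq_square)
      then show "C * (Q\<^sup>2 / 2 + 2) < Q\<^sup>2 - Q" unfolding C_def using Q2 by (simp add: pos_divide_less_eq)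
    qed
    finally show ?thesis using Q by (intro add_strict_right_mono mult_strict_left_mono) auto
  qed
  also have "\<dots> = real m * Q ^ Suc n"
  proof -
    have "n = Suc k" using k(1) by simp
    then show ?thesis by (simp add: algebra_simps power2_eq_square)
  qed
  finally have "real (K (Suc n)) < Q ^ Suc n" using m0 by simp
  then show ?case unfolding Q_def by (metis of_nat_less_iff of_nat_power)
qed

lemma class_number_bound_3:
  fixes K :: "nat \<Rightarrow> nat"
  assumes K1: "K 1 = 3"
    and KS: "\<And>n. 1 \<le> n \<Longrightarrow> 2 * real (K (Suc n))
      = (\<Sum>a<2. \<Sum>b<2. twisted_count 3 (Suc n) (2 div gcd (gcd a b) 2)) + 2 * real (K n)"
  shows "K 2 = 10" "3 \<le> n \<Longrightarrow> K n < 3 ^ n"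
proof -
  have KS': "2 * real (K (Suc n)) = twisted_count 3 (Suc n) 1 + 3 * twisted_count 3 (Suc n) 2 + 2 * real (K n)"
    if "1 \<le> n" for n using KS[OF that] unfolding sum_twisted_count_m_eq_2 .
  have t2: "twisted_count 3 2 1 = 8" "twisted_count 3 2 2 = 2"
    using chain_count_small(1)[of 3] chain_count_small(2)[of 3] by (simp_all add: twisted_count_def)
  have t3: "twisted_count 3 3 1 = 24" "twisted_count 3 3 2 = 0"
    using chain_count_small(3) by (simp_all add: twisted_count_def)
  have t4: "twisted_count 3 4 1 = 78" "twisted_count 3 4 2 = 8"
    using chain_count_small(4) chain_count_small(2)[of 3] by (simp_all add: twisted_count_def)
  show K2: "K 2 = 10" using KS'[of 1] K1 t2 by (simp add: numeral_2_eq_2)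
  have "Suc 2 = 3" "Suc 3 = 4" by simp_all
  then have K3: "K 3 = 22" using KS'[of 2] K2 t3 by simp
  \<comment> \<open>The estimate would not do here: even with \<open>K 3 = 22\<close> it gives only
    \<open>2 K 4 \<le> 165.5\<close>, above \<open>2 * 81\<close>.\<close>
  then have K4: "K 4 = 73" using KS'[of 3] t4 \<open>Suc 3 = 4\<close> by simp
  show "K n < 3 ^ n" if "3 \<le> n"
    using that
  proof (induction n rule: dec_induct)
    case base
    show ?case using K3 by simp
  next
    case (step n)
    show ?case
    proof (cases "n = 3")
      case True
      then show ?thesis using K4 \<open>Suc 3 = 4\<close> by simp
    next
      case False
      then have n: "4 \<le> n" using step(1) by simp
      \<comment> \<open>\<open>k\<close> is \<open>n - 2\<close>, and
        \<open>Suc n div 2 \<le> n - 2\<close> holds from \<open>n = 4\<close> on. In units of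
        \<open>3^k\<close> the estimate then reads 51.75 against the required 54.\<close>
      obtain k where k: "Suc n = k + 3" "Suc n div 2 \<le> k" using n by (intro that[of "n - 2"]) auto
      have "2 * real (K (Suc n)) \<le> 9 / 8 * (3 ^ Suc n + 3 * 3 ^ (Suc n div 2)) + 2 * real (K n)"
        using KS[of n] n sum_twisted_count_le[of 3 2 "Suc n"] by simp
      also have "\<dots> \<le> 9 / 8 * (3 ^ Suc n + 3 * 3 ^ k) + 2 * 3 ^ n"
      proof (intro add_mono mult_left_mono order_refl)
        show "3 ^ (Suc n div 2) \<le> (3::real) ^ k" using k(2) by (intro power_increasing) auto
        show "real (K n) \<le> 3 ^ n" using step.IH by (metis less_imp_le of_nat_le_iff of_nat_numeral of_nat_power)
      qed auto
      also have "\<dots> < 2 * 3 ^ Suc n"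
      proof -
        have "n = k + 2" using k(1) by simp
        then show ?thesis by (simp add: power_add)
      qed
      finally have "real (K (Suc n)) < 3 ^ Suc n" by simp
      then show ?thesis by (metis of_nat_less_iff of_nat_numeral of_nat_power)
    qed
  qed
qed

section \<open>Groups between the special and the general linear group\<close>

lemma subgroup_SL: "subgroup (SL n) (GL n :: 'a::field mat monoid)"
proof -
  interpret group "GL n :: 'a mat monoid" by (rule group_GL)
  show ?thesis
  proof (rule subgroupI)
    show "SL n \<subseteq> carrier (GL n :: 'a mat monoid)" by (auto simp: SL_def)
    have "1\<^sub>m n \<in> SL n" by (simp add: SL_def carrier_GL)
    then show "SL n \<noteq> {}" by blast
  next
    fix a :: "'a mat" assume a: "a \<in> SL n"
    then have ac: "a \<in> carrier (GL n)" "det a = 1" by (auto simp: SL_def)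
    have i: "inv\<^bsub>GL n\<^esub> a \<in> carrier (GL n)" using ac(1) by (rule inv_closed)
    have "a * inv\<^bsub>GL n\<^esub> a = 1\<^sub>m n" using r_inv[OF ac(1)] by simp
    then have "det a * det (inv\<^bsub>GL n\<^esub> a) = 1"
      using det_mult[of a n "inv\<^bsub>GL n\<^esub> a"] ac i by (simp add: carrier_GL)
    then show "inv\<^bsub>GL n\<^esub> a \<in> SL n" using i ac by (simp add: SL_def)
  next
    fix a b :: "'a mat" assume "a \<in> SL n" "b \<in> SL n"
    then show "a \<otimes>\<^bsub>GL n\<^esub> b \<in> SL n"
      using m_closed[of a b] det_mult[of a n b] by (auto simp: SL_def carrier_GL)
  qed
qed

text \<open>\<open>SL\<close> is the kernel of the determinant, so a group above it is the full
  preimage of its image. As the fibres of the determinant over units have equal size, Lagrange gives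
  the index.\<close>

lemma intermediate_group:
  fixes H :: "'a::{field,finite} mat set"
  assumes H: "subgroup H (GL n)" and SL: "SL n \<subseteq> H" and n: "1 \<le> n"
  shows "H = det_mats n (det ` H)" "unit_group (det ` H)" "subgroup_index (GL n) H (SL n) = card (det ` H)"
proof -
  interpret group "GL n :: 'a mat monoid" by (rule group_GL)
  interpret H: subgroup H "GL n" by (rule H)
  have Hc: "h \<in> carrier_mat n n" "det h \<noteq> 0" if "h \<in> H" for h
    using H.subset that by (auto simp: carrier_GL)
  have det_inv: "det (inv\<^bsub>GL n\<^esub> h) = inverse (det h)" if h: "h \<in> H" for h
  proof -
    have "h * inv\<^bsub>GL n\<^esub> h = 1\<^sub>m n" using r_inv[of h] H.mem_carrier[OF h] by simp
    then have "det h * det (inv\<^bsub>GL n\<^esub> h) = 1"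
      using det_mult[OF Hc(1)[OF h] Hc(1)[OF H.m_inv_closed[OF h]]] by simp
    then show ?thesis by (rule inverse_unique[symmetric])
  qed
  have dm: "det (g * h) = det g * det h" if "g \<in> H" "h \<in> H" for g h
    by (rule det_mult[OF Hc(1)[OF that(1)] Hc(1)[OF that(2)]])
  show D: "unit_group (det ` H)"
    unfolding unit_group_def
  proof (intro conjI ballI)
    have "1\<^sub>m n \<in> H" using H.one_closed by simp
    then show "1 \<in> det ` H" by (metis det_one image_eqI)
    show "0 \<notin> det ` H" using Hc by auto
  next
    fix x y assume "x \<in> det ` H" "y \<in> det ` H"
    then obtain g h where gh: "g \<in> H" "h \<in> H" "x = det g" "y = det h" by blast
    have "g * h \<in> H" using H.m_closed[OF gh(1,2)] by simp
    then show "x * y \<in> det ` H" using dm[OF gh(1,2)] gh by (metis image_eqI)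
  next
    fix x assume "x \<in> det ` H"
    then obtain h where h: "h \<in> H" "x = det h" by blast
    then show "inverse x \<in> det ` H" using det_inv[OF h(1)] H.m_inv_closed[OF h(1)] by (metis image_eqI)
  qed
  show eq: "H = det_mats n (det ` H)"
  proof (intro equalityI subsetI)
    fix h assume "h \<in> H"
    then show "h \<in> det_mats n (det ` H)" using Hc by (auto simp: det_mats_def)
  next
    fix g assume "g \<in> det_mats n (det ` H)"
    then obtain h where g: "g \<in> carrier_mat n n" and h: "h \<in> H" "det g = det h" by (auto simp: det_mats_def)
    have gG: "g \<in> carrier (GL n)" using g h Hc by (simp add: carrier_GL)
    define k where "k = g * inv\<^bsub>GL n\<^esub> h"
    have kG: "k \<in> carrier (GL n)" using gG H.mem_carrier[OF h(1)] m_closed[of g "inv\<^bsub>GL n\<^esub> h"] by (simp add: k_def)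
    have "det k = det g * inverse (det h)"
      unfolding k_def det_inv[OF h(1), symmetric] by (rule det_mult[OF g Hc(1)[OF H.m_inv_closed[OF h(1)]]])
    then have "k \<in> SL n" using h Hc kG by (simp add: SL_def)
    then have "k \<in> H" using SL by blast
    then have "k * h \<in> H" using H.m_closed[of k h] h(1) by simp
    moreover have "k * h = g"
      using m_assoc[of g "inv\<^bsub>GL n\<^esub> h" h] gG H.mem_carrier[OF h(1)] l_inv[of h] r_one[of g] by (simp add: k_def)
    ultimately show "g \<in> H" by simp
  qed
  have SLs: "subgroup (SL n) (GL n\<lparr>carrier := H\<rparr>)" by (rule subgroup_incl[OF subgroup_SL H SL])
  have "card (rcosets\<^bsub>GL n\<lparr>carrier := H\<rparr>\<^esub> SL n) * card (SL n :: 'a mat set) = Coset.order (GL n\<lparr>carrier := H\<rparr>)"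
    by (rule group.lagrange[OF subgroup_imp_group[OF H] SLs])
  also have "\<dots> = card H" by (simp add: Coset.order_def)
  also have "\<dots> = card (det ` H) * card (SL n :: 'a mat set)"
  proof -
    have "SL n = {A :: 'a mat. A \<in> carrier_mat n n \<and> det A = 1}" by (auto simp: SL_def carrier_GL)
    moreover have "0 \<notin> det ` H" using D by (simp add: unit_group_def)
    ultimately show ?thesis using card_det_mats[OF n, of "det ` H"] eq by simp
  qed
  finally have "subgroup_index (GL n) H (SL n) * card (SL n :: 'a mat set) = card (det ` H) * card (SL n :: 'a mat set)"
    by (simp add: subgroup_index_def)
  moreover have "0 < card (SL n :: 'a mat set)"
  proof -
    have "finite (SL n :: 'a mat set)" by (rule finite_subset[OF subgroup.subset[OF subgroup_SL]]) simp
    moreover have "1\<^sub>m n \<in> (SL n :: 'a mat set)" by (simp add: SL_def carrier_GL)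
    ultimately show ?thesis by (auto simp: card_gt_0_iff)
  qed
  ultimately show "subgroup_index (GL n) H (SL n) = card (det ` H)" by simp
qed

theorem theorem3p8:
  fixes H :: "'a::{field,finite} mat set" and q n e :: nat
  assumes "q = CARD('a)"
    and "n \<ge> 1"
    and "subgroup H (GL n)"
    and "SL n \<subseteq> H"
    and "e = subgroup_index (GL n) H (SL n)"
    and "e < q - 1"
  shows "(n = 1 \<and> H = SL n \<longrightarrow> class_number (affine_ext n H) = q) \<and>
         (n = 2 \<and> q = 3 \<and> H = SL n \<longrightarrow> class_number (affine_ext n H) = 10) \<and>
         (\<not> (n = 1 \<and> H = SL n) \<and> \<not> (n = 2 \<and> q = 3 \<and> H = SL n) \<longrightarrow>
            class_number (affine_ext n H) < q ^ n)"
proof -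
  define D where "D = det ` H"
  have H: "H = det_mats n D" and D: "unit_group D" and eD: "e = card D"
    using intermediate_group[OF assms(3,4,2)] assms(5) by (simp_all add: D_def)
  have D1: "1 \<in> D" using D by (simp add: unit_group_def)
  have e1: "1 \<le> e" using D1 unfolding eD by (metis One_nat_def Suc_leI card_gt_0_iff empty_iff finite)
  \<comment> \<open>What is taken from the character at this point is that \<open>e\<close> divides
    \<open>q - 1\<close>.\<close>
  obtain m where m: "e * m = q - 1" using ex_character[OF D] unfolding eD assms(1) by blast
  have m2: "2 \<le> m"
  proof (rule ccontr)
    assume "\<not> 2 \<le> m"
    then have "m = 0 \<or> m = 1" by auto
    then show False using m assms(6) by auto
  qed
  have q3: "3 \<le> q" using e1 assms(6) by linarith
  define K where "K n = class_number (affine_ext n (det_mats n D))" for n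
  have mD: "card D * m = CARD('a) - 1" using m unfolding eD assms(1) .
  have K1: "K 1 = e + m" unfolding K_def eD by (rule class_number_affine_ext_1[OF D mD])
  have KS: "real m * K (Suc k)
      = (\<Sum>a<m. \<Sum>b<m. twisted_count (real q) (Suc k) (m div gcd (gcd a b) m)) + real m * K k"
    if "1 \<le> k" for k
    unfolding K_def assms(1) by (rule class_number_affine_ext_Suc[OF D mD that])
  have SL_iff: "H = SL n \<longleftrightarrow> e = 1"
  proof
    assume HSL: "H = SL n"
    have "D \<subseteq> {1}" unfolding D_def HSL by (auto simp: SL_def)
    then have "D = {1}" using D1 by blast
    then show "e = 1" by (simp add: eD)
  next
    assume "e = 1"
    then have "D = {1}" using D1 unfolding eD by (metis card_1_singletonE singletonD)
    then show "H = SL n" unfolding H by (auto simp: det_mats_def SL_def carrier_GL)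
  qed
  have KH: "class_number (affine_ext n H) = K n" unfolding K_def H[symmetric] ..
  show ?thesis
  proof (cases "n = 1")
    case True
    show ?thesis
    proof (cases "e = 1")
      case True
      then have "e + m = q" using m q3 by simp
      then show ?thesis using \<open>n = 1\<close> True K1 unfolding KH SL_iff by simp
    next
      case False
      then have e2: "2 \<le> e" using e1 by simp
      \<comment> \<open>Two numbers that are at least 2 have a sum of at most their product, here
        \<open>q - 1\<close>.\<close>
      have "2 * m \<le> e * m" "e * 2 \<le> e * m" using e2 m2 by simp_all
      then have "e + m \<le> q - 1" unfolding m by linarith
      then show ?thesis using \<open>n = 1\<close> False K1 q3 unfolding KH SL_iff by simp
    qed
  next
    case False
    then have n2: "2 \<le> n" using assms(2) by simp
    show ?thesis
    proof (cases "q = 3")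
      case True
      \<comment> \<open>For \<open>q = 3\<close> the condition \<open>e < 2\<close> leaves only the
        special linear group.\<close>
      then have e: "e = 1" and m: "m = 2" using e1 assms(6) m by (cases "e = 1"; simp)+
      have KS3: "2 * real (K (Suc k))
         = (\<Sum>a<2. \<Sum>b<2. twisted_count 3 (Suc k) (2 div gcd (gcd a b) 2)) + 2 * real (K k)"
        if "1 \<le> k" for k
        using KS[OF that] unfolding True m by simp
      have "K 1 = 3" using K1 e m by simp
      note K3 = class_number_bound_3[OF this KS3]
      have "3 \<le> n" if "n \<noteq> 2" using n2 that by simp
      then show ?thesis using K3 False True e unfolding KH SL_iff by auto
    next
      case q: False
      then have "4 \<le> q" using q3 by simp
      from class_number_bound_large[OF this m m2 e1 K1 KS n2] have "K n < q ^ n" .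
      then show ?thesis using False q unfolding KH SL_iff by simp
    qed
  qed
qed

end
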